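(* Let $1<p<\infty$. Then there is a constant $C>0$ such that for all $f\in L^p(\mathbb{R}^n)$ and $g\in\mathrm{bmo}(\mathbb{R}^n)$, $$\|fg\|_{J_{\mathrm{w}_1}(L^p(\mathbb{R}^n))}\le C\|f\|_{L^p(\mathbb{R}^n)}\|g\|_{\mathrm{bmo}(\mathbb{R}^n)}.$$
   Context: $fg$ is the pointwise product. $a(D)$ denotes the Fourier multiplier $\widehat{a(D)f}=a\widehat f$. Weight. $w_1(t)=1+\log_+(1/t)$. Fix a nonnegative, radial, radially decreasing Schwartz function $\varphi_0$ on $\mathbb{R}^n$, supported in $\{|x|\le3/2\}$ and equal to $1$ on $\{|x|\le1\}$; put $\varphi_1(x)=\varphi_0(x/2)-\varphi_0(x)$ and $\varphi_j(x)=\varphi_1(2^{-j+1}x)$ for $j\ge2$. The regularisation of $w_1$ is $\mathrm{w}_1(\xi)=\sum_{j\ge0}(1+j\log2)\varphi_j(\xi)$. Potential-type space. $J_{\mathrm{w}_1}(L^p(\mathbb{R}^n))=\{f\in\mathcal{S}'(\mathbb{R}^n):(1/\mathrm{w}_1)(D)f\in L^p(\mathbb{R}^n)\}$ with norm $\|f\|_{J_{\mathrm{w}_1}(L^p)}=\|(1/\mathrm{w}_1)(D)f\|_{L^p}$. Local bmo. $\mathrm{bmo}(\mathbb{R}^n)$ is the set of locally integrable $f$ with $\|f\|_{\mathrm{bmo}}=\sup_{\ell(Q)<1}\frac1{|Q|}\int_Q|f-f_Q|+\sup_{\ell(Q)\ge1}\frac1{|Q|}\int_Q|f|<\infty$,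 over cubes $Q$ with sides parallel to the axes and side length $\ell(Q)$, $f_Q=\frac1{|Q|}\int_Qf$. *)

theory Defs
  imports "HOL-Analysis.Analysis"
begin

text \<open>
  All function spaces consist of complex-valued functions on \<open>real ^ 'n\<close>; Lebesgue-measurable
  functions stand for their almost-everywhere classes.
\<close>

section \<open>Schwartz functions\<close>

definition partial_deriv ::
    "'n::finite \<Rightarrow> (real ^ 'n \<Rightarrow> 'b::real_normed_vector) \<Rightarrow> real ^ 'n \<Rightarrow> 'b" where
  "partial_deriv i f x = frechet_derivative f (at x) (axis i 1)"

definition iter_partial ::
    "'n::finite list \<Rightarrow> (real ^ 'n \<Rightarrow> 'b::real_normed_vector) \<Rightarrow> real ^ 'n \<Rightarrow> 'b" where
  "iter_partial is f = foldr partial_deriv is f"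

text \<open>Multi-indices are encoded as lists of coordinate directions. A function is smooth iff all
  its iterated partial derivatives exist and are differentiable.\<close>

definition schwartz :: "(real ^ 'n::finite \<Rightarrow> 'b::real_normed_vector) set" where
  "schwartz = {\<phi>. (\<forall>is x. iter_partial is \<phi> differentiable (at x)) \<and>
     (\<forall>is k. bdd_above (range (\<lambda>x. (1 + norm x) ^ k * norm (iter_partial is \<phi> x))))}"

definition schwartz_seminorm ::
    "nat \<Rightarrow> 'n::finite list \<Rightarrow> (real ^ 'n \<Rightarrow> 'b::real_normed_vector) \<Rightarrow> real" where
  "schwartz_seminorm k is \<phi> = (SUP x. (1 + norm x) ^ k * norm (iter_partial is \<phi> x))"

section \<open>Tempered distributions\<close>

text \<open>A distribution is a functional on all functions of which only the values on \<^const>\<open>schwartz\<close>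
  matter. Continuity for the Schwartz topology is expressed as boundedness by finitely
  many of the defining seminorms.\<close>

type_synonym 'n functional = "(real ^ 'n \<Rightarrow> complex) \<Rightarrow> complex"

definition tempered_distribution :: "'n::finite functional \<Rightarrow> bool" where
  "tempered_distribution T \<longleftrightarrow>
     (\<forall>\<phi>\<in>schwartz. \<forall>\<psi>\<in>schwartz. T (\<lambda>x. \<phi> x + \<psi> x) = T \<phi> + T \<psi>) \<and>
     (\<forall>\<phi>\<in>schwartz. \<forall>c. T (\<lambda>x. c * \<phi> x) = c * T \<phi>) \<and>
     (\<exists>C N. \<forall>\<phi>\<in>schwartz. norm (T \<phi>) \<le> C * (\<Sum>is | length is \<le> N. schwartz_seminorm N is \<phi>))"

definition locally_integrable :: "(real ^ 'n::finite \<Rightarrow> complex) \<Rightarrow> bool" where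
  "locally_integrable h \<longleftrightarrow> (\<forall>K. compact K \<longrightarrow> set_integrable lebesgue K h)"

definition function_distribution :: "(real ^ 'n::finite \<Rightarrow> complex) \<Rightarrow> 'n functional" where
  "function_distribution h \<phi> = (LINT x|lebesgue. h x * \<phi> x)"

text \<open>The Bochner integral of a non-integrable function is 0, so integrability of the pairings
  has to be required separately for \<open>h\<close> to be a tempered distribution.\<close>

definition tempered_function :: "(real ^ 'n::finite \<Rightarrow> complex) \<Rightarrow> bool" where
  "tempered_function h \<longleftrightarrow> locally_integrable h \<and>
     (\<forall>\<phi>\<in>schwartz. integrable lebesgue (\<lambda>x. h x * \<phi> x)) \<and>
     tempered_distribution (function_distribution h)"

section \<open>Fourier multipliers\<close>

text \<open>Convention: \<open>\<phi>^(\<xi>) = \<integral> exp (- i x \<bullet> \<xi>) \<phi>(x) dx\<close>, extended to distributions by duality.\<close>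

definition fourier :: "(real ^ 'n::finite \<Rightarrow> complex) \<Rightarrow> real ^ 'n \<Rightarrow> complex" where
  "fourier \<phi> \<xi> = (LINT x|lebesgue. cis (- (x \<bullet> \<xi>)) * \<phi> x)"

definition inv_fourier :: "(real ^ 'n::finite \<Rightarrow> complex) \<Rightarrow> real ^ 'n \<Rightarrow> complex" where
  "inv_fourier \<phi> x = of_real (1 / (2 * pi) ^ CARD('n)) * (LINT \<xi>|lebesgue. cis (x \<bullet> \<xi>) * \<phi> \<xi>)"

definition fourier_dist :: "'n::finite functional \<Rightarrow> 'n functional" where
  "fourier_dist T \<phi> = T (fourier \<phi>)"

definition inv_fourier_dist :: "'n::finite functional \<Rightarrow> 'n functional" where
  "inv_fourier_dist T \<phi> = T (inv_fourier \<phi>)"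

definition mult_dist :: "(real ^ 'n::finite \<Rightarrow> complex) \<Rightarrow> 'n functional \<Rightarrow> 'n functional" where
  "mult_dist a T \<phi> = T (\<lambda>\<xi>. a \<xi> * \<phi> \<xi>)"

definition fourier_multiplier ::
    "(real ^ 'n::finite \<Rightarrow> complex) \<Rightarrow> 'n functional \<Rightarrow> 'n functional" where
  "fourier_multiplier a T = inv_fourier_dist (mult_dist a (fourier_dist T))"

section \<open>Lebesgue spaces\<close>

definition Lp :: "real \<Rightarrow> (real ^ 'n::finite \<Rightarrow> complex) set" where
  "Lp p = {f. f \<in> borel_measurable lebesgue \<and> integrable lebesgue (\<lambda>x. norm (f x) powr p)}"

definition Lp_norm :: "real \<Rightarrow> (real ^ 'n::finite \<Rightarrow> complex) \<Rightarrow> real" where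
  "Lp_norm p f = (LINT x|lebesgue. norm (f x) powr p) powr (1 / p)"

definition Lp_represents :: "real \<Rightarrow> 'n::finite functional \<Rightarrow> (real ^ 'n \<Rightarrow> complex) \<Rightarrow> bool" where
  "Lp_represents p T h \<longleftrightarrow> h \<in> Lp p \<and> (\<forall>\<phi>\<in>schwartz. T \<phi> = function_distribution h \<phi>)"

text \<open>The representing function is unique up to null sets, so its choice is immaterial.\<close>

definition Lp_norm_dist :: "real \<Rightarrow> 'n::finite functional \<Rightarrow> real" where
  "Lp_norm_dist p T = Lp_norm p (SOME h. Lp_represents p T h)"

section \<open>The regularised logarithmic weight and its potential-type space\<close>

definition LP_cutoff :: "(real ^ 'n::finite \<Rightarrow> real) \<Rightarrow> bool" where
  "LP_cutoff \<phi>0 \<longleftrightarrow> \<phi>0 \<in> schwartz \<and> (\<forall>x. 0 \<le> \<phi>0 x) \<and>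
     (\<forall>x y. norm x = norm y \<longrightarrow> \<phi>0 x = \<phi>0 y) \<and>
     (\<forall>x y. norm x \<le> norm y \<longrightarrow> \<phi>0 y \<le> \<phi>0 x) \<and>
     closure {x. \<phi>0 x \<noteq> 0} \<subseteq> {x. norm x \<le> 3/2} \<and>
     (\<forall>x. norm x \<le> 1 \<longrightarrow> \<phi>0 x = 1)"

definition LP_piece1 :: "(real ^ 'n::finite \<Rightarrow> real) \<Rightarrow> real ^ 'n \<Rightarrow> real" where
  "LP_piece1 \<phi>0 x = \<phi>0 (x /\<^sub>R 2) - \<phi>0 x"

definition LP_piece :: "(real ^ 'n::finite \<Rightarrow> real) \<Rightarrow> nat \<Rightarrow> real ^ 'n \<Rightarrow> real" where
  "LP_piece \<phi>0 j x = (if j = 0 then \<phi>0 x else LP_piece1 \<phi>0 ((2 powr (1 - real j)) *\<^sub>R x))"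

text \<open>At each point only finitely many terms of the series are nonzero.\<close>

definition log_weight :: "(real ^ 'n::finite \<Rightarrow> real) \<Rightarrow> real ^ 'n \<Rightarrow> real" where
  "log_weight \<phi>0 \<xi> = (\<Sum>j. (1 + real j * ln 2) * LP_piece \<phi>0 j \<xi>)"

definition inv_weight_mult ::
    "(real ^ 'n::finite \<Rightarrow> real) \<Rightarrow> 'n functional \<Rightarrow> 'n functional" where
  "inv_weight_mult \<phi>0 T = fourier_multiplier (\<lambda>\<xi>. of_real (1 / log_weight \<phi>0 \<xi>)) T"

definition J_space :: "(real ^ 'n::finite \<Rightarrow> real) \<Rightarrow> real \<Rightarrow> 'n functional set" where
  "J_space \<phi>0 p = {T. tempered_distribution T \<and> (\<exists>h. Lp_represents p (inv_weight_mult \<phi>0 T) h)}"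

definition J_norm :: "(real ^ 'n::finite \<Rightarrow> real) \<Rightarrow> real \<Rightarrow> 'n functional \<Rightarrow> real" where
  "J_norm \<phi>0 p T = Lp_norm_dist p (inv_weight_mult \<phi>0 T)"

section \<open>Local bmo\<close>

definition cube :: "real ^ 'n::finite \<Rightarrow> real \<Rightarrow> (real ^ 'n) set" where
  "cube a l = cbox a (\<chi> i. a $ i + l)"

definition avg :: "(real ^ 'n::finite) set \<Rightarrow> (real ^ 'n \<Rightarrow> 'b::{banach, second_countable_topology}) \<Rightarrow> 'b"
  where "avg Q f = (LINT x:Q|lebesgue. f x) /\<^sub>R measure lebesgue Q"

definition bmo_small :: "(real ^ 'n::finite \<Rightarrow> complex) \<Rightarrow> real set" where
  "bmo_small f = {avg (cube a l) (\<lambda>x. norm (f x - avg (cube a l) f)) | a l. 0 < l \<and> l < 1}"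

definition bmo_large :: "(real ^ 'n::finite \<Rightarrow> complex) \<Rightarrow> real set" where
  "bmo_large f = {avg (cube a l) (\<lambda>x. norm (f x)) | a l. 1 \<le> l}"

definition bmo :: "(real ^ 'n::finite \<Rightarrow> complex) set" where
  "bmo = {f. locally_integrable f \<and> bdd_above (bmo_small f) \<and> bdd_above (bmo_large f)}"

definition bmo_norm :: "(real ^ 'n::finite \<Rightarrow> complex) \<Rightarrow> real" where
  "bmo_norm f = Sup (bmo_small f) + Sup (bmo_large f)"

end

theory Submission
  imports Defs
begin

text \<open>
  Telescoping the weight, \<open>1/w = \<Sum>j. m j\<close>, where \<open>m j\<close> is \<open>O(j^-2)\<close> times a bump adapted to the ball
  of radius \<open>2^j\<close>. Hence \<open>(1/w)(D)\<close> is convolution with an integrable kernel that is dominated by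
  \<open>\<Sum>j. (1 + j)^-2 2^(j n) (1 + 2^j \<bar>x\<bar>)^-(n+1)\<close>, and no cancellation is needed: the estimate holds
  for this positive kernel. By the one-third trick it suffices to bound
  \<open>S = \<Sum>j. (1 + j)^-2 E j (f g)\<close> for \<open>f, g \<ge> 0\<close>, with \<open>E j\<close> the averaging over dyadic cells of side
  \<open>2^-j\<close>. If \<open>S j\<close> are the partial sums, then \<open>S^p \<le> p (\<Sum>j. (1 + j)^-2 E j (f g) (S j)^(p-1))\<close>, and as
  \<open>S j\<close> is constant on the cells of level \<open>j\<close>, the integral of the right-hand side is that of
  \<open>p f (\<Sum>j. (1 + j)^-2 g (S j)^(p-1))\<close>. The terms with \<open>1 + j\<close> at least a multiple of \<open>g\<close> add up to
  \<open>O(f S^(p-1))\<close>. In the remaining ones \<open>g\<close> is so large that, by the John--Nirenberg inequality, its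
  moments over cells of level \<open>j\<close> stay bounded. Young's inequality then allows one to absorb \<open>S^p\<close>.
\<close>

section \<open>Dilations and the decay profile\<close>

text \<open>A product of an L^p function and a bmo function may miss L^p by one logarithm, since g
  is only exponentially integrable; the weights \<open>(1 + j)^-2\<close> repay it. Summed over the
  j with \<open>g <= (1 + j) L\<close> they give \<open>O(L / g)\<close>, which cancels the factor
  g. Where g is larger, the density 2^(j n) of a level-j cell in a unit cell must be beaten;
  exponential integrability over unit cells does so once L is a large enough multiple of n, which is
  why the threshold grows linearly in j. The factor \<open>S j\<close> may include level j itself:
  convexity puts the derivative of t^p at the right endpoint, and this endpoint is still constant on
  cells of level j. Absorption needs finiteness beforehand, so finitely many levels are treated
  first, with a bound independent of their number. The bmo averages over cubes of side 1 bound the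
  means over unit cells, where the John--Nirenberg argument starts; larger scales enter only through
  the tail of the kernel. The norm of the target space is evaluated at an arbitrarily chosen
  representative, hence the uniqueness argument.\<close>

lemma nn_integral_lborel_affine:
  fixes f :: "'a::euclidean_space \<Rightarrow> ennreal"
  assumes [measurable]: "f \<in> borel_measurable borel" and c: "c \<noteq> 0"
  shows "(\<integral>\<^sup>+x. f x \<partial>lborel) = ennreal (\<bar>c\<bar> ^ DIM('a)) * (\<integral>\<^sup>+x. f (t + c *\<^sub>R x) \<partial>lborel)"
  by (subst lborel_affine[OF c, of t])
     (simp add: nn_integral_density nn_integral_distr nn_integral_cmult)

lemma integrable_lborel_affine:
  fixes f :: "'a::euclidean_space \<Rightarrow> 'b::{banach, second_countable_topology}"
  assumes [measurable]: "f \<in> borel_measurable borel" and c: "c \<noteq> 0"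
  shows "integrable lborel (\<lambda>x. f (t + c *\<^sub>R x)) \<longleftrightarrow> integrable lborel f"
proof -
  have "(\<integral>\<^sup>+x. ennreal (norm (f x)) \<partial>lborel)
      = ennreal (\<bar>c\<bar> ^ DIM('a)) * (\<integral>\<^sup>+x. ennreal (norm (f (t + c *\<^sub>R x))) \<partial>lborel)"
    by (rule nn_integral_lborel_affine) (use c in auto)
  moreover have "ennreal (\<bar>c\<bar> ^ DIM('a)) \<noteq> 0" "ennreal (\<bar>c\<bar> ^ DIM('a)) < top"
    using c by (auto simp: ennreal_eq_0_iff not_le)
  ultimately show ?thesis
    unfolding integrable_iff_bounded by (auto simp: ennreal_mult_less_top)
qed

lemma integral_lborel_affine:
  fixes f :: "'a::euclidean_space \<Rightarrow> 'b::{banach, second_countable_topology}"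
  assumes [measurable]: "f \<in> borel_measurable borel" and c: "c \<noteq> 0"
  shows "(LINT x|lborel. f x) = \<bar>c\<bar> ^ DIM('a) *\<^sub>R (LINT x|lborel. f (t + c *\<^sub>R x))"
  by (subst lborel_affine[OF c, of t]) (simp add: integral_density integral_distr)

lemma integral_lborel_translate:
  fixes f :: "'a::euclidean_space \<Rightarrow> 'b::{banach, second_countable_topology}"
  assumes [measurable]: "f \<in> borel_measurable borel"
  shows "(LINT x|lborel. f (x + t)) = (LINT x|lborel. f x)"
  using integral_lborel_affine[of f 1 t] by (simp add: add.commute)

lemma integrable_lborel_translate:
  fixes f :: "'a::euclidean_space \<Rightarrow> 'b::{banach, second_countable_topology}"
  assumes [measurable]: "f \<in> borel_measurable borel"
  shows "integrable lborel (\<lambda>x. f (x + t)) \<longleftrightarrow> integrable lborel f"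
  using integrable_lborel_affine[of f 1 t] by (simp add: add.commute)

text \<open>The exponent n + 1 is the least integer for which this profile is integrable on
  \<open>real ^ 'n\<close>; accordingly n + 1 derivatives of a symbol are used below.\<close>

definition decay :: "real ^ 'n::finite \<Rightarrow> real" where
  "decay x = 1 / (1 + norm x) ^ (CARD('n) + 1)"

lemma decay_pos: "0 < decay x"
  unfolding decay_def by (simp add: add_pos_nonneg)

lemma abs_decay [simp]: "\<bar>decay x\<bar> = decay x"
  using decay_pos[of x] by simp

lemma cis_measurable [measurable]: "cis \<in> borel_measurable borel"
  by (intro borel_measurable_continuous_onI continuous_intros)

lemma decay_le_1: "decay x \<le> 1"
proof -
  have "1 \<le> (1 + norm x) ^ (CARD('a) + 1)"
    by (rule one_le_power) simp
  then show ?thesis unfolding decay_def by (simp add: divide_le_eq_1)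
qed

lemma decay_measurable [measurable]: "decay \<in> borel_measurable borel"
  unfolding decay_def by measurable

text \<open>Rests on \<open>1 + |x| <= (1 + r) (1 + |x + y|)\<close>. It makes the profile
  essentially constant on bounded sets: on segments of length 1 for difference quotients, and on
  unit cells for the tail of the kernel.\<close>

lemma decay_shift:
  fixes x y :: "real ^ 'n::finite"
  assumes "norm y \<le> r" "0 \<le> r"
  shows "decay (x + y) \<le> (1 + r) ^ (CARD('n) + 1) * decay x"
proof -
  have "norm x \<le> norm (x + y) + r"
    using norm_triangle_ineq4[of "x + y" y] assms by simp
  moreover have "(1 + r) * (1 + norm (x + y)) = 1 + norm (x+y) + r + r * norm (x + y)"
    by (simp add: algebra_simps)
  ultimately have "1 + norm x \<le> (1 + r) * (1 + norm (x + y))"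
    using mult_nonneg_nonneg[OF \<open>0 \<le> r\<close> norm_ge_zero[of "x + y"]] by linarith
  then have "(1 + norm x) ^ (CARD('n) + 1) \<le> ((1 + r) * (1 + norm (x + y))) ^ (CARD('n) + 1)"
    by (intro power_mono) auto
  then show ?thesis
    unfolding decay_def by (simp add: divide_simps power_mult_distrib add_pos_nonneg mult_ac)
qed

text \<open>The dyadic shells \<open>2^k - 1 \<le> \<bar>x\<bar> < 2^(k+1) - 1\<close> contribute \<open>O(2^-k)\<close>.\<close>

lemma integrable_decay: "integrable lborel (decay :: real ^ 'n::finite \<Rightarrow> real)"
proof -
  let ?n = "CARD('n)"
  let ?B = "\<lambda>k. ball (0::real^'n) (2 ^ Suc k)"
  let ?V = "emeasure lborel (ball (0::real^'n) 1)"
  have V: "?V < \<infinity>" using emeasure_lborel_ball_finite[of "0::real^'n" 1] by simp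
  have [measurable, simp]: "ball (0::real^'n) r \<in> sets borel" for r by (intro borel_open open_ball)
  have EB: "emeasure lborel (?B k) = ennreal ((2 ^ Suc k) ^ ?n) * ?V" for k
  proof -
    have "emeasure lborel (?B k) = (\<integral>\<^sup>+x. indicator (?B k) x \<partial>lborel)" by simp
    also have "\<dots> = ennreal (\<bar>2 ^ Suc k\<bar> ^ DIM(real^'n)) *
        (\<integral>\<^sup>+x. indicator (?B k) (0 + (2 ^ Suc k) *\<^sub>R x) \<partial>lborel)"
      by (rule nn_integral_lborel_affine) (auto intro!: borel_measurable_indicator)
    also have "(\<lambda>x. indicator (?B k) (0 + (2 ^ Suc k) *\<^sub>R x) :: ennreal)
        = indicator (ball (0::real^'n) 1)"
      by (auto simp: indicator_def fun_eq_iff abs_if)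
    also have "(\<integral>\<^sup>+x. indicator (ball (0::real^'n) 1) x \<partial>lborel) = ?V" by simp
    finally show ?thesis by simp
  qed
  have bound: "ennreal (decay x) \<le> (\<Sum>k. ennreal (1 / (2 ^ k) ^ (?n + 1)) * indicator (?B k) x)" for x :: "real^'n"
  proof -
    obtain m where m: "1 + norm x < 2 ^ m" using real_arch_pow[of 2 "1 + norm x"] by auto
    define k where "k = (LEAST m. 1 + norm x < 2 ^ m)"
    have k1: "1 + norm x < 2 ^ k" unfolding k_def by (rule LeastI[of _ m]) (rule m)
    then have "k \<noteq> 0" by (cases k) auto
    then obtain j where j: "k = Suc j" by (cases k) auto
    have "\<not> 1 + norm x < 2 ^ j" using not_less_Least[of j "\<lambda>m. 1 + norm x < 2 ^ m"] j k_def by auto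
    then have "2 ^ j \<le> 1 + norm x" by simp
    then have "(2 ^ j) ^ (?n + 1) \<le> (1 + norm x) ^ (?n + 1)" by (intro power_mono) auto
    then have d: "decay x \<le> 1 / (2 ^ j) ^ (?n + 1)"
      unfolding decay_def by (intro divide_left_mono) (auto simp: add_pos_nonneg)
    have "ennreal (decay x) \<le> ennreal (1 / (2 ^ j) ^ (?n + 1)) * indicator (?B j) x"
      using d k1 j by (auto simp: indicator_def intro!: ennreal_leI)
    also have "\<dots> \<le> (\<Sum>k. ennreal (1 / (2 ^ k) ^ (?n + 1)) * indicator (?B k) x)"
      using sum_le_suminf[of "\<lambda>k. ennreal (1 / (2 ^ k) ^ (?n + 1)) * indicator (?B k) x" "{j}"]
      by (simp del: sum_mult_indicator)
    finally show ?thesis .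
  qed
  have "(\<integral>\<^sup>+x. ennreal (decay (x :: real^'n)) \<partial>lborel)
      \<le> (\<integral>\<^sup>+x. (\<Sum>k. ennreal (1 / (2 ^ k) ^ (?n + 1)) * indicator (?B k) x) \<partial>lborel)"
    by (intro nn_integral_mono bound)
  also have "\<dots> = (\<Sum>k. ennreal (1 / (2 ^ k) ^ (?n + 1)) * emeasure lborel (?B k))"
    by (subst nn_integral_suminf) (auto simp: nn_integral_cmult)
  \<comment> \<open>The ball has volume of order \<open>(2 ^ Suc k) ^ n\<close> against the height
    \<open>1 / (2 ^ k) ^ (n + 1)\<close>; the surplus power leaves a geometric series.\<close>
  also have "\<dots> = (\<Sum>k. ennreal (2 ^ ?n * (1/2) ^ k) * ?V)"
    unfolding EB mult.assoc[symmetric]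
    by (intro suminf_cong arg_cong2[where f="(*)"] refl)
       (auto simp: ennreal_mult'[symmetric] field_simps power_mult_distrib power_one_over)
  also have "\<dots> = (\<Sum>k. ennreal (2 ^ ?n * (1/2) ^ k)) * ?V" by simp
  also have "(\<Sum>k. ennreal (2 ^ ?n * (1/2) ^ k)) = ennreal (\<Sum>k. 2 ^ ?n * (1/2) ^ k)"
    by (intro suminf_ennreal2 summable_mult summable_geometric) auto
  also have "\<dots> * ?V < \<infinity>" using V by (auto simp: ennreal_mult_less_top)
  finally show ?thesis
    unfolding integrable_iff_bounded by (simp add: abs_of_pos[OF decay_pos])
qed

section \<open>Fourier transforms of smooth families\<close>

text \<open>Families \<open>F t\<close> with \<open>k\<close> derivatives in the coordinate direction \<open>i\<close>, all of size
  \<open>O((1 + \<bar>x\<bar>)^-e)\<close> uniformly in \<open>t\<close>.\<close>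

primrec unif_smooth :: "'n::finite \<Rightarrow> nat \<Rightarrow> nat \<Rightarrow> ('t \<Rightarrow> real ^ 'n \<Rightarrow> complex) \<Rightarrow> bool" where
  "unif_smooth i e 0 F \<longleftrightarrow> (\<forall>t. F t \<in> borel_measurable borel) \<and>
     (\<exists>C. \<forall>t x. norm (F t x) * (1 + norm x) ^ e \<le> C)"
| "unif_smooth i e (Suc k) F \<longleftrightarrow> (\<forall>t. F t \<in> borel_measurable borel) \<and>
     (\<exists>C. \<forall>t x. norm (F t x) * (1 + norm x) ^ e \<le> C) \<and>
     (\<exists>G. (\<forall>t x. ((\<lambda>s. F t (x + s *\<^sub>R axis i 1)) has_vector_derivative G t x) (at 0)) \<and>
       unif_smooth i e k G)"

lemma unif_smooth_base:
  assumes "unif_smooth i e k F"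
  shows "F t \<in> borel_measurable borel" "\<exists>C\<ge>0. \<forall>t x. norm (F t x) * (1 + norm x) ^ e \<le> C"
proof -
  show "F t \<in> borel_measurable borel" using assms by (cases k) auto
  obtain C where C: "\<And>t x. norm (F t x) * (1 + norm x) ^ e \<le> C" using assms by (cases k) auto
  have "norm (F t x) * (1 + norm x) ^ e \<le> max C 0" for t x
    using C[of t x] by simp
  then show "\<exists>C\<ge>0. \<forall>t x. norm (F t x) * (1 + norm x) ^ e \<le> C"
    by (intro exI[of _ "max C 0"]) auto
qed

lemma unif_smooth_Suc:
  assumes "unif_smooth i e (Suc k) F"
  shows "unif_smooth i e k F"
  using assms
proof (induction k arbitrary: F)
  case (Suc k)
  then show ?case by (subst unif_smooth.simps(2)) (use Suc in \<open>auto\<close>)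
qed auto

section \<open>Algebra of uniformly smooth families\<close>

lemma unif_smooth_add:
  fixes F G :: "'t \<Rightarrow> real ^ 'n::finite \<Rightarrow> complex"
  assumes "unif_smooth i e k F" "unif_smooth i e k G"
  shows "unif_smooth i e k (\<lambda>t x. F t x + G t x)"
  using assms
proof (induction k arbitrary: F G)
  have bound: "\<exists>C. \<forall>t x. norm (F t x + G t x) * (1 + norm x) ^ e \<le> C"
    if F: "unif_smooth i e k F" and G: "unif_smooth i e k G" for k and F G :: "'t \<Rightarrow> real^'n \<Rightarrow> complex"
  proof -
    obtain C D where CD: "\<And>t x. norm (F t x) * (1 + norm x) ^ e \<le> C"
      "\<And>t x. norm (G t x) * (1 + norm x) ^ e \<le> D"
      using unif_smooth_base(2)[OF F] unif_smooth_base(2)[OF G] by metis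
    have "norm (F t x + G t x) * (1 + norm x) ^ e \<le> C + D" for t x
    proof -
      have "norm (F t x + G t x) * (1 + norm x) ^ e \<le> (norm (F t x) + norm (G t x)) * (1 + norm x) ^ e"
        by (intro mult_right_mono norm_triangle_ineq) auto
      also have "\<dots> \<le> C + D" using CD[where t=t and x=x] by (simp add: algebra_simps)
      finally show ?thesis .
    qed
    then show ?thesis by blast
  qed
  {
    case 0
    show ?case
      using unif_smooth_base(1)[OF 0(1)] unif_smooth_base(1)[OF 0(2)] bound[OF 0] by simp
  next
    case (Suc k)
    obtain F' G' where
      F': "\<And>t x. ((\<lambda>s. F t (x + s *\<^sub>R axis i 1)) has_vector_derivative F' t x) (at 0)" "unif_smooth i e k F'" and
      G': "\<And>t x. ((\<lambda>s. G t (x + s *\<^sub>R axis i 1)) has_vector_derivative G' t x) (at 0)" "unif_smooth i e k G'"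
      using Suc.prems by auto
    have "\<forall>t x. ((\<lambda>s. F t (x + s *\<^sub>R axis i 1) + G t (x + s *\<^sub>R axis i 1)) has_vector_derivative
        (F' t x + G' t x)) (at 0)"
      using F' G' by (auto intro: has_vector_derivative_add)
    moreover have "unif_smooth i e k (\<lambda>t x. F' t x + G' t x)" by (rule Suc.IH) (use F' G' in auto)
    ultimately show ?case
      using unif_smooth_base(1)[OF Suc.prems(1)] unif_smooth_base(1)[OF Suc.prems(2)] bound[OF Suc.prems]
      by (subst unif_smooth.simps(2)) (auto intro!: exI[of _ "\<lambda>t x. F' t x + G' t x"])
  }
qed

text \<open>Decay exponents add, so multiplying by a bounded smooth family (exponent 0) costs
  nothing; this is how \<open>shell\<close> inherits the decay of the cutoff.\<close>

lemma unif_smooth_mult: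
  fixes F G :: "'t \<Rightarrow> real ^ 'n::finite \<Rightarrow> complex"
  assumes "unif_smooth i d k F" "unif_smooth i e k G"
  shows "unif_smooth i (d + e) k (\<lambda>t x. F t x * G t x)"
  using assms
proof (induction k arbitrary: F G)
  have bound: "\<exists>C. \<forall>t x. norm (F t x * G t x) * (1 + norm x) ^ (d + e) \<le> C"
    if F: "unif_smooth i d k F" and G: "unif_smooth i e k G" for k and F G :: "'t \<Rightarrow> real^'n \<Rightarrow> complex"
  proof -
    obtain C D where CD: "\<And>t x. norm (F t x) * (1 + norm x) ^ d \<le> C"
      "\<And>t x. norm (G t x) * (1 + norm x) ^ e \<le> D" "C \<ge> 0"
      using unif_smooth_base(2)[OF F] unif_smooth_base(2)[OF G] by metis
    have "norm (F t x * G t x) * (1 + norm x) ^ (d + e) \<le> C * D" for t x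
    proof -
      have "norm (F t x * G t x) * (1 + norm x) ^ (d + e) =
          (norm (F t x) * (1 + norm x) ^ d) * (norm (G t x) * (1 + norm x) ^ e)"
        by (simp add: norm_mult power_add mult_ac)
      also have "\<dots> \<le> C * D" using CD by (intro mult_mono) auto
      finally show ?thesis .
    qed
    then show ?thesis by blast
  qed
  {
    case 0
    show ?case
      using unif_smooth_base(1)[OF 0(1)] unif_smooth_base(1)[OF 0(2)] bound[OF 0] by simp
  next
    case (Suc k)
    obtain F' G' where
      F': "\<And>t x. ((\<lambda>s. F t (x + s *\<^sub>R axis i 1)) has_vector_derivative F' t x) (at 0)" "unif_smooth i d k F'" and
      G': "\<And>t x. ((\<lambda>s. G t (x + s *\<^sub>R axis i 1)) has_vector_derivative G' t x) (at 0)" "unif_smooth i e k G'"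
      using Suc.prems by auto
    have "((\<lambda>s. F t (x + s *\<^sub>R axis i 1) * G t (x + s *\<^sub>R axis i 1)) has_vector_derivative
        (F t x * G' t x + F' t x * G t x)) (at 0)" for t x
      using has_vector_derivative_mult[OF F'(1)[of t x] G'(1)[of t x]] by simp
    \<comment> \<open>The Leibniz rule pairs a derivative, of order k, with an undifferentiated
      factor, of order \<open>Suc k\<close>; \<open>unif_smooth_Suc\<close> lowers the latter to
      k.\<close>
    moreover have "unif_smooth i (d + e) k (\<lambda>t x. F t x * G' t x + F' t x * G t x)"
      by (rule unif_smooth_add; rule Suc.IH)
         (use F'(2) G'(2) unif_smooth_Suc[OF Suc.prems(1)] unif_smooth_Suc[OF Suc.prems(2)] in auto)
    ultimately show ?case
      using unif_smooth_base(1)[OF Suc.prems(1)] unif_smooth_base(1)[OF Suc.prems(2)] bound[OF Suc.prems]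
      by (subst unif_smooth.simps(2)) (auto intro!: exI[of _ "\<lambda>t x. F t x * G' t x + F' t x * G t x"])
  }
qed

lemma unif_smooth_const:
  fixes c :: "'t \<Rightarrow> complex"
  assumes "\<And>t. norm (c t) \<le> C"
  shows "unif_smooth i 0 k (\<lambda>t x. c t)"
  using assms
proof (induction k arbitrary: c C)
  case (Suc k)
  have "unif_smooth i 0 k (\<lambda>t::'t. \<lambda>x. 0)" by (rule Suc.IH[where C=0]) simp
  then show ?case using Suc.prems by (auto intro!: exI[of _ "\<lambda>t x. 0"])
qed auto

text \<open>The derivative of 1/F is -F'/F^2, a product of families already under control at order
  k. The common lower bound \<open>c\<close> makes all constants independent of the
  parameter.\<close>

lemma unif_smooth_inverse:
  fixes F :: "'t \<Rightarrow> real ^ 'n::finite \<Rightarrow> complex"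
  assumes F: "unif_smooth i 0 k F" and c: "c > 0" "\<And>t x. norm (F t x) \<ge> c"
  shows "unif_smooth i 0 k (\<lambda>t x. inverse (F t x))"
  using F
proof (induction k)
  have b: "\<exists>C. \<forall>t x. norm (inverse (F t x)) * (1 + norm x) ^ 0 \<le> C"
    using c by (intro exI[of _ "inverse c"]) (auto simp: norm_inverse intro!: le_imp_inverse_le)
  {
    case 0
    then show ?case using b by (auto intro: borel_measurable_inverse)
  next
    case (Suc k)
    obtain F' where
      F': "\<And>t x. ((\<lambda>s. F t (x + s *\<^sub>R axis i 1)) has_vector_derivative F' t x) (at 0)" "unif_smooth i 0 k F'"
      using Suc.prems by auto
    have "((\<lambda>s. inverse (F t (x + s *\<^sub>R axis i 1))) has_vector_derivative
        (-1) * (inverse (F t x) * inverse (F t x) * F' t x)) (at 0)" for t x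
    proof -
      have nz: "F t x \<noteq> 0" using c(1) c(2)[of t x] by auto
      have "(inverse has_field_derivative - (inverse (F t x) ^ Suc (Suc 0)))
          (at (F t (x + 0 *\<^sub>R axis i 1)))"
        using DERIV_inverse[OF nz] by simp
      from field_vector_diff_chain_at[OF F'(1)[of t x] this] show ?thesis
        by (simp add: o_def power2_eq_square mult_ac)
    qed
    moreover have "unif_smooth i 0 k (\<lambda>t x. (-1) * (inverse (F t x) * inverse (F t x) * F' t x))"
    proof -
      have 1: "unif_smooth i 0 k (\<lambda>t x. inverse (F t x))"
        using Suc.IH unif_smooth_Suc[OF Suc.prems] by blast
      have 2: "unif_smooth i 0 k (\<lambda>(t::'t) x. (-1)::complex)"
        by (rule unif_smooth_const[where C=1]) simp
      show ?thesis
        using unif_smooth_mult[OF 2 unif_smooth_mult[OF unif_smooth_mult[OF 1 1] F'(2)]] by simp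
    qed
    ultimately show ?case
      using unif_smooth_base(1)[OF Suc.prems] b
      by (subst unif_smooth.simps(2))
         (auto intro!: exI[of _ "\<lambda>t x. (-1) * (inverse (F t x) * inverse (F t x) * F' t x)"])
  }
qed

section \<open>Decay of Fourier integrals by integration by parts\<close>

lemma bound_decay:
  fixes f :: "'t \<Rightarrow> real ^ 'n::finite \<Rightarrow> 'b::real_normed_vector"
  assumes "norm (f t x) * (1 + norm x) ^ (CARD('n) + 1) \<le> C"
  shows "norm (f t x) \<le> C * decay x"
  using assms unfolding decay_def by (simp add: divide_simps add_pos_nonneg mult_ac)

text \<open>Integrals are translation invariant, so the difference quotients integrate to 0.\<close>

lemma integral_dir_derivative_eq_0:
  fixes f f' :: "real ^ 'n::finite \<Rightarrow> complex"
  assumes meas: "f \<in> borel_measurable borel" "f' \<in> borel_measurable borel"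
    and der: "\<And>x. ((\<lambda>s. f (x + s *\<^sub>R axis i 1)) has_vector_derivative f' x) (at 0)"
    and f: "\<And>x. norm (f x) \<le> C * decay x" and f': "\<And>x. norm (f' x) \<le> C * decay x"
  shows "(LINT x|lborel. f' x) = 0"
proof -
  let ?e = "axis i 1 :: real ^ 'n"
  let ?h = "\<lambda>k. 1 / real (Suc k)"
  let ?q = "\<lambda>k x. (f (x + ?h k *\<^sub>R ?e) - f x) /\<^sub>R ?h k"
  have [measurable]: "f \<in> borel_measurable borel" "f' \<in> borel_measurable borel" by (fact meas)+
  have C: "C \<ge> 0" using f[of 0] decay_pos[of "0::real^'n"]
    by (meson dual_order.trans norm_ge_zero zero_le_mult_iff linorder_not_less)
  have int: "integrable lborel f"
    by (rule Bochner_Integration.integrable_bound[of lborel "\<lambda>x. C * decay x"])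
       (use f C in \<open>auto simp: integrable_decay abs_mult\<close>)
  have der': "((\<lambda>s. f (x + s *\<^sub>R ?e)) has_vector_derivative f' (x + u *\<^sub>R ?e)) (at u)" for x u
  proof -
    have "(((\<lambda>s. f (x + u *\<^sub>R ?e + s *\<^sub>R ?e)) \<circ> (\<lambda>s. s - u)) has_vector_derivative 1 *\<^sub>R f' (x + u *\<^sub>R ?e)) (at u)"
      by (rule vector_diff_chain_at) (use der[of "x + u *\<^sub>R ?e"] in \<open>auto intro!: derivative_eq_intros\<close>)
    then show ?thesis by (simp add: o_def algebra_simps)
  qed
  have lim: "(\<lambda>k. ?q k x) \<longlonglongrightarrow> f' x" for x
  proof -
    have "((\<lambda>s. (f (x + s *\<^sub>R ?e) - f x) /\<^sub>R s) \<longlongrightarrow> f' x) (at 0)"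
    proof -
      have "((\<lambda>s. norm (f (x + s *\<^sub>R ?e) - f x - s *\<^sub>R f' x) / norm s) \<longlongrightarrow> 0) (at 0)"
        using der[of x] by (simp add: has_vector_derivative_def has_derivative_at)
      moreover have "\<forall>\<^sub>F s in at 0. norm (f (x + s *\<^sub>R ?e) - f x - s *\<^sub>R f' x) / norm s
          = norm ((f (x + s *\<^sub>R ?e) - f x) /\<^sub>R s - f' x)"
      proof (rule eventually_mono[OF eventually_neq_at_within])
        fix s :: real assume "s \<noteq> 0"
        then have "(f (x + s *\<^sub>R ?e) - f x) /\<^sub>R s - f' x = (f (x + s *\<^sub>R ?e) - f x - s *\<^sub>R f' x) /\<^sub>R s"
          by (simp add: scaleR_diff_right)
        then show "norm (f (x + s *\<^sub>R ?e) - f x - s *\<^sub>R f' x) / norm s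
          = norm ((f (x + s *\<^sub>R ?e) - f x) /\<^sub>R s - f' x)" by (simp add: divide_inverse mult.commute)
      qed
      ultimately have "((\<lambda>s. norm ((f (x + s *\<^sub>R ?e) - f x) /\<^sub>R s - f' x)) \<longlongrightarrow> 0) (at 0)"
        by (rule Lim_transform_eventually)
      then show ?thesis by (simp add: tendsto_norm_zero_iff LIM_zero_iff)
    qed
    moreover have "filterlim ?h (at 0) sequentially"
      unfolding filterlim_at using lim_inverse_n' LIMSEQ_Suc by fastforce
    ultimately show ?thesis by (rule filterlim_compose)
  qed
  \<comment> \<open>Domination of the quotients by the mean value inequality: the segment stays
    within distance 1 of x, so \<open>decay_shift\<close> with r = 1 gives the factor
    \<open>2 ^ (CARD('n) + 1)\<close>.\<close>
  have bound: "norm (?q k x) \<le> C * 2 ^ (CARD('n) + 1) * decay x" for k x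
  proof -
    have "norm (f (x + ?h k *\<^sub>R ?e) - f (x + 0 *\<^sub>R ?e)) \<le> (C * 2 ^ (CARD('n) + 1) * decay x) * norm (?h k - 0)"
    proof (rule differentiable_bound[where S="{0..?h k}" and f'="\<lambda>u s. s *\<^sub>R f' (x + u *\<^sub>R ?e)"])
      fix u assume u: "u \<in> {0..?h k}"
      show "((\<lambda>s. f (x + s *\<^sub>R ?e)) has_derivative (\<lambda>s. s *\<^sub>R f' (x + u *\<^sub>R ?e))) (at u within {0..?h k})"
        using has_vector_derivative_at_within[OF der'] by (simp add: has_vector_derivative_def)
      have "?h k \<le> 1" by simp
      then have "u \<le> 1" using u by (auto intro: order_trans simp del: divide_le_eq_1 divide_le_eq_1_pos)
      then have "decay (x + u *\<^sub>R ?e) \<le> (1 + 1) ^ (CARD('n) + 1) * decay x"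
        by (intro decay_shift) (use u in auto)
      then have "C * decay (x + u *\<^sub>R ?e) \<le> C * (2 ^ (CARD('n) + 1) * decay x)"
        using C by (intro mult_left_mono) auto
      then have "norm (f' (x + u *\<^sub>R ?e)) \<le> C * 2 ^ (CARD('n) + 1) * decay x"
        using f'[of "x + u *\<^sub>R ?e"] by simp
      then show "onorm (\<lambda>s. s *\<^sub>R f' (x + u *\<^sub>R ?e)) \<le> C * 2 ^ (CARD('n) + 1) * decay x"
        by (intro onorm_le) (auto simp: mult.commute intro: mult_left_mono)
    qed auto
    then show ?thesis by (simp add: divide_simps mult_ac)
  qed
  have "(\<lambda>k. LINT x|lborel. ?q k x) \<longlonglongrightarrow> (LINT x|lborel. f' x)"
    by (rule integral_dominated_convergence[where w="\<lambda>x. C * 2 ^ (CARD('n) + 1) * decay x"])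
       (use lim bound in \<open>auto simp: integrable_decay\<close>)
  moreover have "(LINT x|lborel. ?q k x) = 0" for k
    using int integral_lborel_translate[of f "?h k *\<^sub>R ?e"] integrable_lborel_translate[of f "?h k *\<^sub>R ?e"]
    by simp
  ultimately show ?thesis by (simp add: LIMSEQ_const_iff)
qed

text \<open>Each integration by parts along direction \<open>i\<close> trades one derivative of F
  for one factor \<open>\<xi> $ i\<close>, with a constant uniform in the parameter.\<close>

lemma fourier_coordinate_decay:
  fixes F :: "'t \<Rightarrow> real ^ 'n::finite \<Rightarrow> complex"
  assumes "unif_smooth i (CARD('n) + 1) k F"
  shows "\<exists>C. \<forall>t \<xi>. \<bar>\<xi> $ i\<bar> ^ k * norm (LINT x|lborel. cis (x \<bullet> \<xi>) * F t x) \<le> C"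
  using assms
proof (induction k arbitrary: F)
  case 0
  obtain C where C: "\<And>t x. norm (F t x) * (1 + norm x) ^ (CARD('n) + 1) \<le> C" using 0 by auto
  have F: "norm (F t x) \<le> C * decay x" for t x by (rule bound_decay) (rule C)
  have [measurable]: "F t \<in> borel_measurable borel" for t by (rule unif_smooth_base(1)[OF 0])
  have "norm (LINT x|lborel. cis (x \<bullet> \<xi>) * F t x) \<le> (LINT x|lborel. C * decay (x::real^'n))" for t \<xi>
  proof -
    have "integrable lborel (\<lambda>x. cis (x \<bullet> \<xi>) * F t x)"
      by (rule Bochner_Integration.integrable_bound[of lborel "\<lambda>x. C * decay x"])
         (use F in \<open>auto simp: norm_mult integrable_decay intro: order_trans[OF _ abs_ge_self]\<close>)
    then show ?thesis
      by (intro order_trans[OF integral_norm_bound] integral_mono)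
         (use F in \<open>auto simp: norm_mult integrable_decay dest: integrable_norm\<close>)
  qed
  then show ?case by auto
next
  case (Suc k)
  obtain G where G: "\<And>t x. ((\<lambda>s. F t (x + s *\<^sub>R axis i 1)) has_vector_derivative G t x) (at 0)"
    "unif_smooth i (CARD('n) + 1) k G" using Suc.prems by auto
  obtain C where C: "\<And>t x. norm (F t x) * (1 + norm x) ^ (CARD('n) + 1) \<le> C" using Suc.prems by auto
  obtain D where D: "\<And>t x. norm (G t x) * (1 + norm x) ^ (CARD('n) + 1) \<le> D"
    using unif_smooth_base(2)[OF G(2)] by auto
  have F: "norm (F t x) \<le> C * decay x" for t x by (rule bound_decay) (rule C)
  have G': "norm (G t x) \<le> D * decay x" for t x by (rule bound_decay) (rule D)
  have [measurable]: "F t \<in> borel_measurable borel" "G t \<in> borel_measurable borel" for t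
    by (rule unif_smooth_base(1)[OF Suc.prems], rule unif_smooth_base(1)[OF G(2)])
  have I: "integrable lborel (\<lambda>x. cis (x \<bullet> \<xi>) * F t x)" "integrable lborel (\<lambda>x. cis (x \<bullet> \<xi>) * G t x)" for t \<xi>
  proof -
    show "integrable lborel (\<lambda>x. cis (x \<bullet> \<xi>) * F t x)"
      by (rule Bochner_Integration.integrable_bound[of lborel "\<lambda>x. C * decay x"])
         (use F in \<open>auto simp: norm_mult integrable_decay intro: order_trans[OF _ abs_ge_self]\<close>)
    show "integrable lborel (\<lambda>x. cis (x \<bullet> \<xi>) * G t x)"
      by (rule Bochner_Integration.integrable_bound[of lborel "\<lambda>x. D * decay x"])
         (use G' in \<open>auto simp: norm_mult integrable_decay intro: order_trans[OF _ abs_ge_self]\<close>)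
  qed
  have key: "(LINT x|lborel. cis (x \<bullet> \<xi>) * G t x) = - (\<i> * of_real (\<xi> $ i)) * (LINT x|lborel. cis (x \<bullet> \<xi>) * F t x)" for t \<xi>
  proof -
    \<comment> \<open>The derivative along \<open>axis i 1\<close> of the product of the character
      with \<open>F t\<close>; that its integral vanishes is the integration by parts.\<close>
    let ?f' = "\<lambda>x. cis (x \<bullet> \<xi>) * G t x + \<i> * of_real (\<xi> $ i) * (cis (x \<bullet> \<xi>) * F t x)"
    \<comment> \<open>This constant depends on \<xi>, which is harmless: it only provides
      domination, while the uniform bound comes from the induction hypothesis.\<close>
    have CD: "C \<le> max C D + norm (\<xi> $ i) * \<bar>C\<bar>" "D + \<bar>\<xi> $ i\<bar> * C \<le> max C D + norm (\<xi> $ i) * \<bar>C\<bar>"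
      by (auto intro!: add_mono mult_left_mono simp: le_max_iff_disj intro: order_trans[of C "max C D"])
    have "(LINT x|lborel. ?f' x) = 0"
    proof (rule integral_dir_derivative_eq_0[where f="\<lambda>x. cis (x \<bullet> \<xi>) * F t x" and i=i
          and C="max C D + norm (\<xi> $ i) * \<bar>C\<bar>"])
      fix x :: "real^'n"
      have "((\<lambda>s. cis (x \<bullet> \<xi> + s * \<xi> $ i)) has_vector_derivative \<i> * of_real (\<xi> $ i) * cis (x \<bullet> \<xi>)) (at 0)"
        unfolding cis_conv_exp
        by (rule has_vector_derivative_real_field | auto intro!: derivative_eq_intros)+
      from has_vector_derivative_mult[OF this G(1)[of t x]]
      show "((\<lambda>s. cis ((x + s *\<^sub>R axis i 1) \<bullet> \<xi>) * F t (x + s *\<^sub>R axis i 1)) has_vector_derivative ?f' x) (at 0)"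
        by (simp add: inner_add_left inner_axis' mult_ac)
      show "norm (cis (x \<bullet> \<xi>) * F t x) \<le> (max C D + norm (\<xi> $ i) * \<bar>C\<bar>) * decay x"
        using order_trans[OF F mult_right_mono[OF CD(1) less_imp_le[OF decay_pos]]] by (simp add: norm_mult)
      have "norm (?f' x) \<le> norm (G t x) + \<bar>\<xi> $ i\<bar> * norm (F t x)"
        by (rule order_trans[OF norm_triangle_ineq]) (simp add: norm_mult)
      also have "\<dots> \<le> D * decay x + \<bar>\<xi> $ i\<bar> * (C * decay x)"
        using F G' by (intro add_mono mult_left_mono) auto
      also have "\<dots> = (D + \<bar>\<xi> $ i\<bar> * C) * decay x" by (simp add: algebra_simps)
      also have "\<dots> \<le> (max C D + norm (\<xi> $ i) * \<bar>C\<bar>) * decay x"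
        by (rule mult_right_mono[OF CD(2) less_imp_le[OF decay_pos]])
      finally show "norm (?f' x) \<le> (max C D + norm (\<xi> $ i) * \<bar>C\<bar>) * decay x" .
    qed auto
    moreover have "(LINT x|lborel. ?f' x) = (LINT x|lborel. cis (x \<bullet> \<xi>) * G t x)
        + \<i> * of_real (\<xi> $ i) * (LINT x|lborel. cis (x \<bullet> \<xi>) * F t x)"
      using I by simp
    ultimately show ?thesis by (simp add: eq_neg_iff_add_eq_0)
  qed
  obtain E where "\<And>t \<xi>. \<bar>\<xi> $ i\<bar> ^ k * norm (LINT x|lborel. cis (x \<bullet> \<xi>) * G t x) \<le> E"
    using Suc.IH[OF G(2)] by auto
  then show ?case unfolding key by (auto simp: norm_mult mult_ac intro!: exI[of _ E])
qed

text \<open>Some coordinate of \<xi> is at least |\<xi>|/n in modulus, so decay of order n + 1 along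
  every axis gives isotropic decay; for |\<xi>| <= 1 boundedness suffices.\<close>

lemma fourier_decay:
  fixes F :: "'t \<Rightarrow> real ^ 'n::finite \<Rightarrow> complex"
  assumes F: "\<And>i. unif_smooth i (CARD('n) + 1) (CARD('n) + 1) F"
  shows "\<exists>C\<ge>0. \<forall>t \<xi>. norm (inv_fourier (F t) \<xi>) \<le> C * decay \<xi>"
proof -
  let ?M = "CARD('n) + 1"
  let ?I = "\<lambda>t \<xi>. LINT x|lborel. cis (x \<bullet> \<xi>) * F t x"
  obtain C where C: "\<And>i t \<xi>. \<bar>\<xi> $ i\<bar> ^ ?M * norm (?I t \<xi>) \<le> C i"
    using fourier_coordinate_decay[OF F] by metis
  \<comment> \<open>At order 0 no derivative is taken, so the direction may be arbitrary.\<close>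
  have F0: "unif_smooth undefined (CARD('n) + 1) 0 F"
    using unif_smooth_base[OF F] by auto
  obtain C0 where C0: "\<And>t \<xi>. norm (?I t \<xi>) \<le> C0"
    using fourier_coordinate_decay[OF F0] by auto
  have [measurable]: "F t \<in> borel_measurable borel" for t by (rule unif_smooth_base(1)[OF F])
  have eq: "inv_fourier (F t) \<xi> = of_real (1 / (2 * pi) ^ CARD('n)) * ?I t \<xi>" for t \<xi>
    unfolding inv_fourier_def by (subst integral_completion) (auto simp: inner_commute)
  \<comment> \<open>The summand with \<open>C0\<close> serves |\<xi>| <= 1, where
    \<open>1 + |\<xi>| <= 2\<close>; the other serves the rest, where
    \<open>1 + |\<xi>| <= 2 n \<bar>\<xi> $ i\<bar>\<close> for the largest coordinate.\<close>
  define D where "D = 2 ^ ?M * (\<bar>C0\<bar> + real (CARD('n)) ^ ?M * (\<Sum>i\<in>UNIV. \<bar>C i\<bar>))"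
  have D: "(1 + norm \<xi>) ^ ?M * norm (?I t \<xi>) \<le> D" for t \<xi>
  proof (cases "norm \<xi> \<le> 1")
    case True
    have "(1 + norm \<xi>) ^ ?M * norm (?I t \<xi>) \<le> 2 ^ ?M * \<bar>C0\<bar>"
      using True C0[where \<xi>=\<xi> and t=t] by (intro mult_mono power_mono) auto
    also have "\<dots> \<le> D" unfolding D_def by (intro mult_left_mono) (auto simp: sum_nonneg)
    finally show ?thesis .
  next
    case False
    define m where "m = Max (range (\<lambda>i. \<bar>\<xi> $ i\<bar>))"
    have "m \<in> range (\<lambda>i. \<bar>\<xi> $ i\<bar>)" unfolding m_def by (intro Max_in) auto
    then obtain i where i: "m = \<bar>\<xi> $ i\<bar>" by auto
    have "norm \<xi> \<le> (\<Sum>i\<in>UNIV. \<bar>\<xi> $ i\<bar>)" by (rule norm_le_l1_cart)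
    also have "\<dots> \<le> (\<Sum>i\<in>(UNIV::'n set). m)" unfolding m_def by (intro sum_mono Max_ge) auto
    finally have "norm \<xi> \<le> real (CARD('n)) * \<bar>\<xi> $ i\<bar>" using i by simp
    then have "1 + norm \<xi> \<le> 2 * (real (CARD('n)) * \<bar>\<xi> $ i\<bar>)" using False by simp
    then have "(1 + norm \<xi>) ^ ?M \<le> (2 * (real (CARD('n)) * \<bar>\<xi> $ i\<bar>)) ^ ?M"
      by (intro power_mono) auto
    then have "(1 + norm \<xi>) ^ ?M * norm (?I t \<xi>) \<le> (2 * (real (CARD('n)) * \<bar>\<xi> $ i\<bar>)) ^ ?M * norm (?I t \<xi>)"
      by (intro mult_right_mono) auto
    also have "\<dots> = 2 ^ ?M * (real (CARD('n)) ^ ?M * (\<bar>\<xi> $ i\<bar> ^ ?M * norm (?I t \<xi>)))"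
      by (simp only: power_mult_distrib mult_ac)
    also have "\<dots> \<le> 2 ^ ?M * (real (CARD('n)) ^ ?M * (\<Sum>i\<in>UNIV. \<bar>C i\<bar>))"
    proof (intro mult_left_mono)
      have "\<bar>\<xi> $ i\<bar> ^ ?M * norm (?I t \<xi>) \<le> \<bar>C i\<bar>" using C[where \<xi>=\<xi> and i=i and t=t] by linarith
      also have "\<dots> \<le> (\<Sum>i\<in>UNIV. \<bar>C i\<bar>)" by (rule member_le_sum) auto
      finally show "\<bar>\<xi> $ i\<bar> ^ ?M * norm (?I t \<xi>) \<le> (\<Sum>i\<in>UNIV. \<bar>C i\<bar>)" .
    qed auto
    also have "\<dots> \<le> D" unfolding D_def by (intro mult_left_mono) auto
    finally show ?thesis .
  qed
  have "D \<ge> 0" unfolding D_def by (intro mult_nonneg_nonneg add_nonneg_nonneg sum_nonneg) auto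
  have "norm (inv_fourier (F t) \<xi>) \<le> 1 / (2 * pi) ^ CARD('n) * D * decay \<xi>" for t \<xi>
  proof -
    have "norm (inv_fourier (F t) \<xi>) = 1 / (2 * pi) ^ CARD('n) * norm (?I t \<xi>)"
      unfolding eq by (simp only: norm_mult norm_of_real) simp
    also have "\<dots> \<le> 1 / (2 * pi) ^ CARD('n) * (D * decay \<xi>)"
      by (intro mult_left_mono bound_decay[where f="?I"]) (use D[where \<xi>=\<xi> and t=t] in \<open>simp_all add: mult.commute\<close>)
    finally show ?thesis by simp
  qed
  with \<open>D \<ge> 0\<close> show ?thesis by (intro exI[of _ "1 / (2 * pi) ^ CARD('n) * D"]) auto
qed

section \<open>Schwartz functions\<close>

lemma iter_partial_simps [simp]:
  "iter_partial [] f = f" "iter_partial (i # js) f = partial_deriv i (iter_partial js f)"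
  by (simp_all add: iter_partial_def)

lemma schwartz_differentiable: "\<phi> \<in> schwartz \<Longrightarrow> iter_partial js \<phi> differentiable (at x)"
  by (simp add: schwartz_def)

lemma schwartz_iter_partial_measurable:
  fixes \<phi> :: "real ^ 'n::finite \<Rightarrow> 'b::real_normed_vector"
  assumes "\<phi> \<in> schwartz" shows "iter_partial js \<phi> \<in> borel_measurable borel"
proof (rule borel_measurable_continuous_onI)
  show "continuous_on UNIV (iter_partial js \<phi>)"
    using schwartz_differentiable[OF assms, of js]
    by (simp add: continuous_at_imp_continuous_on differentiable_imp_continuous_within)
qed

lemma schwartz_measurable:
  "\<phi> \<in> schwartz \<Longrightarrow> \<phi> \<in> borel_measurable borel"
  using schwartz_iter_partial_measurable[of \<phi> "[]"] by simp

lemma schwartz_bound: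
  assumes "\<phi> \<in> schwartz"
  shows "(1 + norm x) ^ k * norm (iter_partial js \<phi> x) \<le> schwartz_seminorm k js \<phi>"
  using assms unfolding schwartz_def schwartz_seminorm_def by (auto intro: cSUP_upper)

lemma schwartz_seminorm_nonneg: "\<phi> \<in> schwartz \<Longrightarrow> 0 \<le> schwartz_seminorm k js \<phi>"
  by (rule order_trans[OF _ schwartz_bound[where x=0]]) auto

lemma schwartz_decay_bound:
  fixes \<phi> :: "real ^ 'n::finite \<Rightarrow> 'b::real_normed_vector"
  assumes "\<phi> \<in> schwartz"
  shows "norm (\<phi> x) \<le> schwartz_seminorm (CARD('n) + 1) [] \<phi> * decay x"
  using bound_decay[where f="\<lambda>_::unit. \<phi>" and t="()" and x=x
      and C="schwartz_seminorm (CARD('n) + 1) [] \<phi>"] schwartz_bound[OF assms, of x "CARD('n) + 1" "[]"]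
  by (simp add: mult_ac)

lemma schwartz_bounded:
  fixes \<phi> :: "real ^ 'n::finite \<Rightarrow> 'b::real_normed_vector"
  assumes "\<phi> \<in> schwartz"
  shows "norm (\<phi> x) \<le> schwartz_seminorm 0 [] \<phi>"
  using schwartz_bound[OF assms, of x 0 "[]"] by simp

lemma schwartz_integrable:
  fixes \<phi> :: "real ^ 'n::finite \<Rightarrow> 'b::{banach, second_countable_topology}"
  assumes "\<phi> \<in> schwartz"
  shows "integrable lborel \<phi>"
proof (rule Bochner_Integration.integrable_bound)
  show "integrable lborel (\<lambda>x. schwartz_seminorm (CARD('n) + 1) [] \<phi> * decay x)"
    by (simp add: integrable_decay)
  show "AE x in lborel. norm (\<phi> x) \<le> norm (schwartz_seminorm (CARD('n) + 1) [] \<phi> * decay x)"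
    by (intro AE_I2 order_trans[OF schwartz_decay_bound[OF assms]]) simp
qed (use schwartz_measurable[OF assms] in simp)

lemma dir_derivative_partial_deriv:
  fixes f :: "real ^ 'n::finite \<Rightarrow> 'b::real_normed_vector"
  assumes "f differentiable (at x)"
  shows "((\<lambda>s. f (x + s *\<^sub>R axis i 1)) has_vector_derivative partial_deriv i f x) (at 0)"
proof -
  have f: "(f has_derivative frechet_derivative f (at x)) (at (x + 0 *\<^sub>R axis i 1))"
    using assms by (simp add: frechet_derivative_works)
  have "((f \<circ> (\<lambda>s. x + s *\<^sub>R axis i 1)) has_derivative (frechet_derivative f (at x) \<circ> (\<lambda>s. s *\<^sub>R axis i 1))) (at 0)"
    by (rule diff_chain_at, (auto intro!: derivative_eq_intros)[1]) (rule f)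
  moreover have "frechet_derivative f (at x) (s *\<^sub>R axis i 1) = s *\<^sub>R partial_deriv i f x" for s
    unfolding partial_deriv_def
    using linear_cmul[OF linear_frechet_derivative[OF assms]] by blast
  ultimately show ?thesis by (simp add: has_vector_derivative_def o_def)
qed

lemma schwartz_unif_smooth:
  fixes \<phi> :: "real ^ 'n::finite \<Rightarrow> complex"
  assumes "\<phi> \<in> schwartz"
  shows "unif_smooth i e k (\<lambda>_::'t. iter_partial js \<phi>)"
proof (induction k arbitrary: js)
  have b: "\<exists>C. \<forall>x. norm (iter_partial js \<phi> x) * (1 + norm x) ^ e \<le> C" for js
    using schwartz_bound[OF assms, where k=e and js=js]
    by (intro exI[of _ "schwartz_seminorm e js \<phi>"]) (simp add: mult.commute)
  {
    case 0
    show ?case using b schwartz_iter_partial_measurable[OF assms] by simp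
  next
    case (Suc k)
    show ?case using b schwartz_iter_partial_measurable[OF assms]
        dir_derivative_partial_deriv[OF schwartz_differentiable[OF assms]] Suc[of "i # js"]
      by (subst unif_smooth.simps(2)) (auto intro!: exI[of _ "\<lambda>_. partial_deriv i (iter_partial js \<phi>)"])
  }
qed

lemma partial_deriv_eq:
  assumes "(f has_derivative f') (at x)"
  shows "partial_deriv i f x = f' (axis i 1)"
  using frechet_derivative_at[OF assms] by (simp add: partial_deriv_def)

lemma schwartz_of_real:
  fixes \<phi> :: "real ^ 'n::finite \<Rightarrow> real"
  assumes "\<phi> \<in> schwartz"
  shows "(\<lambda>x. complex_of_real (\<phi> x)) \<in> schwartz"
proof -
  have eq: "iter_partial js (\<lambda>x. complex_of_real (\<phi> x)) = (\<lambda>x. of_real (iter_partial js \<phi> x))" for js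
  proof (induction js)
    case (Cons i js)
    have "partial_deriv i (\<lambda>x. complex_of_real (iter_partial js \<phi> x)) x = of_real (partial_deriv i (iter_partial js \<phi>) x)" for x
    proof -
      have "(iter_partial js \<phi> has_derivative frechet_derivative (iter_partial js \<phi>) (at x)) (at x)"
        using schwartz_differentiable[OF assms] by (simp add: frechet_derivative_works)
      from partial_deriv_eq[OF has_derivative_of_real[OF this]] show ?thesis
        by (simp add: partial_deriv_def)
    qed
    then show ?case using Cons by simp
  qed simp
  have "(\<lambda>x. complex_of_real (iter_partial js \<phi> x)) differentiable at x" for js x
    using schwartz_differentiable[OF assms, of js x] has_derivative_of_real
    unfolding differentiable_def by blast
  then show ?thesis using assms by (simp add: schwartz_def eq)
qed

text \<open>Supplies the translated and dilated cutoffs that serve as test functions in the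
  uniqueness proof. The chain rule contributes powers of \<open>c\<close>, and
  \<open>1 + |x|\<close> is at most a constant times \<open>1 + |b + c x|\<close>.\<close>

lemma schwartz_affine:
  fixes \<phi> :: "real ^ 'n::finite \<Rightarrow> 'b::real_normed_vector"
  assumes "\<phi> \<in> schwartz" "c \<noteq> 0"
  shows "(\<lambda>x. \<phi> (b + c *\<^sub>R x)) \<in> schwartz"
proof -
  let ?A = "\<lambda>x::real^'n. b + c *\<^sub>R x"
  have A: "(?A has_derivative (\<lambda>h. c *\<^sub>R h)) (at x)" for x
    by (auto intro!: derivative_eq_intros)
  have der: "((\<lambda>x. iter_partial js \<phi> (?A x)) has_derivative
     (\<lambda>h. frechet_derivative (iter_partial js \<phi>) (at (?A x)) (c *\<^sub>R h))) (at x)" for js x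
    using diff_chain_at[OF A, of "iter_partial js \<phi>" "frechet_derivative (iter_partial js \<phi>) (at (?A x))" x]
      schwartz_differentiable[OF assms(1), of js "?A x"] by (simp add: frechet_derivative_works o_def)
  have eq: "iter_partial js (\<lambda>x. \<phi> (?A x)) = (\<lambda>x. c ^ length js *\<^sub>R iter_partial js \<phi> (?A x))" for js
  proof (induction js)
    case (Cons i js)
    have "partial_deriv i (\<lambda>x. c ^ length js *\<^sub>R iter_partial js \<phi> (?A x)) x
       = c ^ length (i # js) *\<^sub>R partial_deriv i (iter_partial js \<phi>) (?A x)" for x
    proof -
      have "partial_deriv i (\<lambda>x. c ^ length js *\<^sub>R iter_partial js \<phi> (?A x)) x
         = c ^ length js *\<^sub>R frechet_derivative (iter_partial js \<phi>) (at (?A x)) (c *\<^sub>R axis i 1)"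
        by (rule partial_deriv_eq[OF has_derivative_scaleR_right[OF der]])
      also have "\<dots> = c ^ length (i # js) *\<^sub>R partial_deriv i (iter_partial js \<phi>) (?A x)"
        using linear_cmul[OF linear_frechet_derivative[OF schwartz_differentiable[OF assms(1), of js "?A x"]]]
        by (simp add: partial_deriv_def)
      finally show ?thesis .
    qed
    then show ?case using Cons by auto
  qed simp
  have "(\<lambda>x. c ^ length js *\<^sub>R iter_partial js \<phi> (?A x)) differentiable at x" for js x
    using has_derivative_scaleR_right[OF der] unfolding differentiable_def by blast
  moreover have "bdd_above (range (\<lambda>x. (1 + norm x) ^ k * norm (c ^ length js *\<^sub>R iter_partial js \<phi> (?A x))))" for js k
  proof (rule bdd_aboveI2)
    fix x
    define D where "D = (1 + norm b) / \<bar>c\<bar> + 1"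
    have "\<bar>c\<bar> * norm x \<le> norm (?A x) + norm b"
      using norm_triangle_ineq4[of "?A x" b] by simp
    then have "norm x \<le> (norm (?A x) + norm b) / \<bar>c\<bar>" using assms(2) by (simp add: field_simps)
    moreover have "(norm (?A x) + norm b) / \<bar>c\<bar> \<le> ((1 + norm b) * (1 + norm (?A x))) / \<bar>c\<bar>"
      by (intro divide_right_mono) (auto simp: algebra_simps)
    moreover have "D * (1 + norm (?A x)) = ((1 + norm b) * (1 + norm (?A x))) / \<bar>c\<bar> + (1 + norm (?A x))"
      unfolding D_def by (simp only: distrib_right times_divide_eq_left mult_1)
    ultimately have "1 + norm x \<le> D * (1 + norm (?A x))" using norm_ge_zero[of "?A x"] by linarith
    then have "(1 + norm x) ^ k \<le> D ^ k * (1 + norm (?A x)) ^ k"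
      unfolding power_mult_distrib[symmetric] by (intro power_mono) auto
    then have "(1 + norm x) ^ k * norm (c ^ length js *\<^sub>R iter_partial js \<phi> (?A x))
       \<le> (D ^ k * (1 + norm (?A x)) ^ k) * (\<bar>c\<bar> ^ length js * norm (iter_partial js \<phi> (?A x)))"
      by (simp add: power_abs mult_right_mono)
    also have "\<dots> = D ^ k * \<bar>c\<bar> ^ length js * ((1 + norm (?A x)) ^ k * norm (iter_partial js \<phi> (?A x)))"
      by simp
    also have "\<dots> \<le> D ^ k * \<bar>c\<bar> ^ length js * schwartz_seminorm k js \<phi>"
      unfolding D_def by (intro mult_left_mono schwartz_bound assms(1)) auto
    finally show "(1 + norm x) ^ k * norm (c ^ length js *\<^sub>R iter_partial js \<phi> (?A x))
      \<le> D ^ k * \<bar>c\<bar> ^ length js * schwartz_seminorm k js \<phi>" by (simp add: D_def)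
  qed
  ultimately show ?thesis by (simp add: schwartz_def eq)
qed

lemma integral_lborel_swap:
  fixes f :: "'a::euclidean_space \<Rightarrow> 'b::euclidean_space \<Rightarrow> 'c::{banach, second_countable_topology}"
  assumes [measurable]: "(\<lambda>(x, y). f x y) \<in> borel_measurable (borel \<Otimes>\<^sub>M borel)"
    and "(\<integral>\<^sup>+x. \<integral>\<^sup>+y. ennreal (norm (f x y)) \<partial>lborel \<partial>lborel) < \<infinity>"
  shows "(LINT x|lborel. LINT y|lborel. f x y) = (LINT y|lborel. LINT x|lborel. f x y)"
proof -
  have "integrable (lborel \<Otimes>\<^sub>M lborel) (\<lambda>(x, y). f x y)"
  proof (rule integrableI_bounded)
    have "(\<integral>\<^sup>+p. ennreal (norm (case p of (x, y) \<Rightarrow> f x y)) \<partial>(lborel \<Otimes>\<^sub>M lborel))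
       = (\<integral>\<^sup>+x. \<integral>\<^sup>+y. ennreal (norm (f x y)) \<partial>lborel \<partial>lborel)"
      by (subst lborel.nn_integral_fst[symmetric]) auto
    then show "(\<integral>\<^sup>+p. ennreal (norm (case p of (x, y) \<Rightarrow> f x y)) \<partial>(lborel \<Otimes>\<^sub>M lborel)) < \<infinity>"
      using assms(2) by simp
  qed simp
  then show ?thesis by (rule lborel_pair.Fubini_integral[symmetric])
qed

section \<open>The convolution kernel of the multiplier\<close>

lemma inv_fourier_schwartz_decay:
  fixes \<phi> :: "real ^ 'n::finite \<Rightarrow> complex"
  assumes "\<phi> \<in> schwartz"
  shows "\<exists>C\<ge>0. \<forall>\<xi>. norm (inv_fourier \<phi> \<xi>) \<le> C * decay \<xi>"
proof -
  have "unif_smooth i (CARD('n) + 1) (CARD('n) + 1) (\<lambda>_::unit. \<phi>)" for i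
    using schwartz_unif_smooth[OF assms, where js="[]"] by (simp only: iter_partial_simps)
  from fourier_decay[OF this] show ?thesis by blast
qed

lemma inv_fourier_measurable:
  assumes [measurable]: "\<phi> \<in> borel_measurable borel"
  shows "inv_fourier \<phi> \<in> borel_measurable (borel :: (real ^ 'n::finite) measure)"
proof -
  have "inv_fourier \<phi> = (\<lambda>x. of_real (1 / (2 * pi) ^ CARD('n)) * (LINT \<xi>|lborel. cis (x \<bullet> \<xi>) * \<phi> \<xi>))"
    unfolding inv_fourier_def by (intro ext arg_cong2[where f="(*)"] refl integral_completion) simp
  then show ?thesis by simp
qed

lemma inv_fourier_lborel:
  assumes [measurable]: "\<phi> \<in> borel_measurable borel"
  shows "inv_fourier \<phi> x = of_real (1 / (2 * pi) ^ CARD('n)) * (LINT \<xi>|lborel. cis (x \<bullet> \<xi>) * \<phi> (\<xi> :: real ^ 'n::finite))"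
  unfolding inv_fourier_def by (intro arg_cong2[where f="(*)"] refl integral_completion) simp

lemma fourier_lborel:
  assumes [measurable]: "\<phi> \<in> borel_measurable borel"
  shows "fourier \<phi> \<xi> = (LINT x|lborel. cis (- (x \<bullet> \<xi>)) * \<phi> (x :: real ^ 'n::finite))"
  unfolding fourier_def by (intro integral_completion) simp

lemma inv_fourier_dilate:
  fixes \<rho> :: "real ^ 'n::finite \<Rightarrow> complex"
  assumes [measurable]: "\<rho> \<in> borel_measurable borel" and c: "c > 0"
  shows "inv_fourier (\<lambda>\<xi>. \<rho> (\<xi> /\<^sub>R c)) x = of_real (c ^ CARD('n)) * inv_fourier \<rho> (c *\<^sub>R x)"
proof -
  have "(LINT \<xi>|lborel. cis (x \<bullet> \<xi>) * \<rho> (\<xi> /\<^sub>R c)) =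
    \<bar>c\<bar> ^ DIM(real^'n) *\<^sub>R (LINT \<xi>|lborel. cis (x \<bullet> (0 + c *\<^sub>R \<xi>)) * \<rho> ((0 + c *\<^sub>R \<xi>) /\<^sub>R c))"
    by (rule integral_lborel_affine) (use c in auto)
  also have "\<dots> = of_real (c ^ CARD('n)) * (LINT \<xi>|lborel. cis (c *\<^sub>R x \<bullet> \<xi>) * \<rho> \<xi>)"
    using c by (subst scaleR_conv_of_real[where 'a=complex]) simp
  finally show ?thesis by (simp add: inv_fourier_lborel)
qed

lemma inv_fourier_cmult:
  fixes \<rho> :: "real ^ 'n::finite \<Rightarrow> complex"
  shows "inv_fourier (\<lambda>\<xi>. a * \<rho> \<xi>) x = a * inv_fourier \<rho> x"
  by (simp add: inv_fourier_def mult.left_commute[of "cis _" a] mult_ac)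

text \<open>Since \<open>m\<close> is integrable, this is Fubini's theorem: no Fourier inversion is needed.\<close>

lemma fourier_mult_inv_fourier:
  fixes m \<phi> :: "real ^ 'n::finite \<Rightarrow> complex"
  assumes [measurable]: "m \<in> borel_measurable borel" and m: "integrable lborel m"
    and \<phi>: "integrable lborel \<phi>"
  shows "(LINT \<xi>|lborel. cis (- (\<xi> \<bullet> y)) * (m \<xi> * inv_fourier \<phi> \<xi>))
    = (LINT z|lborel. inv_fourier m (z - y) * \<phi> z)"
proof -
  have [measurable]: "\<phi> \<in> borel_measurable borel" using borel_measurable_integrable[OF \<phi>] by simp
  let ?c = "of_real (1 / (2 * pi) ^ CARD('n)) :: complex"
  let ?f = "\<lambda>\<xi> z. ?c * (cis ((z - y) \<bullet> \<xi>) * m \<xi> * \<phi> z)"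
  have nf: "ennreal (norm (?f \<xi> z)) = (ennreal (norm ?c) * ennreal (norm (m \<xi>))) * ennreal (norm (\<phi> z))" for \<xi> z
    by (simp only: norm_mult norm_cis mult_1_left mult.assoc ennreal_mult'' norm_ge_zero mult_nonneg_nonneg)
  have "(\<integral>\<^sup>+\<xi>. \<integral>\<^sup>+z. ennreal (norm (?f \<xi> z)) \<partial>lborel \<partial>lborel) =
      (\<integral>\<^sup>+\<xi>. \<integral>\<^sup>+z. (ennreal (norm ?c) * ennreal (norm (m \<xi>))) * ennreal (norm (\<phi> z)) \<partial>lborel \<partial>lborel)"
    by (simp only: nf)
  also have "\<dots> = (ennreal (norm ?c) * (\<integral>\<^sup>+\<xi>. ennreal (norm (m \<xi>)) \<partial>lborel)) * (\<integral>\<^sup>+z. ennreal (norm (\<phi> z)) \<partial>lborel)"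
    by (simp add: nn_integral_cmult nn_integral_multc)
  also have "\<dots> < \<infinity>"
    using m \<phi> unfolding integrable_iff_bounded by (simp add: ennreal_mult_less_top)
  finally have fin: "(\<integral>\<^sup>+\<xi>. \<integral>\<^sup>+z. ennreal (norm (?f \<xi> z)) \<partial>lborel \<partial>lborel) < \<infinity>" .
  have "(LINT \<xi>|lborel. cis (- (\<xi> \<bullet> y)) * (m \<xi> * inv_fourier \<phi> \<xi>)) = (LINT \<xi>|lborel. LINT z|lborel. ?f \<xi> z)"
  proof (intro Bochner_Integration.integral_cong refl)
    fix \<xi> :: "real^'n"
    have "cis (- (\<xi> \<bullet> y)) * (m \<xi> * inv_fourier \<phi> \<xi>) = (?c * cis (- (\<xi> \<bullet> y)) * m \<xi>) * (LINT z|lborel. cis (\<xi> \<bullet> z) * \<phi> z)"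
      by (simp add: inv_fourier_lborel mult_ac)
    also have "\<dots> = (LINT z|lborel. (?c * cis (- (\<xi> \<bullet> y)) * m \<xi>) * (cis (\<xi> \<bullet> z) * \<phi> z))"
      by (simp only: integral_mult_right_zero)
    also have "\<dots> = (LINT z|lborel. ?f \<xi> z)"
    proof (intro Bochner_Integration.integral_cong refl)
      fix z
      have "cis ((z - y) \<bullet> \<xi>) = cis (- (\<xi> \<bullet> y)) * cis (\<xi> \<bullet> z)"
        by (simp add: cis_mult inner_diff_left inner_diff_right inner_commute)
      then show "(?c * cis (- (\<xi> \<bullet> y)) * m \<xi>) * (cis (\<xi> \<bullet> z) * \<phi> z) = ?f \<xi> z" by (simp add: mult_ac)
    qed
    finally show "cis (- (\<xi> \<bullet> y)) * (m \<xi> * inv_fourier \<phi> \<xi>) = (LINT z|lborel. ?f \<xi> z)" .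
  qed
  also have "\<dots> = (LINT z|lborel. LINT \<xi>|lborel. ?f \<xi> z)"
    by (rule integral_lborel_swap) (use fin in simp_all)
  also have "\<dots> = (LINT z|lborel. inv_fourier m (z - y) * \<phi> z)"
    by (intro Bochner_Integration.integral_cong refl)
       (simp only: inv_fourier_lborel[OF assms(1)] integral_mult_right_zero integral_mult_left_zero, simp only: mult.assoc)
  finally show ?thesis .
qed

text \<open>The reciprocal of the coefficient of the j-th Littlewood--Paley piece in
  \<open>log_weight\<close>; 1/w interpolates between consecutive values.\<close>

definition weight_coeff :: "nat \<Rightarrow> real" where
  "weight_coeff j = 1 / (1 + real j * ln 2)"

text \<open>The bound 1/2 keeps the denominators of the pieces away from 0 uniformly in j; the last
  bound turns the square of a coefficient into a multiple of \<open>(1 + j)^-2\<close>.\<close>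

lemma weight_coeff_bounds: "0 < weight_coeff j" "ln 2 * weight_coeff (Suc j) \<le> 1 / 2"
  "weight_coeff (Suc j) \<le> 1 / (ln 2 * (1 + real j))"
proof -
  have l: "0 < ln (2::real)" "ln (2::real) \<le> 1" using ln_2_less_1 by (auto intro: less_imp_le)
  have p: "0 < 1 + real j * ln 2" "0 < 1 + real (Suc j) * ln 2" for j
    using l by (auto intro: add_pos_nonneg)
  show "0 < weight_coeff j" using p unfolding weight_coeff_def by simp
  have "0 \<le> real j * ln 2" by simp
  then have "2 * ln 2 \<le> 1 + real (Suc j) * ln 2"
    using l(2) by (simp only: of_nat_Suc distrib_right)
  then have "ln 2 / (1 + real (Suc j) * ln 2) \<le> 1 / 2"
    using p(2)[of j] by (subst pos_divide_le_eq) simp_all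
  then show "ln 2 * weight_coeff (Suc j) \<le> 1 / 2" unfolding weight_coeff_def by simp
  show "weight_coeff (Suc j) \<le> 1 / (ln 2 * (1 + real j))"
    unfolding weight_coeff_def
  proof (rule divide_left_mono)
    show "ln 2 * (1 + real j) \<le> 1 + real (Suc j) * ln 2" by (simp add: distrib_left distrib_right mult.commute)
    show "0 < (1 + real (Suc j) * ln 2) * (ln 2 * (1 + real j))"
      by (intro mult_pos_pos p l) simp
  qed simp
qed

lemma weight_coeff_tendsto: "weight_coeff \<longlonglongrightarrow> 0"
proof -
  have "filterlim (\<lambda>j. 1 + real j * ln 2) at_top sequentially"
    by (intro filterlim_tendsto_add_at_top[OF tendsto_const]
        filterlim_at_top_mult_tendsto_pos[OF tendsto_const] filterlim_real_sequentially) auto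
  then show ?thesis unfolding weight_coeff_def
    using tendsto_inverse_0_at_top by (simp add: inverse_eq_divide)
qed

lemma summable_inverse_square: "summable (\<lambda>j. 1 / (1 + real j)\<^sup>2)"
  using inverse_power_summable[of 2, where 'a=real] summable_Suc_iff[of "\<lambda>n. inverse (real n ^ 2)"]
  by (simp add: inverse_eq_divide add.commute)

lemma nn_integral_dilated_decay:
  "(\<integral>\<^sup>+z. ennreal ((2 ^ j) ^ CARD('n) * decay (2 ^ j *\<^sub>R (z - y :: real^'n::finite))) \<partial>lborel) = (\<integral>\<^sup>+z. ennreal (decay (z :: real^'n)) \<partial>lborel)"
proof -
  have "(\<integral>\<^sup>+z. ennreal (decay (z :: real^'n)) \<partial>lborel) =
     ennreal (\<bar>2 ^ j\<bar> ^ DIM(real^'n)) * (\<integral>\<^sup>+z. ennreal (decay ((- (2 ^ j *\<^sub>R y)) + 2 ^ j *\<^sub>R z)) \<partial>lborel)"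
    by (rule nn_integral_lborel_affine) auto
  also have "\<dots> = (\<integral>\<^sup>+z. ennreal ((2 ^ j) ^ CARD('n)) * ennreal (decay (2 ^ j *\<^sub>R (z - y))) \<partial>lborel)"
    by (subst nn_integral_cmult) (simp_all add: scaleR_diff_right)
  finally show ?thesis by (simp add: ennreal_mult'' less_imp_le decay_pos)
qed

text \<open>At a fixed z away from 0 the L^1-normalised dilations decay like 2^-j. This gives
  pointwise convergence of the kernel series, and later bounds its terms at scales finer than
  |z|.\<close>

lemma dilated_decay_bound:
  assumes "z \<noteq> 0"
  shows "(2 ^ j) ^ CARD('n) * decay (2 ^ j *\<^sub>R (z :: real^'n::finite)) \<le> 1 / norm z ^ (CARD('n) + 1) * (1 / 2 ^ j)"
proof -
  have "decay (2 ^ j *\<^sub>R z) \<le> 1 / (2 ^ j * norm z) ^ (CARD('n) + 1)"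
    unfolding decay_def norm_scaleR using assms
    by (intro divide_left_mono power_mono mult_pos_pos zero_less_power add_pos_nonneg) auto
  then have "(2 ^ j) ^ CARD('n) * decay (2 ^ j *\<^sub>R z) \<le> (2 ^ j) ^ CARD('n) * (1 / (2 ^ j * norm z) ^ (CARD('n) + 1))"
    by (rule mult_left_mono) simp
  also have "\<dots> = 1 / norm z ^ (CARD('n) + 1) * (1 / 2 ^ j)"
    by (simp add: power_mult_distrib)
  finally show ?thesis .
qed

text \<open>With L = ln 2, the first identity says that a piece with cutoff value 1 is the
  difference of two consecutive \<open>weight_coeff\<close>. The second says that the one piece with
  an intermediate cutoff value s moves 1/d to 1/(d - L s), the value of 1/w.\<close>

lemma reciprocal_increment:
  fixes L :: real
  shows "0 < w \<Longrightarrow> 0 < L \<Longrightarrow> 1 / w - 1 / (w + L) = L * (1 / (w + L))\<^sup>2 * (1 / (1 - L * (1 / (w + L))))"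
    and "0 < d \<Longrightarrow> L * s < d \<Longrightarrow> 1 / d + L * (1 / d)\<^sup>2 * (s / (1 - L * (1 / d) * s)) = 1 / (d - L * s)"
proof -
  assume w: "0 < w" and L: "0 < L"
  have nz: "w \<noteq> 0" "w + L \<noteq> 0" using w L by simp_all
  have "1 = (w + L) / (w + L)" using nz by simp
  then have 1: "1 - L * (1 / (w + L)) = w / (w + L)" unfolding add_divide_distrib by simp
  have 2: "1 / w - 1 / (w + L) = L / (w * (w + L))" using nz by (simp add: diff_frac_eq)
  have 3: "(1 / (w + L))\<^sup>2 * (1 / (w / (w + L))) = 1 / (w * (w + L))"
    using nz by (simp add: power2_eq_square)
  show "1 / w - 1 / (w + L) = L * (1 / (w + L))\<^sup>2 * (1 / (1 - L * (1 / (w + L))))"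
    unfolding 1 2 mult.assoc 3 by simp
next
  assume d: "0 < d" and ds: "L * s < d"
  define e where "e = d - L * s"
  have nz: "d \<noteq> 0" "e \<noteq> 0" using d ds by (simp_all add: e_def)
  have 1: "1 - L * (1 / d) * s = e / d" using nz by (simp add: e_def diff_divide_distrib)
  have 2: "L * (1 / d)\<^sup>2 * (s / (e / d)) = L * s / (d * e)" using nz by (simp add: power2_eq_square)
  have "1 / d + L * s / (d * e) = (e + L * s) / (d * e)" using nz by (simp add: add_divide_distrib)
  also have "\<dots> = 1 / e" using nz by (simp add: e_def)
  finally show "1 / d + L * (1 / d)\<^sup>2 * (s / (1 - L * (1 / d) * s)) = 1 / (d - L * s)"
    unfolding 1 2 unfolding e_def .
qed

section \<open>Decomposition of the reciprocal weight into smooth pieces\<close>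

context
  fixes \<phi>0 :: "real ^ 'n::finite \<Rightarrow> real"
  assumes cutoff: "LP_cutoff \<phi>0"
begin

lemma cutoff_range: "0 \<le> \<phi>0 x" "\<phi>0 x \<le> 1"
  and cutoff_1: "norm x \<le> 1 \<Longrightarrow> \<phi>0 x = 1"
  and cutoff_0: "3/2 < norm x \<Longrightarrow> \<phi>0 x = 0"
  and cutoff_schwartz: "\<phi>0 \<in> schwartz"
proof -
  have c: "\<phi>0 \<in> schwartz" "\<forall>x. 0 \<le> \<phi>0 x" "\<forall>x y. norm x \<le> norm y \<longrightarrow> \<phi>0 y \<le> \<phi>0 x"
    "closure {x. \<phi>0 x \<noteq> 0} \<subseteq> {x. norm x \<le> 3/2}" "\<forall>x. norm x \<le> 1 \<longrightarrow> \<phi>0 x = 1"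
    using cutoff unfolding LP_cutoff_def by blast+
  show "0 \<le> \<phi>0 x" "norm x \<le> 1 \<Longrightarrow> \<phi>0 x = 1" "\<phi>0 \<in> schwartz" using c(1,2,5) by blast+
  have "\<phi>0 x \<le> \<phi>0 0" using c(3)[rule_format, of 0 x] by simp
  then show "\<phi>0 x \<le> 1" using c(5)[rule_format, of 0] by simp
  show "\<phi>0 x = 0" if "3/2 < norm x"
  proof (rule ccontr)
    assume "\<phi>0 x \<noteq> 0"
    then have "x \<in> {x. \<phi>0 x \<noteq> 0}" by simp
    then have "x \<in> {x. norm x \<le> 3/2}" by (rule subsetD[OF order_trans[OF closure_subset c(4)]])
    then show False using that by simp
  qed
qed

lemma cutoff_measurable: "\<phi>0 \<in> borel_measurable borel"
  by (rule schwartz_measurable[OF cutoff_schwartz])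

text \<open>The symbol of the j-th piece, rescaled to unit frequency and stripped of its size. The
  form with \<open>inverse\<close> fits \<open>unif_smooth_inverse\<close>, and the index j plays
  the part of the parameter t of a uniformly smooth family.\<close>

definition shell :: "nat \<Rightarrow> real ^ 'n \<Rightarrow> complex" where
  "shell j x = of_real (\<phi>0 x) * inverse (1 - of_real (ln 2 * weight_coeff (Suc j) * \<phi>0 x))"

text \<open>Built from a single dilated cutoff: its value 0 gives 0, its value 1 gives
  \<open>weight_coeff j - weight_coeff (Suc j)\<close>, and a value in between gives precisely the
  correction that 1/w needs at the transition scale.\<close>

definition piece :: "nat \<Rightarrow> real ^ 'n \<Rightarrow> real" where
  "piece j \<xi> = ln 2 * (weight_coeff (Suc j))\<^sup>2 * (\<phi>0 (\<xi> /\<^sub>R 2 ^ j) / (1 - ln 2 * weight_coeff (Suc j) * \<phi>0 (\<xi> /\<^sub>R 2 ^ j)))"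

definition kernel :: "nat \<Rightarrow> real ^ 'n \<Rightarrow> complex" where
  "kernel j = inv_fourier (\<lambda>\<xi>. of_real (piece j \<xi>))"

lemma shell_denominator: "ln 2 * weight_coeff (Suc j) * \<phi>0 x \<le> 1 / 2"
proof -
  have "ln 2 * weight_coeff (Suc j) * \<phi>0 x \<le> ln 2 * weight_coeff (Suc j) * 1"
    using weight_coeff_bounds(1)[of "Suc j"] cutoff_range[of x] by (intro mult_left_mono) auto
  then show ?thesis using weight_coeff_bounds(2)[of j] by linarith
qed

lemma piece_shell: "complex_of_real (piece j \<xi>) = of_real (ln 2 * (weight_coeff (Suc j))\<^sup>2) * shell j (\<xi> /\<^sub>R 2 ^ j)"
  unfolding piece_def shell_def by (simp add: divide_inverse)

lemma shell_unif_smooth: "unif_smooth i (CARD('n) + 1) k shell"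
proof -
  let ?\<phi> = "\<lambda>x. complex_of_real (\<phi>0 x)"
  have 1: "unif_smooth i e k (\<lambda>_::nat. ?\<phi>)" for e
    using schwartz_unif_smooth[OF schwartz_of_real[OF cutoff_schwartz], where js="[]"] by simp
  have 2: "unif_smooth i 0 k (\<lambda>j x. complex_of_real (- (ln 2 * weight_coeff (Suc j))))"
  proof (rule unif_smooth_const[where C="1/2"])
    fix j
    have "0 \<le> ln 2 * weight_coeff (Suc j)"
      using weight_coeff_bounds(1)[of "Suc j"] by (intro mult_nonneg_nonneg) auto
    then show "norm (complex_of_real (- (ln 2 * weight_coeff (Suc j)))) \<le> 1/2"
      unfolding norm_of_real abs_minus_cancel using weight_coeff_bounds(2)[of j] by linarith
  qed
  have 3: "unif_smooth i 0 k (\<lambda>(j::nat) x. 1)" by (rule unif_smooth_const[where C=1]) simp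
  have 4: "unif_smooth i 0 k (\<lambda>j x. 1 + complex_of_real (- (ln 2 * weight_coeff (Suc j))) * ?\<phi> x)"
    using unif_smooth_add[OF 3 unif_smooth_mult[OF 2 1[of 0], unfolded add_0_left]] .
  have 5: "unif_smooth i 0 k (\<lambda>j x. inverse (1 + complex_of_real (- (ln 2 * weight_coeff (Suc j))) * ?\<phi> x))"
  proof (rule unif_smooth_inverse[OF 4])
    show "(1/2::real) > 0" by simp
    fix j x
    have "1 + complex_of_real (- (ln 2 * weight_coeff (Suc j))) * ?\<phi> x = of_real (1 - ln 2 * weight_coeff (Suc j) * \<phi>0 x)"
      by simp
    then have "norm (1 + complex_of_real (- (ln 2 * weight_coeff (Suc j))) * ?\<phi> x) = \<bar>1 - ln 2 * weight_coeff (Suc j) * \<phi>0 x\<bar>"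
      by (simp only: norm_of_real)
    then show "norm (1 + complex_of_real (- (ln 2 * weight_coeff (Suc j))) * ?\<phi> x) \<ge> 1/2"
      using shell_denominator[of j x] by linarith
  qed
  have "shell = (\<lambda>j x. ?\<phi> x * inverse (1 + complex_of_real (- (ln 2 * weight_coeff (Suc j))) * ?\<phi> x))"
    unfolding shell_def by (simp add: fun_eq_iff)
  then show ?thesis using unif_smooth_mult[OF 1[of "CARD('n) + 1"] 5] by simp
qed

lemma piece_measurable [measurable]: "piece j \<in> borel_measurable borel"
  using cutoff_measurable unfolding piece_def by measurable

lemma shell_measurable [measurable]: "shell j \<in> borel_measurable borel"
  using cutoff_measurable unfolding shell_def by measurable

lemma kernel_measurable [measurable]: "kernel j \<in> borel_measurable borel"
  unfolding kernel_def by (rule inv_fourier_measurable) simp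

text \<open>Dilating a symbol by 2^j dilates its transform the other way, and all the transforms of
  \<open>shell j\<close> obey one bound by \<open>decay\<close>. The factor
  \<open>(1 + j)^-2\<close> is the square of \<open>weight_coeff (Suc j)\<close>.\<close>

lemma kernel_bound:
  "\<exists>C\<ge>0. \<forall>j z. norm (kernel j z) \<le> C * (1 / (1 + real j)\<^sup>2 * ((2 ^ j) ^ CARD('n) * decay (2 ^ j *\<^sub>R z)))"
proof -
  obtain C where C: "C \<ge> 0" "\<And>j z. norm (inv_fourier (shell j) z) \<le> C * decay z"
    using fourier_decay[of shell] shell_unif_smooth by blast
  have "norm (kernel j z) \<le> 1 / ln 2 * C * (1 / (1 + real j)\<^sup>2 * ((2 ^ j) ^ CARD('n) * decay (2 ^ j *\<^sub>R z)))" for j z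
  proof -
    have "kernel j z = of_real (ln 2 * (weight_coeff (Suc j))\<^sup>2) * (of_real ((2 ^ j) ^ CARD('n)) * inv_fourier (shell j) (2 ^ j *\<^sub>R z))"
      unfolding kernel_def piece_shell inv_fourier_cmult by (subst inv_fourier_dilate) auto
    then have "norm (kernel j z) = (ln 2 * (weight_coeff (Suc j))\<^sup>2) * ((2 ^ j) ^ CARD('n) * norm (inv_fourier (shell j) (2 ^ j *\<^sub>R z)))"
      by (simp add: norm_mult norm_power)
    also have "\<dots> \<le> (ln 2 * (1 / (ln 2 * (1 + real j)))\<^sup>2) * ((2 ^ j) ^ CARD('n) * (C * decay (2 ^ j *\<^sub>R z)))"
    proof (rule mult_mono)
      show "ln 2 * (weight_coeff (Suc j))\<^sup>2 \<le> ln 2 * (1 / (ln 2 * (1 + real j)))\<^sup>2"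
        by (intro mult_left_mono power_mono weight_coeff_bounds(3)) (simp_all add: less_imp_le weight_coeff_bounds(1))
      show "(2 ^ j) ^ CARD('n) * norm (inv_fourier (shell j) (2 ^ j *\<^sub>R z)) \<le> (2 ^ j) ^ CARD('n) * (C * decay (2 ^ j *\<^sub>R z))"
        by (intro mult_left_mono C(2)) simp
    qed simp_all
    also have "ln 2 * (1 / (ln 2 * (1 + real j)))\<^sup>2 = 1 / ln 2 * (1 / (1 + real j)\<^sup>2)"
      by (simp add: power2_eq_square)
    finally show ?thesis by (simp only: mult_ac)
  qed
  then show ?thesis using C(1) by (intro exI[of _ "1 / ln 2 * C"]) auto
qed

lemma piece_bounds: "0 \<le> piece j \<xi>" "piece j \<xi> \<le> 2 / ln 2 * (1 / (1 + real j)\<^sup>2) * \<phi>0 (\<xi> /\<^sub>R 2 ^ j)"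
proof -
  let ?w = "weight_coeff (Suc j)"
  let ?p = "\<phi>0 (\<xi> /\<^sub>R 2 ^ j)"
  have d: "1 - ln 2 * ?w * ?p \<ge> 1/2" using shell_denominator[of j "\<xi> /\<^sub>R 2 ^ j"] by simp
  show "0 \<le> piece j \<xi>" unfolding piece_def
    using d cutoff_range[of "\<xi> /\<^sub>R 2 ^ j"] by (intro mult_nonneg_nonneg divide_nonneg_nonneg) auto
  have p: "0 \<le> ?p" by (rule cutoff_range)
  have "piece j \<xi> \<le> ln 2 * (1 / (ln 2 * (1 + real j)))\<^sup>2 * (?p / (1/2))"
    unfolding piece_def
  proof (rule mult_mono)
    show "ln 2 * (weight_coeff (Suc j))\<^sup>2 \<le> ln 2 * (1 / (ln 2 * (1 + real j)))\<^sup>2"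
      by (intro mult_left_mono power_mono weight_coeff_bounds(3)) (simp_all add: less_imp_le weight_coeff_bounds(1))
    show "?p / (1 - ln 2 * ?w * ?p) \<le> ?p / (1/2)"
      using p d by (intro divide_left_mono) auto
    show "0 \<le> ?p / (1 - ln 2 * ?w * ?p)" using p d by (intro divide_nonneg_nonneg) auto
  qed simp
  also have "\<dots> = 2 / ln 2 * (1 / (1 + real j)\<^sup>2) * ?p"
    by (simp add: power2_eq_square mult_ac)
  finally show "piece j \<xi> \<le> 2 / ln 2 * (1 / (1 + real j)\<^sup>2) * ?p" .
qed

text \<open>At each frequency the cutoffs \<open>\<phi>0 (2^-j \<xi>)\<close> are 0 up to some scale \<open>k\<close> and 1 beyond it.\<close>

lemma transition_scale: "\<exists>k. (\<forall>j<k. \<phi>0 (\<xi> /\<^sub>R 2 ^ j) = 0) \<and> (\<forall>j>k. \<phi>0 (\<xi> /\<^sub>R 2 ^ j) = 1)"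
proof (cases "norm \<xi> \<le> 1")
  case True
  have "\<phi>0 (\<xi> /\<^sub>R 2 ^ j) = 1" for j
  proof (rule cutoff_1)
    have "(1::real) \<le> 2 ^ j" by simp
    then have "norm \<xi> \<le> 2 ^ j" using True by linarith
    then show "norm (\<xi> /\<^sub>R 2 ^ j) \<le> 1" by (simp add: field_simps)
  qed
  then show ?thesis by (intro exI[of _ 0]) auto
next
  case False
  obtain m where m: "norm \<xi> < 2 ^ m" using real_arch_pow[of 2 "norm \<xi>"] by auto
  define l where "l = (LEAST m. norm \<xi> < 2 ^ m)"
  have l1: "norm \<xi> < 2 ^ l" unfolding l_def by (rule LeastI[of _ m]) (rule m)
  have "l \<noteq> 0" using l1 False by (cases l) auto
  then obtain k where k: "l = Suc k" by (cases l) auto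
  have "\<not> norm \<xi> < 2 ^ k" using not_less_Least[of k "\<lambda>m. norm \<xi> < 2 ^ m"] k l_def by auto
  \<comment> \<open>Now \<open>2^k <= |\<xi>| < 2^(k+1)\<close>. Scales below k shrink \<xi> to norm
    at least 2 > 3/2, scales above k to norm below 1; only the cutoff at scale k itself stays
    undetermined.\<close>
  have "\<phi>0 (\<xi> /\<^sub>R 2 ^ j) = 0" if "j < k" for j
  proof (rule cutoff_0)
    have "(2::real) * 2 ^ j \<le> 2 ^ k" using that power_increasing[of "Suc j" k "2::real"] by simp
    then have "2 * 2 ^ j \<le> norm \<xi>" using \<open>\<not> norm \<xi> < 2 ^ k\<close> by simp
    moreover have "(0::real) < 2 ^ j" by simp
    ultimately have "3/2 * 2 ^ j < norm \<xi>" by linarith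
    then show "3/2 < norm (\<xi> /\<^sub>R 2 ^ j)" by (simp add: divide_simps mult.commute)
  qed
  moreover have "\<phi>0 (\<xi> /\<^sub>R 2 ^ j) = 1" if "k < j" for j
  proof (rule cutoff_1)
    have "(2::real) ^ l \<le> 2 ^ j" using that k by (intro power_increasing) auto
    then have "norm \<xi> \<le> 2 ^ j" using l1 by linarith
    then show "norm (\<xi> /\<^sub>R 2 ^ j) \<le> 1" by (simp add: field_simps)
  qed
  ultimately show ?thesis by blast
qed

lemma LP_piece_eq: "LP_piece \<phi>0 j \<xi> = (if j = 0 then \<phi>0 \<xi> else \<phi>0 (\<xi> /\<^sub>R 2 ^ j) - \<phi>0 (\<xi> /\<^sub>R 2 ^ (j - 1)))"
proof (cases j)
  case (Suc i)
  have 1: "1 - real (Suc i) = - real i" by simp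
  have 2: "(2::real) powr (1 - real (Suc i)) = inverse (2 ^ i)"
    unfolding 1 powr_minus by (simp add: powr_realpow)
  show ?thesis unfolding Suc LP_piece_def LP_piece1_def 2 by simp
qed (simp add: LP_piece_def)

text \<open>Only the Littlewood--Paley pieces k and k + 1 can be nonzero at \<xi>, so w = d - s ln 2
  with s the cutoff value at the transition scale k. The pieces before k vanish, those after k
  telescope to 1/d, and piece k makes up the difference.\<close>

lemma piece_sums: "(\<lambda>j. piece j \<xi>) sums (1 / log_weight \<phi>0 \<xi>)"
proof -
  obtain k where k: "\<And>j. j < k \<Longrightarrow> \<phi>0 (\<xi> /\<^sub>R 2 ^ j) = 0" "\<And>j. k < j \<Longrightarrow> \<phi>0 (\<xi> /\<^sub>R 2 ^ j) = 1"
    using transition_scale by blast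
  define s where "s = \<phi>0 (\<xi> /\<^sub>R 2 ^ k)"
  let ?L = "ln (2::real)"
  define d where "d = 1 + real (Suc k) * ?L"
  have dpos: "d > 0" unfolding d_def by (intro add_pos_nonneg) auto
  have wd: "weight_coeff (Suc k) = 1 / d" by (simp add: weight_coeff_def d_def)
  have ds: "?L * s < d"
  proof -
    have "?L * s \<le> ?L * 1" using cutoff_range[of "\<xi> /\<^sub>R 2 ^ k"] unfolding s_def by (intro mult_left_mono) auto
    also have "\<dots> < d"
    proof -
      have "0 \<le> real k * ?L" by simp
      then show ?thesis unfolding d_def of_nat_Suc distrib_right by linarith
    qed
    finally show ?thesis .
  qed
  have lw: "log_weight \<phi>0 \<xi> = d - ?L * s"
  proof -
    have z: "LP_piece \<phi>0 j \<xi> = 0" if "j \<notin> {k, Suc k}" for j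
      using that k(1)[of j] k(1)[of "j-1"] k(2)[of j] k(2)[of "j-1"] unfolding LP_piece_eq
      by (cases "j < k"; cases j) (auto simp: not_less)
    have "log_weight \<phi>0 \<xi> = (\<Sum>j\<in>{k, Suc k}. (1 + real j * ?L) * LP_piece \<phi>0 j \<xi>)"
      unfolding log_weight_def by (rule suminf_finite) (auto simp: z)
    also have "LP_piece \<phi>0 k \<xi> = s" using k(1)[of "k - 1"] unfolding LP_piece_eq s_def by (cases k) auto
    moreover have "LP_piece \<phi>0 (Suc k) \<xi> = 1 - s" using k(2)[of "Suc k"] unfolding LP_piece_eq s_def by simp
    moreover have "(1 + real k * ?L) * s + (1 + real (Suc k) * ?L) * (1 - s) = d - ?L * s"
      unfolding d_def of_nat_Suc by algebra
    ultimately show ?thesis by simp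
  qed
  have "(\<lambda>j. weight_coeff (j + Suc k) - weight_coeff (Suc j + Suc k)) sums (weight_coeff (0 + Suc k) - 0)"
    by (rule telescope_sums') (rule LIMSEQ_ignore_initial_segment[OF weight_coeff_tendsto])
  moreover have "weight_coeff (j + Suc k) - weight_coeff (Suc j + Suc k) = piece (j + Suc k) \<xi>" for j
  proof -
    define w where "w = 1 + real (j + Suc k) * ?L"
    have w: "w > 0" unfolding w_def by (intro add_pos_nonneg) auto
    have w2: "weight_coeff (j + Suc k) = 1 / w" "weight_coeff (Suc (j + Suc k)) = 1 / (w + ?L)"
      unfolding w_def weight_coeff_def by (simp_all only: add_Suc of_nat_Suc[of "j + Suc k"] distrib_right mult_1 add_ac)
    have L: "?L > 0" by (rule ln_gt_zero) simp
    have "1 / w - 1 / (w + ?L) = ?L * (1 / (w + ?L))\<^sup>2 * (1 / (1 - ?L * (1 / (w + ?L))))"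
      using reciprocal_increment(1)[OF w L] .
    moreover have "\<phi>0 (\<xi> /\<^sub>R 2 ^ (j + Suc k)) = 1" by (rule k(2)) simp
    ultimately show ?thesis unfolding piece_def add_Suc w2 by (simp only: mult_1_right)
  qed
  ultimately have "(\<lambda>j. piece (j + Suc k) \<xi>) sums (weight_coeff (0 + Suc k) - 0)" by (simp only:)
  then have "(\<lambda>j. piece (j + Suc k) \<xi>) sums (1 / d)" by (simp only: wd add_0 diff_zero)
  then have "(\<lambda>j. piece j \<xi>) sums (1 / d + (\<Sum>j<Suc k. piece j \<xi>))"
    by (subst (asm) sums_iff_shift)
  also have "(\<Sum>j<Suc k. piece j \<xi>) = piece k \<xi>" using k(1) by (simp add: piece_def)
  also have "1 / d + piece k \<xi> = 1 / (d - ?L * s)"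
    unfolding piece_def s_def[symmetric] wd by (rule reciprocal_increment(2)[OF dpos ds])
  finally show ?thesis by (simp add: lw)
qed

lemma piece_summable_bound: "norm (complex_of_real (piece j \<xi>)) \<le> 2 / ln 2 * (1 / (1 + real j)\<^sup>2)"
proof -
  have "norm (complex_of_real (piece j \<xi>)) = piece j \<xi>"
    unfolding norm_of_real using piece_bounds(1)[of j \<xi>] by simp
  also have "\<dots> \<le> 2 / ln 2 * (1 / (1 + real j)\<^sup>2) * \<phi>0 (\<xi> /\<^sub>R 2 ^ j)" by (rule piece_bounds)
  also have "\<dots> \<le> 2 / ln 2 * (1 / (1 + real j)\<^sup>2) * 1"
    by (intro mult_left_mono cutoff_range) simp
  finally show ?thesis by simp
qed

lemma piece_integrable: "integrable lborel (\<lambda>\<xi>. complex_of_real (piece j \<xi>))"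
proof (rule Bochner_Integration.integrable_bound)
  show "integrable lborel (\<lambda>\<xi>. 2 / ln 2 * (1 / (1 + real j)\<^sup>2) * \<phi>0 (0 + inverse (2 ^ j) *\<^sub>R \<xi>))"
    using integrable_lborel_affine[of \<phi>0 "inverse (2 ^ j)" 0] cutoff_measurable schwartz_integrable[OF cutoff_schwartz] by simp
  show "AE \<xi> in lborel. norm (complex_of_real (piece j \<xi>))
      \<le> norm (2 / ln 2 * (1 / (1 + real j)\<^sup>2) * \<phi>0 (0 + inverse (2 ^ j) *\<^sub>R \<xi>))"
  proof (rule AE_I2)
    fix \<xi> :: "real^'n"
    show "norm (complex_of_real (piece j \<xi>)) \<le> norm (2 / ln 2 * (1 / (1 + real j)\<^sup>2) * \<phi>0 (0 + inverse (2 ^ j) *\<^sub>R \<xi>))"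
      using piece_bounds[of j \<xi>] unfolding norm_of_real real_norm_def add_0 by linarith
  qed
qed simp

lemma kernel_summable:
  assumes "z \<noteq> 0"
  shows "summable (\<lambda>j. norm (kernel j z))"
proof -
  obtain C where C: "C \<ge> 0" "\<And>j z. norm (kernel j z) \<le> C * (1 / (1 + real j)\<^sup>2 * ((2 ^ j) ^ CARD('n) * decay (2 ^ j *\<^sub>R z)))"
    using kernel_bound by blast
  have bound: "norm (kernel j z) \<le> C * (1 / norm z ^ (CARD('n) + 1)) * (1 / 2) ^ j" for j
  proof -
    have "1 / (1 + real j)\<^sup>2 * ((2 ^ j) ^ CARD('n) * decay (2 ^ j *\<^sub>R z)) \<le> 1 * (1 / norm z ^ (CARD('n) + 1) * (1 / 2 ^ j))"
    proof (rule mult_mono[OF _ dilated_decay_bound[OF assms]])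
      show "1 / (1 + real j)\<^sup>2 \<le> 1" by simp
      show "0 \<le> (2 ^ j) ^ CARD('n) * decay (2 ^ j *\<^sub>R z)"
        by (intro mult_nonneg_nonneg less_imp_le[OF decay_pos]) simp
    qed simp
    then have "norm (kernel j z) \<le> C * (1 * (1 / norm z ^ (CARD('n) + 1) * (1 / 2 ^ j)))"
      by (rule order_trans[OF C(2) mult_left_mono[OF _ C(1)]])
    then show ?thesis by (simp only: power_one_over mult_1 mult.assoc)
  qed
  show ?thesis
  proof (rule summable_comparison_test'[where N=0])
    show "summable (\<lambda>j. C * (1 / norm z ^ (CARD('n) + 1)) * (1 / 2) ^ j)"
      by (rule summable_mult[OF summable_geometric]) simp
    show "norm (norm (kernel j z)) \<le> C * (1 / norm z ^ (CARD('n) + 1)) * (1 / 2) ^ j" for j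
      using bound by simp
  qed
qed

text \<open>The multiplier, transposed onto test functions, is a correlation with the summed kernel.
  For one piece this is \<open>fourier_mult_inv_fourier\<close>; on both sides the L^1 norms of the
  terms are \<open>O((1 + j)^-2)\<close>, so both series may be integrated termwise.\<close>

lemma weight_multiplier_eq_convolution:
  fixes \<phi> :: "real^'n \<Rightarrow> complex"
  assumes "\<phi> \<in> schwartz"
  shows "fourier (\<lambda>\<xi>. of_real (1 / log_weight \<phi>0 \<xi>) * inv_fourier \<phi> \<xi>) y = (LINT z|lborel. (\<Sum>j. kernel j (z - y)) * \<phi> z)"
proof -
  have [measurable]: "\<phi> \<in> borel_measurable borel" by (rule schwartz_measurable[OF assms])
  have [measurable]: "inv_fourier \<phi> \<in> borel_measurable borel" by (rule inv_fourier_measurable) simp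
  have lw: "1 / log_weight \<phi>0 \<xi> = (\<Sum>j. piece j \<xi>)" for \<xi>
    using piece_sums by (rule sums_unique)
  obtain A where A: "\<And>\<xi>. norm (inv_fourier \<phi> \<xi>) \<le> A * decay \<xi>" "A \<ge> 0"
    using inv_fourier_schwartz_decay[OF assms] by blast
  obtain C where C: "C \<ge> 0" "\<And>j z. norm (kernel j z) \<le> C * (1 / (1 + real j)\<^sup>2 * ((2 ^ j) ^ CARD('n) * decay (2 ^ j *\<^sub>R z)))"
    using kernel_bound by blast
  define B where "B = schwartz_seminorm 0 [] \<phi>"
  have B: "norm (\<phi> z) \<le> B" for z unfolding B_def by (rule schwartz_bounded[OF assms])
  have B0: "B \<ge> 0" unfolding B_def by (rule schwartz_seminorm_nonneg[OF assms])
  let ?F = "\<lambda>j \<xi>. cis (- (\<xi> \<bullet> y)) * (complex_of_real (piece j \<xi>) * inv_fourier \<phi> \<xi>)"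
  let ?G = "\<lambda>j z. kernel j (z - y) * \<phi> z"
  have F_bound: "norm (?F j \<xi>) \<le> 2 / ln 2 * (1 / (1 + real j)\<^sup>2) * (A * decay \<xi>)" for j \<xi>
    unfolding norm_mult norm_cis mult_1_left
    by (intro mult_mono piece_summable_bound A) simp_all
  have F_int: "integrable lborel (?F j)" for j
    by (rule Bochner_Integration.integrable_bound[where f="\<lambda>\<xi>. 2 / ln 2 * (1 / (1 + real j)\<^sup>2) * (A * decay \<xi>)"])
       (use F_bound A in \<open>auto simp: integrable_decay abs_mult\<close>)
  have "(\<lambda>j. LINT \<xi>|lborel. ?F j \<xi>) sums (LINT \<xi>|lborel. (\<Sum>j. ?F j \<xi>))"
  proof (rule sums_integral[OF F_int])
    show "AE \<xi> in lborel. summable (\<lambda>j. norm (?F j \<xi>))"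
    proof (rule AE_I2)
      fix \<xi> :: "real^'n"
      have "summable (\<lambda>j. (2 / ln 2 * (A * decay \<xi>)) * (1 / (1 + real j)\<^sup>2))"
        by (rule summable_mult[OF summable_inverse_square])
      then show "summable (\<lambda>j. norm (?F j \<xi>))"
        by (rule summable_comparison_test'[where N=0]) (use F_bound[where \<xi>=\<xi>] in \<open>simp add: mult_ac\<close>)
    qed
    show "summable (\<lambda>j. LINT \<xi>|lborel. norm (?F j \<xi>))"
    proof (rule summable_comparison_test'[where N=0])
      show "summable (\<lambda>j. (2 / ln 2 * (A * (LINT \<xi>|lborel. decay (\<xi>::real^'n)))) * (1 / (1 + real j)\<^sup>2))"
        by (rule summable_mult[OF summable_inverse_square])
      fix j
      have "(LINT \<xi>|lborel. norm (?F j \<xi>)) \<le> (LINT \<xi>|lborel. 2 / ln 2 * (1 / (1 + real j)\<^sup>2) * (A * decay (\<xi> :: real^'n)))"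
        by (intro integral_mono integrable_norm F_int F_bound) (simp add: integrable_decay)
      then show "norm (LINT \<xi>|lborel. norm (?F j \<xi>)) \<le> (2 / ln 2 * (A * (LINT \<xi>|lborel. decay (\<xi>::real^'n)))) * (1 / (1 + real j)\<^sup>2)"
        by (simp add: mult_ac)
    qed
  qed
  also have "(\<lambda>j. LINT \<xi>|lborel. ?F j \<xi>) = (\<lambda>j. LINT z|lborel. ?G j z)"
    unfolding kernel_def
    by (intro ext fourier_mult_inv_fourier piece_integrable schwartz_integrable assms) simp
  finally have 1: "(\<lambda>j. LINT z|lborel. ?G j z) sums (LINT \<xi>|lborel. (\<Sum>j. ?F j \<xi>))" .
  have G_nn: "(\<integral>\<^sup>+z. ennreal (norm (?G j z)) \<partial>lborel) \<le> ennreal (B * C * (LINT z|lborel. decay (z::real^'n)) * (1 / (1 + real j)\<^sup>2))" for j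
  proof -
    have "(\<integral>\<^sup>+z. ennreal (norm (?G j z)) \<partial>lborel) \<le>
        (\<integral>\<^sup>+z. ennreal (B * C * (1 / (1 + real j)\<^sup>2)) * ennreal ((2 ^ j) ^ CARD('n) * decay (2 ^ j *\<^sub>R (z - y))) \<partial>lborel)"
    proof (rule nn_integral_mono)
      fix z :: "real^'n"
      have "norm (?G j z) \<le> (C * (1 / (1 + real j)\<^sup>2 * ((2 ^ j) ^ CARD('n) * decay (2 ^ j *\<^sub>R (z - y))))) * B"
        unfolding norm_mult
        by (intro mult_mono C B mult_nonneg_nonneg less_imp_le[OF decay_pos]) simp_all
      also have "\<dots> = B * C * (1 / (1 + real j)\<^sup>2) * ((2 ^ j) ^ CARD('n) * decay (2 ^ j *\<^sub>R (z - y)))" by simp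
      finally show "ennreal (norm (?G j z)) \<le> ennreal (B * C * (1 / (1 + real j)\<^sup>2)) * ennreal ((2 ^ j) ^ CARD('n) * decay (2 ^ j *\<^sub>R (z - y)))"
        using B0 C(1) by (simp add: ennreal_leI flip: ennreal_mult')
    qed
    also have "\<dots> = ennreal (B * C * (1 / (1 + real j)\<^sup>2)) * (\<integral>\<^sup>+z. ennreal (decay (z::real^'n)) \<partial>lborel)"
      by (subst nn_integral_cmult) (simp_all add: nn_integral_dilated_decay)
    also have "(\<integral>\<^sup>+z. ennreal (decay (z::real^'n)) \<partial>lborel) = ennreal (LINT z|lborel. decay (z::real^'n))"
      by (rule nn_integral_eq_integral[OF integrable_decay]) (simp add: less_imp_le decay_pos)
    also have "ennreal (B * C * (1 / (1 + real j)\<^sup>2)) * ennreal (LINT z|lborel. decay (z::real^'n))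
        = ennreal (B * C * (1 / (1 + real j)\<^sup>2) * (LINT z|lborel. decay (z::real^'n)))"
      using B0 C(1) by (intro ennreal_mult'[symmetric]) simp
    finally show ?thesis by (simp only: mult_ac)
  qed
  have G_int: "integrable lborel (?G j)" for j
    unfolding integrable_iff_bounded
    by (intro conjI order_le_less_trans[OF G_nn]) simp_all
  have D0: "0 \<le> (LINT z|lborel. decay (z::real^'n))"
    by (rule integral_nonneg_AE) (simp add: less_imp_le decay_pos)
  have "(\<lambda>j. LINT z|lborel. ?G j z) sums (LINT z|lborel. (\<Sum>j. ?G j z))"
  proof (rule sums_integral[OF G_int])
    \<comment> \<open>Absolute convergence of the kernel series is known away from its singularity
      only; the exceptional point z = y is null.\<close>
    show "AE z in lborel. summable (\<lambda>j. norm (?G j z))"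
      using AE_lborel_singleton[of y]
    proof eventually_elim
      fix z assume "z \<noteq> y"
      then show "summable (\<lambda>j. norm (?G j z))"
        using kernel_summable[of "z - y"] by (simp only: norm_mult) (intro summable_mult2, simp)
    qed
    show "summable (\<lambda>j. LINT z|lborel. norm (?G j z))"
    proof (rule summable_comparison_test'[where N=0])
      show "summable (\<lambda>j. B * C * (LINT z|lborel. decay (z::real^'n)) * (1 / (1 + real j)\<^sup>2))"
        by (rule summable_mult[OF summable_inverse_square])
      fix j
      have "ennreal (LINT z|lborel. norm (?G j z)) = (\<integral>\<^sup>+z. ennreal (norm (?G j z)) \<partial>lborel)"
        by (rule nn_integral_eq_integral[symmetric]) (use G_int in \<open>auto intro: integrable_norm\<close>)
      also note G_nn
      finally show "norm (LINT z|lborel. norm (?G j z)) \<le> B * C * (LINT z|lborel. decay (z::real^'n)) * (1 / (1 + real j)\<^sup>2)"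
        using B0 C(1) D0 by (subst (asm) ennreal_le_iff) (auto intro!: mult_nonneg_nonneg)
    qed
  qed
  with 1 have eq: "(LINT \<xi>|lborel. (\<Sum>j. ?F j \<xi>)) = (LINT z|lborel. (\<Sum>j. ?G j z))" by (rule sums_unique2)
  have sF: "(\<Sum>j. ?F j \<xi>) = cis (- (\<xi> \<bullet> y)) * (of_real (1 / log_weight \<phi>0 \<xi>) * inv_fourier \<phi> \<xi>)" for \<xi>
  proof -
    have "(\<lambda>j. complex_of_real (piece j \<xi>)) sums of_real (1 / log_weight \<phi>0 \<xi>)"
      by (rule sums_of_real[OF piece_sums])
    then show ?thesis by (intro sums_unique[symmetric] sums_mult sums_mult2)
  qed
  have sG: "(\<Sum>j. ?G j z) = (\<Sum>j. kernel j (z - y)) * \<phi> z" if "z \<noteq> y" for z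
  proof -
    have "z - y \<noteq> 0" using that by simp
    then have "summable (\<lambda>j. kernel j (z - y))" by (rule summable_norm_cancel[OF kernel_summable])
    then show ?thesis by (rule suminf_mult2[symmetric])
  qed
  have [measurable]: "log_weight \<phi>0 \<in> borel_measurable borel"
  proof -
    have "log_weight \<phi>0 \<xi> = inverse (\<Sum>j. piece j \<xi>)" for \<xi>
      by (simp flip: lw)
    then have eq: "log_weight \<phi>0 = (\<lambda>\<xi>. inverse (\<Sum>j. piece j \<xi>))" by (rule ext)
    show ?thesis by (subst eq) measurable
  qed
  have "fourier (\<lambda>\<xi>. of_real (1 / log_weight \<phi>0 \<xi>) * inv_fourier \<phi> \<xi>) y = (LINT \<xi>|lborel. (\<Sum>j. ?F j \<xi>))"
    unfolding sF by (rule fourier_lborel) simp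
  also have "\<dots> = (LINT z|lborel. (\<Sum>j. kernel j (z - y)) * \<phi> z)"
    unfolding eq
  proof (rule integral_cong_AE)
    show "AE z in lborel. (\<Sum>j. ?G j z) = (\<Sum>j. kernel j (z - y)) * \<phi> z"
      using AE_lborel_singleton[of y] by eventually_elim (rule sG)
  qed simp_all
  finally show ?thesis .
qed

end

section \<open>Uniqueness of the representing function\<close>

lemma lebesgue_borel_representative:
  fixes f :: "real ^ 'n::finite \<Rightarrow> complex"
  assumes "f \<in> borel_measurable lebesgue"
  obtains f' where "f' \<in> borel_measurable borel" "AE x in lborel. f x = f' x"
proof -
  have "(\<lambda>x. Re (f x)) \<in> borel_measurable (completion lborel)" "(\<lambda>x. Im (f x)) \<in> borel_measurable (completion lborel)"
    using assms by auto
  from this[THEN completion_ex_borel_measurable_real]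
  obtain r i where ri: "r \<in> borel_measurable lborel" "AE x in lborel. Re (f x) = r x"
      "i \<in> borel_measurable lborel" "AE x in lborel. Im (f x) = i x" by auto
  show thesis
  proof (rule that)
    show "(\<lambda>x. Complex (r x) (i x)) \<in> borel_measurable borel"
      using ri(1,3) by (simp add: borel_measurable_complex_iff)
    show "AE x in lborel. f x = Complex (r x) (i x)"
      using ri(2,4) by eventually_elim (simp add: complex_eq_iff)
  qed
qed

lemma AE_lborel_imp_lebesgue: "AE x in lborel. P x \<Longrightarrow> AE x in lebesgue. P x"
  by (rule AE_completion)

text \<open>Lebesgue differentiation: at almost every point the averages over shrinking boxes
  converge to u, and all of them are 0.\<close>

lemma AE_eq_0_if_cbox_integrals_0:
  fixes u :: "'a::euclidean_space \<Rightarrow> complex"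
  assumes int: "\<And>a b. integrable lborel (\<lambda>x. indicator (cbox a b) x *\<^sub>R u x)"
    and zero: "\<And>a b. (LINT x|lborel. indicator (cbox a b) x *\<^sub>R u x) = 0"
  shows "AE x in lebesgue. u x = 0"
proof -
  have hk: "(u has_integral 0) (cbox a b)" for a b
  proof -
    have "((\<lambda>x. indicator (cbox a b) x *\<^sub>R u x) has_integral 0) UNIV"
      using has_integral_integral_lborel[OF int[of a b]] by (simp add: zero)
    moreover have "(\<lambda>x. indicator (cbox a b) x *\<^sub>R u x) = (\<lambda>x. if x \<in> cbox a b then u x else 0)"
      by (auto simp: fun_eq_iff)
    ultimately show ?thesis by (simp add: has_integral_restrict_UNIV)
  qed
  have "\<And>a b. u integrable_on cbox a b" using hk by blast
  then obtain N where N: "negligible N"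
    "\<And>x e. \<lbrakk>x \<notin> N; 0 < e\<rbrakk> \<Longrightarrow> \<exists>d>0. \<forall>h. 0 < h \<and> h < d \<longrightarrow>
        norm (integral (cbox x (x + h *\<^sub>R One)) u /\<^sub>R h ^ DIM('a) - u x) < e"
    using integrable_ccontinuous_explicit by metis
  have "u x = 0" if xN: "x \<notin> N" for x
  proof (rule ccontr)
    assume "u x \<noteq> 0"
    then obtain d where d: "d > 0" "\<And>h. 0 < h \<and> h < d \<Longrightarrow>
        norm (integral (cbox x (x + h *\<^sub>R One)) u /\<^sub>R h ^ DIM('a) - u x) < norm (u x)"
      using N(2)[OF xN, of "norm (u x)"] by auto
    have "integral (cbox x (x + (d/2) *\<^sub>R One)) u = 0" using hk by (rule integral_unique)
    then show False using d(2)[of "d/2"] d(1) by simp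
  qed
  then have "{x. u x \<noteq> 0} \<subseteq> N" by blast
  then show ?thesis
    using N(1) by (auto simp: negligible_iff_null_sets intro: AE_I')
qed

text \<open>Mollifying the indicator of a box with the cutoff shows that \<open>u\<close> integrates to 0 over the box.\<close>

lemma AE_eq_0_if_cutoff_integrals_0:
  fixes u :: "real ^ 'n::finite \<Rightarrow> complex" and \<Phi> :: "real ^ 'n \<Rightarrow> real"
  assumes [measurable]: "u \<in> borel_measurable borel" "\<Phi> \<in> borel_measurable borel"
    and u: "\<And>R. integrable lborel (\<lambda>x. indicator (cball 0 R) x *\<^sub>R u x)"
    and \<Phi>: "\<And>x. 0 \<le> \<Phi> x" "\<And>x. 2 < norm x \<Longrightarrow> \<Phi> x = 0" "integrable lborel \<Phi>" "(LINT x|lborel. \<Phi> x) > 0"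
    and zero: "\<And>x r. 0 < r \<Longrightarrow> (LINT y|lborel. \<Phi> ((y - x) /\<^sub>R r) *\<^sub>R u y) = 0"
  shows "AE x in lebesgue. u x = 0"
proof (rule AE_eq_0_if_cbox_integrals_0)
  fix a b :: "real ^ 'n"
  let ?E = "cbox a b"
  let ?r = "\<lambda>k. 1 / real (Suc k)"
  obtain R where R: "R > 0" "?E \<subseteq> cball 0 R"
    using bounded_cbox[of a b] unfolding bounded_pos by (metis mem_cball_0 subsetI)
  let ?B = "cball (0::real^'n) (R + 2)"
  let ?U = "LINT y|lborel. norm (indicator ?B y *\<^sub>R u y)"
  have B_int: "integrable lborel (\<lambda>y. norm (indicator ?B y *\<^sub>R u y))" by (rule integrable_norm[OF u])
  show int: "integrable lborel (\<lambda>x. indicator ?E x *\<^sub>R u x)"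
    by (rule Bochner_Integration.integrable_bound[OF u[of R]]) (use R in \<open>auto simp: indicator_def subset_eq intro!: AE_I2\<close>)
  \<comment> \<open>The cutoff lives on |z| <= 2 and the steps \<open>?r k\<close> are at most 1, so
    all shifted boxes stay in one ball; this yields a dominating function independent of k.\<close>
  have in_B: "y \<in> ?B" if "norm z \<le> 2" "y - ?r k *\<^sub>R z \<in> ?E" for k z y
  proof -
    have "norm (?r k *\<^sub>R z) \<le> 1 * 2"
      unfolding norm_scaleR using that(1) by (intro mult_mono) auto
    moreover have "norm (y - ?r k *\<^sub>R z) \<le> R" using that(2) R(2) by auto
    ultimately show ?thesis using norm_triangle_ineq2[of y "?r k *\<^sub>R z"] by simp
  qed
  let ?g = "\<lambda>k z y. indicator ?E (y - ?r k *\<^sub>R z) *\<^sub>R u y"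
  have g_le: "norm (?g k z y) \<le> norm (indicator ?B y *\<^sub>R u y)" if "norm z \<le> 2" for k z y
    using in_B[OF that, where y=y and k=k] by (auto simp: indicator_def)
  have g_int: "integrable lborel (?g k z)" if "norm z \<le> 2" for k z
    by (rule Bochner_Integration.integrable_bound[OF B_int]) (use g_le[OF that] in simp_all)
  let ?H = "\<lambda>k z. \<Phi> z *\<^sub>R (LINT y|lborel. ?g k z y)"
  have H_le: "norm (?H k z) \<le> \<Phi> z * ?U" for k z
  proof (cases "norm z \<le> 2")
    case True
    have "norm (LINT y|lborel. ?g k z y) \<le> (LINT y|lborel. norm (?g k z y))" by (rule integral_norm_bound)
    also have "\<dots> \<le> ?U" by (intro integral_mono integrable_norm g_int True u g_le)
    finally show ?thesis using \<Phi>(1)[of z] by (simp add: mult_left_mono)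
  qed (use \<Phi>(2)[of z] in simp)
  have H_lim: "(\<lambda>k. ?H k z) \<longlonglongrightarrow> \<Phi> z *\<^sub>R (LINT y|lborel. indicator ?E y *\<^sub>R u y)" for z
  proof (cases "norm z \<le> 2")
    case True
    have "(\<lambda>k. LINT y|lborel. ?g k z y) \<longlonglongrightarrow> (LINT y|lborel. indicator ?E y *\<^sub>R u y)"
    proof (rule integral_dominated_convergence[OF _ _ B_int])
      \<comment> \<open>Off the null boundary of the box, the shifted indicators are eventually
        equal to the unshifted one.\<close>
      have "AE y in lborel. y \<notin> cbox a b - box a b"
      proof (rule AE_not_in)
        show "cbox a b - box a b \<in> null_sets lborel"
          using negligible_frontier_interval[of a b]
          by (simp add: negligible_iff_null_sets null_sets_completion_iff)
      qed
      then show "AE y in lborel. (\<lambda>k. ?g k z y) \<longlonglongrightarrow> indicator ?E y *\<^sub>R u y"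
      proof eventually_elim
        fix y assume y: "y \<notin> cbox a b - box a b"
        have "(\<lambda>k. y - ?r k *\<^sub>R z) \<longlonglongrightarrow> y - 0 *\<^sub>R z"
          using LIMSEQ_Suc[OF lim_inverse_n'] by (intro tendsto_intros) simp
        then have lim: "(\<lambda>k. y - ?r k *\<^sub>R z) \<longlonglongrightarrow> y" by simp
        have "\<forall>\<^sub>F k in sequentially. ?g k z y = indicator ?E y *\<^sub>R u y"
        proof (cases "y \<in> box a b")
          case True
          have "\<forall>\<^sub>F k in sequentially. y - ?r k *\<^sub>R z \<in> box a b"
            using topological_tendstoD[OF lim open_box True] .
          then show ?thesis
            using True box_subset_cbox[of a b] by (auto elim!: eventually_mono simp: indicator_def)
        next
          case False
          then have "y \<in> - cbox a b" using y by auto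
          then have "\<forall>\<^sub>F k in sequentially. y - ?r k *\<^sub>R z \<in> - cbox a b"
            by (intro topological_tendstoD[OF lim]) (auto simp: closed_cbox open_Compl)
          then show ?thesis
            by (rule eventually_mono) (use \<open>y \<in> - cbox a b\<close> in \<open>auto simp: indicator_def\<close>)
        qed
        then show "(\<lambda>k. ?g k z y) \<longlonglongrightarrow> indicator ?E y *\<^sub>R u y" by (rule tendsto_eventually)
      qed
      show "AE y in lborel. norm (?g k z y) \<le> norm (indicator ?B y *\<^sub>R u y)" for k
        by (rule AE_I2) (rule g_le[OF True])
    qed simp_all
    then show ?thesis by (intro tendsto_intros)
  qed (use \<Phi>(2)[of z] in simp)
  \<comment> \<open>After translating y and exchanging the integrals, the inner integral over z is,
    up to the substitution y = x + r z and a factor, one of the vanishing cutoff integrals.\<close>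
  have H_int0: "(LINT z|lborel. ?H k z) = 0" for k
  proof -
    let ?f = "\<lambda>z x. \<Phi> z *\<^sub>R (indicator ?E x *\<^sub>R u (x + ?r k *\<^sub>R z))"
    have H: "?H k z = (LINT x|lborel. ?f z x)" for z
    proof -
      have "(LINT y|lborel. ?g k z y) = (LINT x|lborel. ?g k z (x + ?r k *\<^sub>R z))"
        by (rule integral_lborel_translate[symmetric]) simp
      then show ?thesis by (simp del: scaleR_scaleR)
    qed
    have "(\<integral>\<^sup>+z. \<integral>\<^sup>+x. ennreal (norm (?f z x)) \<partial>lborel \<partial>lborel) \<le> (\<integral>\<^sup>+z. ennreal (\<Phi> z * ?U) \<partial>lborel)"
    proof (rule nn_integral_mono)
      fix z :: "real^'n"
      show "(\<integral>\<^sup>+x. ennreal (norm (?f z x)) \<partial>lborel) \<le> ennreal (\<Phi> z * ?U)"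
      proof (cases "norm z \<le> 2")
        case True
        have "(\<integral>\<^sup>+x. ennreal (norm (?f z x)) \<partial>lborel) = (\<integral>\<^sup>+x. ennreal (\<Phi> z * norm (?g k z (?r k *\<^sub>R z + 1 *\<^sub>R x))) \<partial>lborel)"
          using \<Phi>(1)[of z] by (simp add: add.commute mult.assoc)
        also have "\<dots> = (\<integral>\<^sup>+y. ennreal (\<Phi> z * norm (?g k z y)) \<partial>lborel)"
          by (subst nn_integral_lborel_affine[of "\<lambda>y. ennreal (\<Phi> z * norm (?g k z y))" 1 "?r k *\<^sub>R z"]) simp_all
        also have "\<dots> \<le> (\<integral>\<^sup>+y. ennreal (\<Phi> z * norm (indicator ?B y *\<^sub>R u y)) \<partial>lborel)"
          by (intro nn_integral_mono ennreal_leI mult_left_mono g_le True \<Phi>)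
        also have "\<dots> = ennreal (\<Phi> z * ?U)"
          using \<Phi>(1)[of z] by (subst nn_integral_eq_integral) (use B_int in simp_all)
        finally show ?thesis .
      qed (use \<Phi>(2)[of z] in simp)
    qed
    also have "\<dots> < \<infinity>"
      using \<Phi> by (subst nn_integral_eq_integral) (auto intro!: mult_nonneg_nonneg)
    finally have "(LINT z|lborel. LINT x|lborel. ?f z x) = (LINT x|lborel. LINT z|lborel. ?f z x)"
      by (intro integral_lborel_swap) simp_all
    also have "\<dots> = (LINT x|(lborel :: (real^'n) measure). 0)"
    proof (intro Bochner_Integration.integral_cong refl)
      fix x :: "real^'n"
      have "0 = (LINT y|lborel. \<Phi> ((y - x) /\<^sub>R ?r k) *\<^sub>R u y)" by (rule zero[symmetric]) simp
      also have "\<dots> = \<bar>?r k\<bar> ^ DIM(real^'n) *\<^sub>R (LINT z|lborel. \<Phi> ((x + ?r k *\<^sub>R z - x) /\<^sub>R ?r k) *\<^sub>R u (x + ?r k *\<^sub>R z))"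
        by (rule integral_lborel_affine) simp_all
      finally have "(LINT z|lborel. \<Phi> z *\<^sub>R u (x + ?r k *\<^sub>R z)) = 0" by simp
      then show "(LINT z|lborel. ?f z x) = 0"
        by (cases "x \<in> ?E") simp_all
    qed
    finally show ?thesis unfolding H by simp
  qed
  have "(\<lambda>k. LINT z|lborel. ?H k z) \<longlonglongrightarrow> (LINT z|lborel. \<Phi> z *\<^sub>R (LINT y|lborel. indicator ?E y *\<^sub>R u y))"
    by (rule integral_dominated_convergence[where w="\<lambda>z. \<Phi> z * ?U"]) (use H_lim H_le \<Phi>(3) in simp_all)
  then have "(LINT z|lborel. \<Phi> z) *\<^sub>R (LINT y|lborel. indicator ?E y *\<^sub>R u y) = 0"
    unfolding H_int0 integral_scaleR_left[OF \<Phi>(3)] by (simp add: LIMSEQ_const_iff)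
  then show "(LINT y|lborel. indicator ?E y *\<^sub>R u y) = 0" using \<Phi>(4) by simp
qed

text \<open>The function spaces refer to the completed measure, whereas the arguments with product
  measures concern Borel functions; this is the passage between the two.\<close>

lemma lebesgue_integral_representative:
  fixes f f' :: "real ^ 'n::finite \<Rightarrow> 'b::{banach, second_countable_topology}"
  assumes "f \<in> borel_measurable lebesgue" "f' \<in> borel_measurable borel" "AE x in lborel. f x = f' x"
  shows "(LINT x|lebesgue. f x) = (LINT x|lborel. f' x)"
    and "integrable lebesgue f \<longleftrightarrow> integrable lborel f'"
proof -
  have f': "f' \<in> borel_measurable lebesgue" using assms(2) by (simp add: measurable_completion)
  have AE: "AE x in lebesgue. f x = f' x" by (rule AE_lborel_imp_lebesgue[OF assms(3)])
  show "(LINT x|lebesgue. f x) = (LINT x|lborel. f' x)"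
    using integral_cong_AE[OF assms(1) f' AE] assms(2) by (simp add: integral_completion)
  show "integrable lebesgue f \<longleftrightarrow> integrable lborel f'"
    using integrable_cong_AE[OF assms(1) f' AE] assms(2) by (simp add: integrable_completion)
qed

lemma Lp_borel_representative:
  fixes f :: "real ^ 'n::finite \<Rightarrow> complex"
  assumes "f \<in> Lp p"
  obtains f' where "f' \<in> borel_measurable borel" "AE x in lborel. f x = f' x"
    "integrable lborel (\<lambda>x. norm (f' x) powr p)"
    "(LINT x|lebesgue. norm (f x) powr p) = (LINT x|lborel. norm (f' x) powr p)"
proof -
  have f: "f \<in> borel_measurable lebesgue" "integrable lebesgue (\<lambda>x. norm (f x) powr p)"
    using assms by (auto simp: Lp_def)
  obtain f' where f': "f' \<in> borel_measurable borel" "AE x in lborel. f x = f' x"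
    using lebesgue_borel_representative[OF f(1)] by blast
  have m: "(\<lambda>x. norm (f x) powr p) \<in> borel_measurable lebesgue" "(\<lambda>x. norm (f' x) powr p) \<in> borel_measurable borel"
    using f(1) f'(1) by measurable
  have ae: "AE x in lborel. norm (f x) powr p = norm (f' x) powr p" using f'(2) by eventually_elim simp
  show thesis
    using that[OF f'] lebesgue_integral_representative[OF m ae] f(2) by blast
qed

lemma le_1_plus_powr: "0 \<le> (t::real) \<Longrightarrow> 1 \<le> p \<Longrightarrow> t \<le> 1 + t powr p"
proof (cases "t \<le> 1")
  case False
  assume "1 \<le> p"
  then have "t powr 1 \<le> t powr p" using False by (intro powr_mono) auto
  then show ?thesis using False by simp
qed (simp add: add_increasing2)

text \<open>\<open>Lp_norm_dist\<close> evaluates the norm at a representative picked by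
  \<open>SOME\<close>, so an estimate for a concrete representative counts only through uniqueness.
  The difference of two representatives pairs to 0 with every translate and dilate of the
  cutoff.\<close>

lemma Lp_representative_unique:
  fixes \<phi>0 :: "real ^ 'n::finite \<Rightarrow> real" and h h' :: "real ^ 'n \<Rightarrow> complex"
  assumes cutoff: "LP_cutoff \<phi>0" and p: "1 \<le> p"
    and h: "Lp_represents p T h" and h': "Lp_represents p T h'"
  shows "Lp_norm p h = Lp_norm p h'"
proof -
  obtain k where k: "k \<in> borel_measurable borel" "AE x in lborel. h x = k x"
    "integrable lborel (\<lambda>x. norm (k x) powr p)" "(LINT x|lebesgue. norm (h x) powr p) = (LINT x|lborel. norm (k x) powr p)"
    using Lp_borel_representative[of h p] h unfolding Lp_represents_def by blast
  obtain k' where k': "k' \<in> borel_measurable borel" "AE x in lborel. h' x = k' x"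
    "integrable lborel (\<lambda>x. norm (k' x) powr p)" "(LINT x|lebesgue. norm (h' x) powr p) = (LINT x|lborel. norm (k' x) powr p)"
    using Lp_borel_representative[of h' p] h' unfolding Lp_represents_def by blast
  have [measurable]: "k \<in> borel_measurable borel" "k' \<in> borel_measurable borel" by (fact k k')+
  have [measurable]: "\<phi>0 \<in> borel_measurable borel" by (rule cutoff_measurable[OF cutoff])
  note bd = cutoff_range[OF cutoff]
  \<comment> \<open>By \<open>t <= 1 + t^p\<close>, an L^p function is integrable against any
    integrable weight with values in [0, 1].\<close>
  have loc: "integrable lborel (\<lambda>y. w y *\<^sub>R l y)"
    if "l \<in> borel_measurable borel" "integrable lborel (\<lambda>x. norm (l x) powr p)"
      "integrable lborel w" "\<And>y. 0 \<le> w y \<and> w y \<le> 1" for l :: "real^'n \<Rightarrow> complex" and w :: "real^'n \<Rightarrow> real"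
  proof (rule Bochner_Integration.integrable_bound)
    show "integrable lborel (\<lambda>y. w y + norm (l y) powr p)" using that by simp
    have "norm (w y *\<^sub>R l y) \<le> norm (w y + norm (l y) powr p)" for y
    proof -
      have "norm (w y *\<^sub>R l y) \<le> w y * (1 + norm (l y) powr p)"
        using that(4)[of y] le_1_plus_powr[OF norm_ge_zero p, of "l y"] by (simp add: mult_left_mono)
      also have "\<dots> \<le> w y + 1 * norm (l y) powr p"
        using that(4)[of y] by (simp add: distrib_left mult_left_le_one_le)
      finally show ?thesis by simp
    qed
    then show "AE y in lborel. norm (w y *\<^sub>R l y) \<le> norm (w y + norm (l y) powr p)" by simp
  qed (use that(1) borel_measurable_integrable[OF that(3)] in measurable)
  have pair: "function_distribution g (\<lambda>y. complex_of_real (w y)) = (LINT y|lborel. w y *\<^sub>R l y)"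
    if "g \<in> borel_measurable lebesgue" "l \<in> borel_measurable borel" "AE x in lborel. g x = l x"
      "w \<in> borel_measurable borel" for g l :: "real^'n \<Rightarrow> complex" and w :: "real^'n \<Rightarrow> real"
  proof -
    have w: "w \<in> borel_measurable lebesgue" using that(4) by (simp add: measurable_completion)
    show ?thesis unfolding function_distribution_def
    proof (rule lebesgue_integral_representative)
      show "(\<lambda>x. g x * complex_of_real (w x)) \<in> borel_measurable lebesgue" using that(1) w by simp
      show "AE x in lborel. g x * complex_of_real (w x) = w x *\<^sub>R l x"
        using that(3) by eventually_elim (simp add: scaleR_conv_of_real mult.commute)
    qed (use that(2,4) in simp)
  qed
  have "AE x in lebesgue. k x - k' x = 0"
  proof (rule AE_eq_0_if_cutoff_integrals_0[where \<Phi>=\<phi>0 and u="\<lambda>x. k x - k' x"])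
    show "integrable lborel (\<lambda>x. indicator (cball 0 R) x *\<^sub>R (k x - k' x))" for R
      unfolding scaleR_diff_right
    proof (intro Bochner_Integration.integrable_diff loc k k')
      show "integrable lborel (indicator (cball (0::real^'n) R) :: _ \<Rightarrow> real)"
        by (rule integrable_real_indicator) (use emeasure_lborel_cball_finite[of "0::real^'n" R] in simp_all)
      then show "integrable lborel (indicator (cball (0::real^'n) R) :: _ \<Rightarrow> real)" .
    qed (auto simp: indicator_def)
    show "\<phi>0 x = 0" if "2 < norm x" for x using cutoff_0[OF cutoff, of x] that by simp
    show i\<phi>: "integrable lborel \<phi>0" by (rule schwartz_integrable[OF cutoff_schwartz[OF cutoff]])
    show "0 < (LINT x|lborel. \<phi>0 x)"
    proof -
      have "0 < measure lborel (ball (0::real^'n) 1)"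
        using content_ball_pos[of 1 "0::real^'n"] by simp
      also have "\<dots> = (LINT x|lborel. indicator (ball (0::real^'n) 1) x)" by simp
      also have "\<dots> \<le> (LINT x|lborel. \<phi>0 x)"
      proof (rule integral_mono[OF _ i\<phi>])
        show "integrable lborel (indicator (ball (0::real^'n) 1) :: _ \<Rightarrow> real)"
          by (rule integrable_real_indicator) (use emeasure_lborel_ball_finite[of "0::real^'n" 1] in simp_all)
        show "indicator (ball 0 1) x \<le> \<phi>0 x" for x
          using bd[of x] cutoff_1[OF cutoff, of x] by (auto simp: indicator_def)
      qed
      finally show ?thesis .
    qed
    fix x :: "real^'n" and r :: real assume r: "0 < r"
    let ?w = "\<lambda>y. \<phi>0 ((y - x) /\<^sub>R r)"
    have w_eq: "?w = (\<lambda>y. \<phi>0 (- (x /\<^sub>R r) + inverse r *\<^sub>R y))" by (simp add: fun_eq_iff scaleR_diff_right)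
    have ws: "?w \<in> schwartz" unfolding w_eq by (rule schwartz_affine[OF cutoff_schwartz[OF cutoff]]) (use r in simp)
    have wi: "integrable lborel ?w" by (rule schwartz_integrable[OF ws])
    have wc: "(\<lambda>y. complex_of_real (?w y)) \<in> schwartz" by (rule schwartz_of_real[OF ws])
    have "function_distribution h (\<lambda>y. complex_of_real (?w y)) = function_distribution h' (\<lambda>y. complex_of_real (?w y))"
      using h h' wc unfolding Lp_represents_def by metis
    moreover have "function_distribution h (\<lambda>y. complex_of_real (?w y)) = (LINT y|lborel. ?w y *\<^sub>R k y)"
      by (rule pair) (use h k in \<open>auto simp: Lp_represents_def Lp_def\<close>)
    moreover have "function_distribution h' (\<lambda>y. complex_of_real (?w y)) = (LINT y|lborel. ?w y *\<^sub>R k' y)"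
      by (rule pair) (use h' k' in \<open>auto simp: Lp_represents_def Lp_def\<close>)
    ultimately have "(LINT y|lborel. ?w y *\<^sub>R k y) = (LINT y|lborel. ?w y *\<^sub>R k' y)" by simp
    moreover have "integrable lborel (\<lambda>y. ?w y *\<^sub>R k y)" "integrable lborel (\<lambda>y. ?w y *\<^sub>R k' y)"
      using bd by (auto intro!: loc k k' wi)
    ultimately show "(LINT y|lborel. ?w y *\<^sub>R (k y - k' y)) = 0"
      by (simp add: scaleR_diff_right)
  qed (use bd in auto)
  then have "AE x in lborel. k x = k' x" by (auto simp: AE_completion_iff)
  then have "(LINT x|lborel. norm (k x) powr p) = (LINT x|lborel. norm (k' x) powr p)"
    by (intro integral_cong_AE) auto
  then show ?thesis unfolding Lp_norm_def k(4) k'(4) by simp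
qed

section \<open>Dyadic cells\<close>

text \<open>Half-open cells, so that the cells of one level partition the space; \<open>a\<close>
  translates the whole grid. Comparing floors makes membership an equivalence relation and reduces
  nesting to integer division by 2.\<close>

definition dcell :: "real ^ 'n::finite \<Rightarrow> nat \<Rightarrow> real ^ 'n \<Rightarrow> (real ^ 'n) set" where
  "dcell a j x = {y. \<forall>i. \<lfloor>2 ^ j * (y $ i - a $ i)\<rfloor> = \<lfloor>2 ^ j * (x $ i - a $ i)\<rfloor>}"

definition dcorner :: "real ^ 'n::finite \<Rightarrow> nat \<Rightarrow> real ^ 'n \<Rightarrow> real ^ 'n" where
  "dcorner a j x = (\<chi> i. a $ i + of_int \<lfloor>2 ^ j * (x $ i - a $ i)\<rfloor> / 2 ^ j)"

text \<open>The conditional expectation on the cells of level j. Values in \<open>ennreal\<close>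
  make it meaningful before any integrability is known.\<close>

definition dmean :: "real ^ 'n::finite \<Rightarrow> nat \<Rightarrow> (real ^ 'n \<Rightarrow> ennreal) \<Rightarrow> real ^ 'n \<Rightarrow> ennreal" where
  "dmean a j F x = ennreal ((2 ^ j) ^ CARD('n)) * (\<integral>\<^sup>+y. indicator (dcell a j x) y * F y \<partial>lborel)"

lemma dcell_self: "x \<in> dcell a j x"
  by (simp add: dcell_def)

lemma dcell_sym: "y \<in> dcell a j x \<longleftrightarrow> x \<in> dcell a j y"
  by (auto simp: dcell_def)

lemma dcell_eq: "y \<in> dcell a j x \<Longrightarrow> dcell a j y = dcell a j x"
  by (auto simp: dcell_def)

lemma dcell_bounds:
  assumes "y \<in> dcell a j x"
  shows "dcorner a j x $ i \<le> y $ i" "y $ i < dcorner a j x $ i + 1 / 2 ^ j"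
proof -
  have e: "\<lfloor>2 ^ j * (y $ i - a $ i)\<rfloor> = \<lfloor>2 ^ j * (x $ i - a $ i)\<rfloor>" using assms by (simp add: dcell_def)
  have "of_int \<lfloor>2 ^ j * (x $ i - a $ i)\<rfloor> \<le> 2 ^ j * (y $ i - a $ i)"
    "2 ^ j * (y $ i - a $ i) < of_int \<lfloor>2 ^ j * (x $ i - a $ i)\<rfloor> + 1"
    unfolding e[symmetric] by (simp_all)
  then show "dcorner a j x $ i \<le> y $ i" "y $ i < dcorner a j x $ i + 1 / 2 ^ j"
    by (simp_all add: dcorner_def field_simps)
qed

lemma dcell_iff:
  "y \<in> dcell a j x \<longleftrightarrow> (\<forall>i. dcorner a j x $ i \<le> y $ i \<and> y $ i < dcorner a j x $ i + 1 / 2 ^ j)"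
proof
  assume r: "\<forall>i. dcorner a j x $ i \<le> y $ i \<and> y $ i < dcorner a j x $ i + 1 / 2 ^ j"
  have "\<lfloor>2 ^ j * (y $ i - a $ i)\<rfloor> = \<lfloor>2 ^ j * (x $ i - a $ i)\<rfloor>" for i
  proof (rule floor_unique)
    let ?m = "real_of_int \<lfloor>2 ^ j * (x $ i - a $ i)\<rfloor>"
    have "?m / 2 ^ j \<le> y $ i - a $ i" "y $ i - a $ i < ?m / 2 ^ j + 1 / 2 ^ j"
      using r[rule_format, of i] by (simp_all add: dcorner_def)
    then show "?m \<le> 2 ^ j * (y $ i - a $ i)" "2 ^ j * (y $ i - a $ i) < ?m + 1"
      by (simp_all add: field_simps)
  qed
  then show "y \<in> dcell a j x" by (simp add: dcell_def)
qed (use dcell_bounds in blast)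

lemma dcell_dist:
  fixes x y a :: "real ^ 'n::finite"
  assumes "y \<in> dcell a j x"
  shows "norm (y - x) \<le> real CARD('n) / 2 ^ j"
proof -
  have "\<bar>(y - x) $ i\<bar> \<le> 1 / 2 ^ j" for i
    using dcell_bounds[OF assms, of i] dcell_bounds[OF dcell_self[of x a j], of i] by simp
  then have "(\<Sum>i\<in>UNIV. \<bar>(y - x) $ i\<bar>) \<le> (\<Sum>i\<in>(UNIV::'n set). 1 / 2 ^ j)" by (intro sum_mono) auto
  then show ?thesis using norm_le_l1_cart[of "y - x"] by simp
qed

lemma dcell_Suc_subset: "dcell a (Suc j) x \<subseteq> dcell a j x"
proof
  have half: "\<lfloor>s\<rfloor> = \<lfloor>2 * s\<rfloor> div 2" for s :: real by linarith
  fix y assume y: "y \<in> dcell a (Suc j) x"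
  have "\<lfloor>2 ^ j * (y $ i - a $ i)\<rfloor> = \<lfloor>2 ^ j * (x $ i - a $ i)\<rfloor>" for i
    using y unfolding half[of "2 ^ j * (y $ i - a $ i)"] half[of "2 ^ j * (x $ i - a $ i)"]
    by (simp add: dcell_def mult.assoc)
  then show "y \<in> dcell a j x" by (simp add: dcell_def)
qed

lemma dcell_antimono: "j \<le> k \<Longrightarrow> dcell a k x \<subseteq> dcell a j x"
  by (induction rule: dec_induct) (use dcell_Suc_subset in blast)+

lemma vec_nth_measurable [measurable]: "(\<lambda>x :: real ^ 'n::finite. x $ i) \<in> borel_measurable borel"
  by (intro borel_measurable_continuous_onI continuous_intros)

text \<open>Joint measurability in the base point and the point, as Tonelli's theorem for the
  averaging operators demands.\<close>

lemma dcell_pred [measurable]: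
  "Measurable.pred (borel \<Otimes>\<^sub>M borel) (\<lambda>p. snd p \<in> dcell a j (fst p))"
proof -
  have [measurable]: "(\<lambda>p. real_of_int \<lfloor>2 ^ j * (f p $ i - a $ i)\<rfloor>) \<in> borel_measurable (borel \<Otimes>\<^sub>M borel)"
    if [measurable]: "f \<in> measurable (borel \<Otimes>\<^sub>M borel) borel" for f i
    by (rule measurable_compose[OF _ borel_measurable_real_floor]) measurable
  show ?thesis
    unfolding dcell_def mem_Collect_eq of_int_eq_iff[where 'a=real, symmetric] by measurable
qed

lemma dcell_sets [measurable, simp]: "dcell a j x \<in> sets borel"
proof -
  have [measurable]: "(\<lambda>y. real_of_int \<lfloor>2 ^ j * (y $ i - a $ i)\<rfloor>) \<in> borel_measurable borel" for i
    by (rule measurable_compose[OF _ borel_measurable_real_floor]) measurable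
  show ?thesis
    unfolding dcell_def of_int_eq_iff[where 'a=real, symmetric] by measurable
qed

lemma dcell_indicator_measurable:
  "(\<lambda>p. indicator (dcell a j (fst p)) (snd p) :: ennreal) \<in> borel_measurable (borel \<Otimes>\<^sub>M borel)"
proof -
  have "(\<lambda>p. indicator (dcell a j (fst p)) (snd p) :: ennreal) = indicator {p. snd p \<in> dcell a j (fst p)}"
    by (auto simp: fun_eq_iff indicator_def)
  moreover have "{p. snd p \<in> dcell a j (fst p)} \<in> sets (borel \<Otimes>\<^sub>M borel)"
    using dcell_pred[of a j] by (simp add: pred_def space_pair_measure)
  ultimately show ?thesis by simp
qed

lemma dcell_indicator_compose [measurable]:
  assumes "f \<in> borel_measurable M" "g \<in> borel_measurable M"
  shows "(\<lambda>z. indicator (dcell a j (f z)) (g z) :: ennreal) \<in> borel_measurable M"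
proof -
  have "(\<lambda>z. (f z, g z)) \<in> measurable M (borel \<Otimes>\<^sub>M borel)" using assms by measurable
  from measurable_compose[OF this dcell_indicator_measurable[of a j]] show ?thesis by simp
qed

lemma dcell_cbox: "dcell a j x \<subseteq> cbox (dcorner a j x) (dcorner a j x + (\<chi> i. 1 / 2 ^ j))"
  "box (dcorner a j x) (dcorner a j x + (\<chi> i. 1 / 2 ^ j)) \<subseteq> dcell a j x"
  by (auto simp: dcell_iff mem_box_cart less_imp_le)

lemma emeasure_dcell: "emeasure lborel (dcell a j x) = ennreal (1 / (2 ^ j) ^ CARD('n))"
  for a x :: "real ^ 'n::finite"
proof -
  let ?l = "dcorner a j x" let ?u = "dcorner a j x + (\<chi> i. 1 / 2 ^ j)"
  have "(\<Prod>b\<in>Basis. (?u - ?l) \<bullet> b) = (\<Prod>b\<in>(Basis::(real^'n) set). 1 / 2 ^ j)"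
    by (intro prod.cong refl) (auto simp: Basis_vec_def inner_axis)
  then have p: "(\<Prod>b\<in>Basis. (?u - ?l) \<bullet> b) = 1 / (2 ^ j) ^ CARD('n)" by (simp add: power_one_over)
  have le: "\<forall>b\<in>Basis. ?l \<bullet> b \<le> ?u \<bullet> b"
    by (auto simp: Basis_vec_def inner_axis)
  have "emeasure lborel (dcell a j x) \<le> emeasure lborel (cbox ?l ?u)"
    by (intro emeasure_mono dcell_cbox) simp
  moreover have "emeasure lborel (box ?l ?u) \<le> emeasure lborel (dcell a j x)"
    by (intro emeasure_mono dcell_cbox) simp
  ultimately show ?thesis
    using le p by (simp add: emeasure_lborel_box_eq emeasure_lborel_cbox_eq)
qed

lemma dcell_real_indicator_compose [measurable]:
  assumes "f \<in> borel_measurable M" "g \<in> borel_measurable M"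
  shows "(\<lambda>z. indicator (dcell a j (f z)) (g z) :: real) \<in> borel_measurable M"
proof -
  have "(\<lambda>z. indicator (dcell a j (f z)) (g z) :: real) = (\<lambda>z. enn2real (indicator (dcell a j (f z)) (g z)))"
    by (simp add: fun_eq_iff indicator_def)
  then show ?thesis using assms by simp
qed

lemma dmean_measurable [measurable]:
  assumes [measurable]: "F \<in> borel_measurable borel"
  shows "dmean a j F \<in> borel_measurable borel"
  unfolding dmean_def[abs_def] by measurable

lemma dmean_const_on_cell: "y \<in> dcell a j x \<Longrightarrow> dmean a j F y = dmean a j F x"
  using dcell_eq unfolding dmean_def by metis

lemma dmean_mono: "(\<And>y. F y \<le> G y) \<Longrightarrow> dmean a j F x \<le> dmean a j G x"
  unfolding dmean_def by (intro mult_left_mono nn_integral_mono) auto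

lemma dcell_normalized: "ennreal ((2 ^ j) ^ CARD('n)) * emeasure lborel (dcell a j (x :: real ^ 'n::finite)) = 1"
  by (simp add: emeasure_dcell flip: ennreal_mult')

text \<open>Tonelli's theorem and the symmetry of the averaging kernel,
  \<open>dcell_sym\<close>.\<close>

lemma dmean_selfadjoint:
  assumes [measurable]: "F \<in> borel_measurable borel" "G \<in> borel_measurable borel"
  shows "(\<integral>\<^sup>+x. dmean a j F x * G x \<partial>lborel) = (\<integral>\<^sup>+x. F x * dmean a j G x \<partial>lborel)"
proof -
  let ?c = "ennreal ((2 ^ j) ^ CARD('a))"
  have "(\<integral>\<^sup>+x. dmean a j F x * G x \<partial>lborel) = (\<integral>\<^sup>+x. \<integral>\<^sup>+y. ?c * (indicator (dcell a j x) y * F y * G x) \<partial>lborel \<partial>lborel)"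
  proof (rule nn_integral_cong)
    fix x
    have "dmean a j F x * G x = ?c * ((\<integral>\<^sup>+y. indicator (dcell a j x) y * F y \<partial>lborel) * G x)"
      by (simp add: dmean_def mult.assoc)
    also have "\<dots> = (\<integral>\<^sup>+y. ?c * (indicator (dcell a j x) y * F y * G x) \<partial>lborel)"
      by (subst nn_integral_cmult, simp, subst nn_integral_multc) simp_all
    finally show "dmean a j F x * G x = (\<integral>\<^sup>+y. ?c * (indicator (dcell a j x) y * F y * G x) \<partial>lborel)" .
  qed
  also have "\<dots> = (\<integral>\<^sup>+y. \<integral>\<^sup>+x. ?c * (indicator (dcell a j x) y * F y * G x) \<partial>lborel \<partial>lborel)"
    by (rule lborel_pair.Fubini') simp
  also have "\<dots> = (\<integral>\<^sup>+y. \<integral>\<^sup>+x. F y * (?c * (indicator (dcell a j y) x * G x)) \<partial>lborel \<partial>lborel)"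
    by (intro nn_integral_cong) (auto simp: indicator_def dcell_sym mult_ac)
  also have "\<dots> = (\<integral>\<^sup>+x. F x * dmean a j G x \<partial>lborel)"
    unfolding dmean_def by (simp add: nn_integral_cmult mult.assoc)
  finally show ?thesis .
qed

text \<open>For Borel functions this is measurability with respect to the sigma-algebra generated by
  the cells of level j.\<close>

definition level_const :: "real ^ 'n::finite \<Rightarrow> nat \<Rightarrow> (real ^ 'n \<Rightarrow> 'b) \<Rightarrow> bool" where
  "level_const a j G \<longleftrightarrow> (\<forall>x. \<forall>y\<in>dcell a j x. G y = G x)"

lemma level_constD: "level_const a j G \<Longrightarrow> y \<in> dcell a j x \<Longrightarrow> G y = G x"
  by (simp add: level_const_def)

lemma level_const_mono: "level_const a j G \<Longrightarrow> j \<le> k \<Longrightarrow> level_const a k G"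
  unfolding level_const_def using dcell_antimono by blast

lemma level_const_dmean: "level_const a j (dmean a j F)"
  by (simp add: level_const_def dmean_const_on_cell)

lemma dmean_level_const:
  assumes "level_const a j G"
  shows "dmean a j G x = G x"
proof -
  have "(\<integral>\<^sup>+y. indicator (dcell a j x) y * G y \<partial>lborel) = (\<integral>\<^sup>+y. G x * indicator (dcell a j x) y \<partial>lborel)"
    by (intro nn_integral_cong) (auto simp: indicator_def level_constD[OF assms])
  also have "\<dots> = G x * emeasure lborel (dcell a j x)" by (rule nn_integral_cmult_indicator) simp
  finally show ?thesis unfolding dmean_def using dcell_normalized[of j a x] by (simp add: mult.left_commute)
qed

text \<open>The central exchange: next to a factor constant on the cells, averaging can be inserted
  or removed under the integral. It serves the stopping sets as well as the positive
  operator.\<close>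

lemma nn_integral_dmean_level:
  assumes [measurable]: "F \<in> borel_measurable borel" "G \<in> borel_measurable borel"
    and "level_const a j G"
  shows "(\<integral>\<^sup>+x. dmean a j F x * G x \<partial>lborel) = (\<integral>\<^sup>+x. F x * G x \<partial>lborel)"
  unfolding dmean_selfadjoint[OF assms(1,2)] dmean_level_const[OF assms(3)] ..

lemma level_const_indicator:
  assumes "\<And>x y. y \<in> dcell a j x \<Longrightarrow> x \<in> A \<Longrightarrow> y \<in> A"
  shows "level_const a j (indicator A :: _ \<Rightarrow> ennreal)"
  unfolding level_const_def
proof (intro allI ballI)
  fix x y assume "y \<in> dcell a j x"
  then have "y \<in> A \<longleftrightarrow> x \<in> A" using assms[of y x] assms[of x y] dcell_sym[of y a j x] by blast
  then show "indicator A y = (indicator A x :: ennreal)" by (simp add: indicator_def)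
qed

text \<open>A parent cell has 2^n times the volume of a child. This bounds the mean over a stopping
  cell by the mean over its parent, which has not been stopped.\<close>

lemma dmean_Suc_le:
  "dmean a (Suc j) F x \<le> ennreal (2 ^ CARD('n)) * dmean a j F x" for x :: "real ^ 'n::finite"
proof -
  have "(\<integral>\<^sup>+y. indicator (dcell a (Suc j) x) y * F y \<partial>lborel) \<le> (\<integral>\<^sup>+y. indicator (dcell a j x) y * F y \<partial>lborel)"
    using dcell_Suc_subset[of a j x] by (intro nn_integral_mono) (auto simp: indicator_def)
  moreover have "ennreal ((2 ^ Suc j) ^ CARD('n)) = ennreal (2 ^ CARD('n)) * ennreal ((2 ^ j) ^ CARD('n))"
    by (simp add: power_mult_distrib flip: ennreal_mult')
  ultimately show ?thesis unfolding dmean_def by (simp add: mult.assoc mult_left_mono)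
qed

lemma dcell_subset_open:
  fixes x a :: "real ^ 'n::finite"
  assumes "open U" "x \<in> U"
  shows "\<exists>k\<ge>j. dcell a k x \<subseteq> U"
proof -
  obtain e where e: "e > 0" "ball x e \<subseteq> U" using assms by (meson openE)
  obtain k where k: "real CARD('n) / e < 2 ^ k" using real_arch_pow[of 2 "real CARD('n) / e"] by auto
  have "dcell a (max j k) x \<subseteq> ball x e"
  proof
    fix y assume "y \<in> dcell a (max j k) x"
    from dcell_dist[OF this] have "norm (y - x) \<le> real CARD('n) / 2 ^ max j k" .
    also have "\<dots> \<le> real CARD('n) / 2 ^ k" by (intro divide_left_mono power_increasing) auto
    also have "\<dots> < e" using k e(1) by (simp add: field_simps)
    finally show "y \<in> ball x e" by (simp add: dist_norm norm_minus_commute)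
  qed
  then show ?thesis using e(2) by (intro exI[of _ "max j k"]) auto
qed

text \<open>A stopping time. If \<open>P k\<close> depends on cells of level k only, this is the
  union of the maximal cells with property P among those of level k, without any enumeration of
  cells.\<close>

definition first_level :: "(nat \<Rightarrow> 'a \<Rightarrow> bool) \<Rightarrow> nat \<Rightarrow> 'a set" where
  "first_level P k = {y. P k y \<and> (\<forall>i<k. \<not> P i y)}"

lemma first_level_measurable [measurable]:
  assumes [measurable]: "\<And>k. Measurable.pred borel (P k)"
  shows "first_level P k \<in> sets borel"
  unfolding first_level_def by measurable

lemma first_level_disjoint: "disjoint_family (first_level P)"
  unfolding disjoint_family_on_def first_level_def by (auto simp: nat_neq_iff)

lemma UN_first_level: "(\<Union>k. first_level P k) = {y. \<exists>k. P k y}"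
proof -
  have "y \<in> first_level P (LEAST i. P i y)" if "P k y" for k y
    unfolding first_level_def using LeastI[of "\<lambda>i. P i y" k] not_less_Least[of _ "\<lambda>i. P i y"] that by blast
  then show ?thesis by (auto simp: first_level_def)
qed

text \<open>Failure of P at an earlier level is a property of a coarser cell, which contains the
  whole cell of level k.\<close>

lemma level_const_first_level:
  assumes P: "\<And>i x y. P i x \<Longrightarrow> y \<in> dcell a i x \<Longrightarrow> P i y"
  shows "level_const a k (indicator (first_level P k) :: _ \<Rightarrow> ennreal)"
proof (rule level_const_indicator)
  fix x y assume xy: "y \<in> dcell a k x" and x: "x \<in> first_level P k"
  have "P k y" using x xy P unfolding first_level_def by blast
  moreover have "\<not> P i y" if "i < k" for i
  proof
    assume "P i y"
    moreover have "x \<in> dcell a i y"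
      using dcell_antimono[of i k a y] that xy dcell_sym[of y a k x] by auto
    ultimately have "P i x" by (rule P)
    then show False using x that unfolding first_level_def by blast
  qed
  ultimately show "y \<in> first_level P k" unfolding first_level_def by blast
qed

text \<open>Cover \<open>N\<close> by an open set of almost the same measure, and that set by the maximal cells
  meeting \<open>N\<close>; \<open>F\<close> has mean at most 4 on each of them.\<close>

lemma null_if_dmeans_bounded:
  fixes N :: "(real ^ 'n::finite) set"
  assumes [measurable]: "F \<in> borel_measurable borel" "N \<in> sets borel" "Q \<in> sets borel"
    and Q: "\<And>x y k. j \<le> k \<Longrightarrow> y \<in> dcell a k x \<Longrightarrow> x \<in> Q \<Longrightarrow> y \<in> Q"
    and N: "N \<subseteq> Q" "emeasure lborel N < \<infinity>"
    and large: "\<And>x. x \<in> N \<Longrightarrow> 5 \<le> F x"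
    and small: "\<And>x k. x \<in> N \<Longrightarrow> j \<le> k \<Longrightarrow> dmean a k F x \<le> 4"
  shows "emeasure lborel N = 0"
proof -
  obtain \<nu> where \<nu>: "emeasure lborel N = ennreal \<nu>" "\<nu> \<ge> 0"
    using N(2) by (cases "emeasure lborel N") auto
  have main: "\<nu> \<le> 4 * \<delta>" if \<delta>: "\<delta> > 0" for \<delta>
  proof -
    obtain U where U: "open U" "N \<subseteq> U" "emeasure lborel (U - N) < ennreal \<delta>"
      using outer_regular_lborel[OF assms(2), of \<delta>] \<delta> by auto
    have [measurable]: "U \<in> sets borel" using U(1) by simp
    \<comment> \<open>Expressed through means: up to null sets the cell lies inside U, and it meets
      N in positive measure. This form is measurable in y and constant on cells.\<close>
    define P where "P k y \<longleftrightarrow> j \<le> k \<and> y \<in> Q \<and> dmean a k (indicator (- U)) y = 0 \<and> 0 < dmean a k (indicator N) y" for k y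
    define V where "V = first_level P"
    have P_cell: "P i y" if "P i x" "y \<in> dcell a i x" for i x y
      using that Q[of i y x] dmean_const_on_cell[OF that(2)] unfolding P_def by simp
    have [measurable]: "Measurable.pred borel (P k)" for k unfolding P_def by measurable
    have V_P: "P k x" if "x \<in> V k" for k x using that unfolding V_def first_level_def by blast
    have [measurable]: "V k \<in> sets borel" for k unfolding V_def by measurable
    have disj: "disjoint_family V" unfolding V_def by (rule first_level_disjoint)
    have V_level: "level_const a k (indicator (V k) :: _ \<Rightarrow> ennreal)" for k
      unfolding V_def by (rule level_const_first_level) (rule P_cell)
    have V_U: "emeasure lborel (V k - U) = 0" for k
    proof -
      have "emeasure lborel (V k - U) = (\<integral>\<^sup>+x. indicator (- U) x * indicator (V k) x \<partial>lborel)"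
      proof -
        have "(\<lambda>x. indicator (- U) x * indicator (V k) x :: ennreal) = indicator (V k - U)"
          by (auto simp: fun_eq_iff indicator_def)
        then show ?thesis by simp
      qed
      also have "\<dots> = (\<integral>\<^sup>+x. dmean a k (indicator (- U)) x * indicator (V k) x \<partial>lborel)"
        by (rule nn_integral_dmean_level[symmetric]) (simp_all add: V_level)
      also have "\<dots> = (\<integral>\<^sup>+x. 0 \<partial>(lborel :: (real^'n) measure))"
        by (intro nn_integral_cong) (auto dest!: V_P simp: P_def indicator_def)
      finally show ?thesis by simp
    qed
    have V_mean: "(\<integral>\<^sup>+x. F x * indicator (V k) x \<partial>lborel) \<le> 4 * emeasure lborel (V k)" for k
    proof -
      have "(\<integral>\<^sup>+x. F x * indicator (V k) x \<partial>lborel) = (\<integral>\<^sup>+x. dmean a k F x * indicator (V k) x \<partial>lborel)"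
        by (rule nn_integral_dmean_level[symmetric]) (simp_all add: V_level)
      also have "\<dots> \<le> (\<integral>\<^sup>+x. 4 * indicator (V k) x \<partial>lborel)"
      proof (rule nn_integral_mono)
        fix x
        show "dmean a k F x * indicator (V k) x \<le> 4 * indicator (V k) x"
        proof (cases "x \<in> V k")
          case True
          then have P: "P k x" by (rule V_P)
          have "\<exists>z. z \<in> dcell a k x \<and> z \<in> N"
          proof (rule ccontr)
            assume no: "\<nexists>z. z \<in> dcell a k x \<and> z \<in> N"
            have "(\<integral>\<^sup>+y. indicator (dcell a k x) y * indicator N y \<partial>lborel) = (\<integral>\<^sup>+y. 0 \<partial>(lborel :: (real^'n) measure))"
              using no by (intro nn_integral_cong) (auto simp: indicator_def)
            then show False using P unfolding P_def dmean_def by simp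
          qed
          then obtain z where z: "z \<in> dcell a k x" "z \<in> N" by blast
          have "dmean a k F x = dmean a k F z" using dmean_const_on_cell[OF z(1)] by simp
          also have "\<dots> \<le> 4" using small z(2) P unfolding P_def by blast
          finally show ?thesis by (simp add: mult_right_mono)
        qed simp
      qed
      also have "\<dots> = 4 * emeasure lborel (V k)" by (simp add: nn_integral_cmult)
      finally show ?thesis .
    qed
    \<comment> \<open>At each level the cells that meet N in a null set form the set
      \<open>?Z\<close>; exchanging averages against its indicator shows that N meets
      \<open>?Z\<close> in a null set. There are countably many levels.\<close>
    have N_pos: "AE x in lborel. x \<in> N \<longrightarrow> (\<forall>k. 0 < dmean a k (indicator N) x)"
    proof -
      have "AE x in lborel. x \<in> N \<longrightarrow> 0 < dmean a k (indicator N) x" for k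
      proof -
        let ?Z = "{x. dmean a k (indicator N) x = 0}"
        have [measurable]: "?Z \<in> sets borel" by measurable
        have "emeasure lborel (N \<inter> ?Z) = (\<integral>\<^sup>+x. indicator N x * indicator ?Z x \<partial>lborel)"
        proof -
          have "(\<lambda>x. indicator N x * indicator ?Z x :: ennreal) = indicator (N \<inter> ?Z)"
            by (auto simp: fun_eq_iff indicator_def)
          then show ?thesis by simp
        qed
        also have "\<dots> = (\<integral>\<^sup>+x. dmean a k (indicator N) x * indicator ?Z x \<partial>lborel)"
          by (rule nn_integral_dmean_level[symmetric])
             (auto intro!: level_const_indicator simp: dmean_const_on_cell)
        also have "\<dots> = (\<integral>\<^sup>+x. 0 \<partial>(lborel :: (real^'n) measure))"
          by (intro nn_integral_cong) (auto simp: indicator_def)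
        finally have "N \<inter> ?Z \<in> null_sets lborel" by (intro null_setsI) simp_all
        then show ?thesis by (rule AE_I') (auto simp: zero_less_iff_neq_zero)
      qed
      then have "AE x in lborel. \<forall>k. x \<in> N \<longrightarrow> 0 < dmean a k (indicator N) x"
        unfolding AE_all_countable by blast
      then show ?thesis by eventually_elim blast
    qed
    have N_cover: "AE x in lborel. x \<in> N \<longrightarrow> x \<in> (\<Union>k. V k)"
      using N_pos
    proof eventually_elim
      fix x assume pos: "x \<in> N \<longrightarrow> (\<forall>k. 0 < dmean a k (indicator N) x)"
      show "x \<in> N \<longrightarrow> x \<in> (\<Union>k. V k)"
      proof
        assume x: "x \<in> N"
        then obtain k where k: "k \<ge> j" "dcell a k x \<subseteq> U" using dcell_subset_open[OF U(1), of x j a] U(2) by blast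
        have "(\<integral>\<^sup>+y. indicator (dcell a k x) y * indicator (- U) y \<partial>lborel) = (\<integral>\<^sup>+y. 0 \<partial>(lborel :: (real^'n) measure))"
          using k(2) by (intro nn_integral_cong) (auto simp: indicator_def)
        then have "dmean a k (indicator (- U)) x = 0" unfolding dmean_def by simp
        then have "P k x" using pos x k(1) N(1) unfolding P_def by blast
        then show "x \<in> (\<Union>k. V k)" unfolding V_def UN_first_level by blast
      qed
    qed
    \<comment> \<open>With F at least 5 on N and of mean at most 4 on the covering cells, 5|N| <=
      4(|N| + \<delta>); the gap between 5 and 4 leaves |N| <= 4\<delta>.\<close>
    have "5 * emeasure lborel N = (\<integral>\<^sup>+x. 5 * indicator N x \<partial>lborel)" by (simp add: nn_integral_cmult)
    also have "\<dots> \<le> (\<integral>\<^sup>+x. F x * indicator (\<Union>k. V k) x \<partial>lborel)"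
      by (intro nn_integral_mono_AE, use N_cover in eventually_elim) (use large in \<open>auto simp: indicator_def\<close>)
    also have "\<dots> = (\<Sum>k. \<integral>\<^sup>+x. F x * indicator (V k) x \<partial>lborel)"
    proof -
      have "F x * indicator (\<Union>k. V k) x = (\<Sum>k. F x * indicator (V k) x)" for x
        using suminf_indicator[OF disj] by simp
      then show ?thesis by (simp add: nn_integral_suminf del: ennreal_suminf_cmult)
    qed
    also have "\<dots> \<le> (\<Sum>k. 4 * emeasure lborel (V k))" by (intro suminf_le V_mean) simp_all
    also have "\<dots> = 4 * emeasure lborel (\<Union>k. V k)"
      using suminf_emeasure[of V lborel] disj by (simp add: image_subset_iff)
    also have "emeasure lborel (\<Union>k. V k) \<le> emeasure lborel U"
    proof (rule emeasure_mono_AE)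
      have "AE x in lborel. x \<notin> V k - U" for k
        using V_U[of k] by (intro AE_not_in null_setsI) simp_all
      then have "AE x in lborel. \<forall>k. x \<notin> V k - U" unfolding AE_all_countable by (rule allI)
      then show "AE x in lborel. x \<in> (\<Union>k. V k) \<longrightarrow> x \<in> U" by eventually_elim auto
    qed simp
    also have "emeasure lborel U \<le> emeasure lborel N + emeasure lborel (U - N)"
      using U(2) by (subst plus_emeasure) (auto simp: Un_absorb1)
    also have "\<dots> \<le> ennreal \<nu> + ennreal \<delta>" using U(3) \<nu> by (intro add_mono) auto
    finally have "5 * ennreal \<nu> \<le> 4 * (ennreal \<nu> + ennreal \<delta>)" using \<nu>(1) by (simp add: mult_left_mono)
    then have "ennreal 5 * ennreal \<nu> \<le> ennreal 4 * ennreal (\<nu> + \<delta>)"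
      using \<nu>(2) \<delta> by simp
    then have "ennreal (5 * \<nu>) \<le> ennreal (4 * (\<nu> + \<delta>))"
      by (simp only: ennreal_mult' zero_le_numeral)
    then show ?thesis using \<nu>(2) \<delta> by (subst (asm) ennreal_le_iff) auto
  qed
  have "\<nu> \<le> 0"
  proof (rule field_le_epsilon)
    fix e :: real assume "e > 0"
    then show "\<nu> \<le> 0 + e" using main[of "e/4"] by simp
  qed
  then show ?thesis using \<nu> by simp
qed

section \<open>Dyadic John--Nirenberg inequality\<close>

definition cell_mean :: "real ^ 'n::finite \<Rightarrow> (real ^ 'n \<Rightarrow> complex) \<Rightarrow> nat \<Rightarrow> real ^ 'n \<Rightarrow> complex" where
  "cell_mean a g j x = (2 ^ j) ^ CARD('n) *\<^sub>R (LINT y|lborel. indicator (dcell a j x) y *\<^sub>R g y)"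

lemma cell_mean_const: "y \<in> dcell a j x \<Longrightarrow> cell_mean a g j y = cell_mean a g j x"
  unfolding cell_mean_def using dcell_eq by metis

lemma cell_mean_measurable [measurable]:
  assumes [measurable]: "g \<in> borel_measurable borel"
  shows "cell_mean a g j \<in> borel_measurable borel"
  unfolding cell_mean_def[abs_def] by measurable

lemma measure_dcell: "measure lborel (dcell a j (x :: real ^ 'n::finite)) = 1 / (2 ^ j) ^ CARD('n)"
  by (simp add: measure_def emeasure_dcell)

lemma integrable_dcell_indicator: "integrable lborel (indicator (dcell a j x) :: _ \<Rightarrow> real)"
  by (rule integrable_real_indicator) (simp_all add: emeasure_dcell)

lemma cell_mean_diff_le:
  fixes g :: "real ^ 'n::finite \<Rightarrow> complex"
  assumes [measurable]: "g \<in> borel_measurable borel"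
    and int: "integrable lborel (\<lambda>y. indicator (dcell a j x) y *\<^sub>R g y)"
  shows "ennreal (norm (cell_mean a g j x - c)) \<le> dmean a j (\<lambda>y. ennreal (norm (g y - c))) x"
proof -
  let ?s = "(2 ^ j) ^ CARD('n) :: real"
  let ?I = "indicator (dcell a j x) :: _ \<Rightarrow> real"
  have "(LINT y|lborel. ?I y *\<^sub>R c) = measure lborel (dcell a j x) *\<^sub>R c"
    using integral_scaleR_left[OF integrable_dcell_indicator[of a j x], of c] by simp
  moreover have intc: "integrable lborel (\<lambda>y. ?I y *\<^sub>R c)"
    by (rule integrable_scaleR_left[OF integrable_dcell_indicator])
  ultimately have "cell_mean a g j x - c = ?s *\<^sub>R (LINT y|lborel. ?I y *\<^sub>R (g y - c))"
    using int by (simp add: cell_mean_def scaleR_diff_right measure_dcell)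
  then have "norm (cell_mean a g j x - c) = ?s * norm (LINT y|lborel. ?I y *\<^sub>R (g y - c))" by simp
  then have "ennreal (norm (cell_mean a g j x - c)) = ennreal ?s * ennreal (norm (LINT y|lborel. ?I y *\<^sub>R (g y - c)))"
    by (simp add: ennreal_mult')
  also have "\<dots> \<le> ennreal ?s * (\<integral>\<^sup>+y. ennreal (norm (?I y *\<^sub>R (g y - c))) \<partial>lborel)"
    by (intro mult_left_mono integral_norm_bound_ennreal) (use int intc in \<open>simp_all add: scaleR_diff_right\<close>)
  also have "(\<integral>\<^sup>+y. ennreal (norm (?I y *\<^sub>R (g y - c))) \<partial>lborel) = (\<integral>\<^sup>+y. indicator (dcell a j x) y * ennreal (norm (g y - c)) \<partial>lborel)"
    by (intro nn_integral_cong) (auto simp: indicator_def)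
  finally show ?thesis unfolding dmean_def .
qed

lemma nn_integral_disjoint_UN:
  fixes V :: "nat \<Rightarrow> 'a set"
  assumes [measurable]: "F \<in> borel_measurable M" "\<And>k. V k \<in> sets M" and "disjoint_family V"
  shows "(\<integral>\<^sup>+x. F x * indicator (\<Union>k. V k) x \<partial>M) = (\<Sum>k. \<integral>\<^sup>+x. F x * indicator (V k) x \<partial>M)"
proof -
  have "F x * indicator (\<Union>k. V k) x = (\<Sum>k. F x * indicator (V k) x)" for x
    using suminf_indicator[OF assms(3)] by simp
  then show ?thesis by (simp add: nn_integral_suminf del: ennreal_suminf_cmult)
qed

text \<open>The Calderon--Zygmund argument: on the maximal cells where the mean oscillation exceeds 4 the
  mean of \<open>g\<close> has moved by at most \<open>4 * 2^n\<close>, and these cells fill at most a quarter of the cell.\<close>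

lemma dyadic_John_Nirenberg:
  fixes g :: "real ^ 'n::finite \<Rightarrow> complex"
  assumes [measurable]: "g \<in> borel_measurable borel"
    and int: "\<And>j x. integrable lborel (\<lambda>y. indicator (dcell a j x) y *\<^sub>R g y)"
    and osc: "\<And>j x. dmean a j (\<lambda>y. ennreal (norm (g y - cell_mean a g j x))) x \<le> 1"
  shows "dmean a j (indicator {y. real m * (4 * 2 ^ CARD('n)) < norm (g y - cell_mean a g j x)}) x \<le> ennreal ((1/4) ^ m)"
proof (induction m arbitrary: j x)
  case 0
  have "dmean a j (indicator {y. real 0 * (4 * 2 ^ CARD('n)) < norm (g y - cell_mean a g j x)}) x \<le> dmean a j (\<lambda>_. 1) x"
    by (rule dmean_mono) (simp add: indicator_def)
  also have "\<dots> = 1" by (rule dmean_level_const) (simp add: level_const_def)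
  finally show ?case by simp
next
  case (Suc m)
  let ?A = "4 * 2 ^ CARD('n) :: real"
  define Q where "Q = dcell a j x"
  define c where "c = cell_mean a g j x"
  define F where "F z = ennreal (norm (g z - c))" for z
  define E where "E = {y. real (Suc m) * ?A < norm (g y - c)}"
  have [measurable]: "F \<in> borel_measurable borel" "E \<in> sets borel" "Q \<in> sets borel"
    unfolding F_def[abs_def] E_def Q_def by measurable
  \<comment> \<open>Ensures that F is at least 5 on E, as the comparison in
    \<open>null_if_dmeans_bounded\<close> demands.\<close>
  have A8: "8 \<le> ?A"
  proof -
    have "(2::real) ^ 1 \<le> 2 ^ CARD('n)" by (intro power_increasing) (auto simp: Suc_le_eq)
    then show ?thesis by simp
  qed
  define P where "P k y \<longleftrightarrow> j \<le> k \<and> y \<in> Q \<and> 4 < dmean a k F y" for k y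
  define V where "V = first_level P"
  have [measurable]: "Measurable.pred borel (P k)" for k unfolding P_def by measurable
  have [measurable]: "V k \<in> sets borel" for k unfolding V_def by measurable
  have Q_cell: "y \<in> Q" if "j \<le> k" "y \<in> dcell a k z" "z \<in> Q" for y z k
    using dcell_antimono[OF that(1), of a z] that(2,3) dcell_eq[of z a j x] unfolding Q_def by blast
  have P_cell: "P i z" if "P i y" "z \<in> dcell a i y" for i y z
    using that Q_cell[of i z y] dmean_const_on_cell[OF that(2)] unfolding P_def by simp
  have V_level: "level_const a k (indicator (V k) :: _ \<Rightarrow> ennreal)" for k
    unfolding V_def by (rule level_const_first_level) (rule P_cell)
  have V_P: "P k y" if "y \<in> V k" for k y using that unfolding V_def first_level_def by blast
  have disj: "disjoint_family V" unfolding V_def by (rule first_level_disjoint)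
  have start: "dmean a j F x \<le> 1" unfolding F_def c_def by (rule osc)
  have sum_V: "4 * (\<Sum>k. emeasure lborel (V k)) \<le> emeasure lborel Q"
  proof -
    have "4 * emeasure lborel (V k) \<le> (\<integral>\<^sup>+y. F y * indicator (V k) y \<partial>lborel)" for k
    proof -
      have "4 * emeasure lborel (V k) = (\<integral>\<^sup>+y. 4 * indicator (V k) y \<partial>lborel)" by (simp add: nn_integral_cmult)
      also have "\<dots> \<le> (\<integral>\<^sup>+y. dmean a k F y * indicator (V k) y \<partial>lborel)"
        by (intro nn_integral_mono) (auto simp: indicator_def P_def less_imp_le dest!: V_P)
      also have "\<dots> = (\<integral>\<^sup>+y. F y * indicator (V k) y \<partial>lborel)"
        by (rule nn_integral_dmean_level) (simp_all add: V_level)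
      finally show ?thesis .
    qed
    then have "(\<Sum>k. 4 * emeasure lborel (V k)) \<le> (\<Sum>k. \<integral>\<^sup>+y. F y * indicator (V k) y \<partial>lborel)"
      by (intro suminf_le) simp_all
    also have "\<dots> = (\<integral>\<^sup>+y. F y * indicator (\<Union>k. V k) y \<partial>lborel)"
      by (rule nn_integral_disjoint_UN[symmetric]) (simp_all add: disj)
    also have "\<dots> \<le> (\<integral>\<^sup>+y. indicator Q y * F y \<partial>lborel)"
      by (intro nn_integral_mono) (auto simp: indicator_def P_def dest!: V_P)
    also have "\<dots> = 1 * (\<integral>\<^sup>+y. indicator Q y * F y \<partial>lborel)" by simp
    also have "\<dots> = emeasure lborel Q * dmean a j F x"
      unfolding dmean_def Q_def using dcell_normalized[of j a x] by (simp add: mult_ac flip: mult.assoc)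
    also have "\<dots> \<le> emeasure lborel Q * 1" by (intro mult_left_mono start) simp
    finally show ?thesis by simp
  qed
  have V_mean: "norm (cell_mean a g k y - c) \<le> ?A" if "y \<in> V k" for k y
  proof -
    have P: "P k y" by (rule V_P[OF that])
    \<comment> \<open>The starting cell itself is never stopped, its mean being at most 1. So every
      stopping cell has a parent inside Q, on which the mean is still at most 4.\<close>
    have "k \<noteq> j"
    proof
      assume "k = j"
      then have "4 < dmean a j F x" using P dmean_const_on_cell[of y a j x F] unfolding P_def Q_def by simp
      also note start
      finally show False by simp
    qed
    then obtain i where i: "k = Suc i" "j \<le> i" using P unfolding P_def by (cases k) auto
    have "\<not> P i y" using that i(1) unfolding V_def first_level_def by blast
    then have le4: "dmean a i F y \<le> 4" using i(2) P unfolding P_def by auto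
    have "ennreal (norm (cell_mean a g k y - c)) \<le> dmean a k F y"
      unfolding F_def by (rule cell_mean_diff_le) (simp_all add: int)
    also have "\<dots> \<le> ennreal (2 ^ CARD('n)) * dmean a i F y" unfolding i(1) by (rule dmean_Suc_le)
    also have "\<dots> \<le> ennreal (2 ^ CARD('n)) * ennreal 4" using le4 by (intro mult_left_mono) simp_all
    also have "\<dots> = ennreal ?A" by (subst ennreal_mult'[symmetric]) (simp_all only: mult.commute zero_le_power zero_le_numeral)
    finally show ?thesis by (subst (asm) ennreal_le_iff) simp_all
  qed
  \<comment> \<open>In a stopping cell the reference value changes by at most \<open>?A\<close>, so
    deviating by m + 1 units from \<open>c\<close> means deviating by m units from the mean of that
    cell, to which the induction hypothesis applies.\<close>
  have V_E: "(\<integral>\<^sup>+y. indicator E y * indicator (V k) y \<partial>lborel) \<le> ennreal ((1/4) ^ m) * emeasure lborel (V k)" for k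
  proof -
    let ?H = "indicator {y. real m * ?A < norm (g y - cell_mean a g k y)} :: _ \<Rightarrow> ennreal"
    have "(\<integral>\<^sup>+y. indicator E y * indicator (V k) y \<partial>lborel) \<le> (\<integral>\<^sup>+y. ?H y * indicator (V k) y \<partial>lborel)"
    proof (rule nn_integral_mono)
      fix y
      show "indicator E y * indicator (V k) y \<le> ?H y * indicator (V k) y"
      proof (cases "y \<in> E \<inter> V k")
        case True
        then have "real (Suc m) * ?A < norm (g y - c)" "norm (cell_mean a g k y - c) \<le> ?A"
          using V_mean unfolding E_def by auto
        moreover have "norm (g y - c) \<le> norm (g y - cell_mean a g k y) + norm (cell_mean a g k y - c)"
          using norm_triangle_ineq[of "g y - cell_mean a g k y" "cell_mean a g k y - c"] by simp
        ultimately have "real m * ?A < norm (g y - cell_mean a g k y)"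
          by (simp only: of_nat_Suc distrib_right mult_1)
        then show ?thesis by (simp add: mult_right_mono indicator_def)
      qed (auto simp: indicator_def)
    qed
    also have "\<dots> = (\<integral>\<^sup>+y. dmean a k ?H y * indicator (V k) y \<partial>lborel)"
      by (rule nn_integral_dmean_level[symmetric]) (simp_all add: V_level)
    also have "\<dots> \<le> (\<integral>\<^sup>+y. ennreal ((1/4) ^ m) * indicator (V k) y \<partial>lborel)"
    proof (intro nn_integral_mono mult_right_mono)
      fix y
      have "indicator (dcell a k y) z * ?H z
          = indicator (dcell a k y) z * indicator {z. real m * ?A < norm (g z - cell_mean a g k y)} z" for z
        using cell_mean_const[of z a k y g] by (cases "z \<in> dcell a k y") (simp_all add: indicator_def)
      then have "dmean a k ?H y = dmean a k (indicator {z. real m * ?A < norm (g z - cell_mean a g k y)}) y"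
        unfolding dmean_def by (simp only:)
      also have "\<dots> \<le> ennreal ((1/4) ^ m)" by (rule Suc.IH)
      finally show "dmean a k ?H y \<le> ennreal ((1/4) ^ m)" .
    qed simp
    also have "\<dots> = ennreal ((1/4) ^ m) * emeasure lborel (V k)" by (simp add: nn_integral_cmult)
    finally show ?thesis .
  qed
  \<comment> \<open>Outside the stopping cells all means of F from level j on are at most 4,
    although F is at least 5 on E; hence this remainder is null.\<close>
  define N where "N = Q \<inter> E - (\<Union>k. V k)"
  have [measurable]: "N \<in> sets borel" unfolding N_def by measurable
  have "emeasure lborel N = 0"
  proof (rule null_if_dmeans_bounded[where F=F and Q=Q and j=j and a=a])
    show "emeasure lborel N < \<infinity>"
    proof -
      have "emeasure lborel N \<le> emeasure lborel Q" by (rule emeasure_mono) (auto simp: N_def)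
      also have "\<dots> < \<infinity>" unfolding Q_def by (simp add: emeasure_dcell)
      finally show ?thesis .
    qed
    show "5 \<le> F y" if "y \<in> N" for y
    proof -
      have "1 * ?A \<le> real (Suc m) * ?A" by (intro mult_right_mono) auto
      moreover have "real (Suc m) * ?A < norm (g y - c)" using that unfolding N_def E_def by blast
      ultimately have "5 \<le> norm (g y - c)" using A8 by linarith
      then show ?thesis unfolding F_def by (metis ennreal_leI ennreal_numeral zero_le_numeral)
    qed
    show "dmean a k F y \<le> 4" if "y \<in> N" "j \<le> k" for y k
    proof (rule ccontr)
      assume "\<not> dmean a k F y \<le> 4"
      then have "P k y" using that unfolding P_def N_def by auto
      then have "y \<in> (\<Union>k. V k)" unfolding V_def UN_first_level by blast
      then show False using that(1) unfolding N_def by blast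
    qed
  qed (use Q_cell in \<open>auto simp: N_def\<close>)
  then have N0: "N \<in> null_sets lborel" by (intro null_setsI) simp_all
  have q4: "ennreal (1/4) * 4 = 1"
    by (subst ennreal_numeral[symmetric], subst ennreal_mult'[symmetric]) simp_all
  have q5: "ennreal ((1/4) ^ Suc m) = ennreal ((1/4) ^ m) * ennreal (1/4)"
    by (subst ennreal_mult'[symmetric]) simp_all
  have "(\<integral>\<^sup>+y. indicator Q y * indicator E y \<partial>lborel) \<le> (\<integral>\<^sup>+y. indicator E y * indicator (\<Union>k. V k) y \<partial>lborel)"
  proof (rule nn_integral_mono_AE)
    show "AE y in lborel. indicator Q y * indicator E y \<le> (indicator E y * indicator (\<Union>k. V k) y :: ennreal)"
      using AE_not_in[OF N0] by eventually_elim (auto simp: N_def indicator_def)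
  qed
  also have "\<dots> = (\<Sum>k. \<integral>\<^sup>+y. indicator E y * indicator (V k) y \<partial>lborel)"
    by (rule nn_integral_disjoint_UN) (simp_all add: disj)
  also have "\<dots> \<le> (\<Sum>k. ennreal ((1/4) ^ m) * emeasure lborel (V k))" by (intro suminf_le V_E) simp_all
  also have "\<dots> = ennreal ((1/4) ^ m) * (\<Sum>k. emeasure lborel (V k))" by simp
  also have "\<dots> = ennreal ((1/4) ^ m) * (ennreal (1/4) * (4 * (\<Sum>k. emeasure lborel (V k))))"
    by (simp only: mult.assoc[of "ennreal (1/4)" 4, symmetric] q4 mult_1)
  also have "\<dots> \<le> ennreal ((1/4) ^ m) * (ennreal (1/4) * emeasure lborel Q)"
    by (intro mult_left_mono sum_V) simp_all
  also have "\<dots> = ennreal ((1/4) ^ Suc m) * emeasure lborel Q"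
    by (simp only: q5 mult.assoc)
  finally have "dmean a j (indicator E) x \<le> ennreal ((2 ^ j) ^ CARD('n)) * (ennreal ((1/4) ^ Suc m) * emeasure lborel Q)"
    unfolding dmean_def Q_def by (rule mult_left_mono) simp
  also have "\<dots> = ennreal ((1/4) ^ Suc m)"
    unfolding Q_def mult.left_commute[of "ennreal ((2 ^ j) ^ CARD('n))"] dcell_normalized by simp
  finally show ?case unfolding E_def c_def .
qed

text \<open>A layer-cake sum: the values 2^(m+1) against the proportions 4^-m add up to 4, and 1
  more covers the points where g = 0. The summand 1 in \<open>A\<close> absorbs the mean of g over
  the unit cell.\<close>

lemma dyadic_exponential_integrability:
  fixes g :: "real ^ 'n::finite \<Rightarrow> complex"
  defines "A \<equiv> 4 * 2 ^ CARD('n) + 1"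
  assumes [measurable]: "g \<in> borel_measurable borel"
    and int: "\<And>j x. integrable lborel (\<lambda>y. indicator (dcell a j x) y *\<^sub>R g y)"
    and osc: "\<And>j x. dmean a j (\<lambda>y. ennreal (norm (g y - cell_mean a g j x))) x \<le> 1"
    and mean: "\<And>x. norm (cell_mean a g 0 x) \<le> 1"
  shows "dmean a 0 (\<lambda>y. ennreal (2 powr (norm (g y) / A))) x \<le> 5"
proof -
  let ?B = "4 * 2 ^ CARD('n) :: real"
  have A: "A > 0" unfolding A_def by (intro add_pos_pos) auto
  define E where "E m = {y. real m * A < norm (g y)}" for m
  have [measurable]: "E m \<in> sets borel" for m unfolding E_def by measurable
  have E: "dmean a 0 (indicator (E m)) x \<le> ennreal ((1/4) ^ m)" for m
  proof (cases m)
    case 0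
    have "dmean a 0 (indicator (E m)) x \<le> dmean a 0 (\<lambda>_. 1) x"
      by (rule dmean_mono) (simp add: indicator_def)
    also have "\<dots> = 1" by (rule dmean_level_const) (simp add: level_const_def)
    finally show ?thesis using 0 by simp
  next
    case (Suc k)
    have "dmean a 0 (indicator (E m)) x \<le> dmean a 0 (indicator {y. real m * ?B < norm (g y - cell_mean a g 0 x)}) x"
    proof (rule dmean_mono)
      fix y
      have "real m * ?B < norm (g y - cell_mean a g 0 x)" if "real m * A < norm (g y)"
      proof -
        have "real m * A = real m * ?B + real m" unfolding A_def by (simp add: distrib_left)
        moreover have "1 \<le> real m" using Suc by simp
        ultimately show ?thesis using that mean[of x] norm_triangle_ineq2[of "g y" "cell_mean a g 0 x"] by linarith
      qed
      then show "indicator (E m) y \<le> (indicator {y. real m * ?B < norm (g y - cell_mean a g 0 x)} y :: ennreal)"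
        unfolding E_def by (simp add: indicator_def)
    qed
    also have "\<dots> \<le> ennreal ((1/4) ^ m)" by (rule dyadic_John_Nirenberg) (simp_all add: int osc)
    finally show ?thesis .
  qed
  have ptw: "ennreal (2 powr (norm (g y) / A)) \<le> 1 + (\<Sum>m. ennreal (2 ^ Suc m) * indicator (E m) y)" for y
  proof (cases "norm (g y) = 0")
    case True
    then show ?thesis by simp
  next
    case False
    define t where "t = norm (g y) / A"
    have t: "t > 0" using False A unfolding t_def by simp
    \<comment> \<open>Rounding up and subtracting 1 gives m < t <= m + 1; the left inequality must
      be strict to match the definition of \<open>E m\<close>.\<close>
    define m where "m = nat (\<lceil>t\<rceil> - 1)"
    have m: "real m < t" "t \<le> real (Suc m)" using t unfolding m_def by linarith+
    have "y \<in> E m" using m(1) A unfolding E_def t_def by (simp add: field_simps)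
    have "2 powr t \<le> 2 powr real (Suc m)" using m(2) by (intro powr_mono) auto
    then have "ennreal (2 powr t) \<le> ennreal (2 ^ Suc m) * indicator (E m) y"
      using \<open>y \<in> E m\<close> by (simp add: powr_realpow ennreal_leI del: of_nat_Suc power_Suc)
    also have "\<dots> \<le> (\<Sum>m. ennreal (2 ^ Suc m) * indicator (E m) y)"
      using sum_le_suminf[of "\<lambda>m. ennreal (2 ^ Suc m) * indicator (E m) y" "{m}"] by (simp del: sum_mult_indicator)
    finally show ?thesis unfolding t_def by (rule order_trans) simp
  qed
  have "dmean a 0 (\<lambda>y. ennreal (2 powr (norm (g y) / A))) x \<le> dmean a 0 (\<lambda>y. 1 + (\<Sum>m. ennreal (2 ^ Suc m) * indicator (E m) y)) x"
    by (rule dmean_mono) (rule ptw)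
  also have "\<dots> = (\<integral>\<^sup>+y. indicator (dcell a 0 x) y * (1 + (\<Sum>m. ennreal (2 ^ Suc m) * indicator (E m) y)) \<partial>lborel)"
    unfolding dmean_def by simp
  also have "\<dots> = (\<integral>\<^sup>+y. indicator (dcell a 0 x) y + (\<Sum>m. ennreal (2 ^ Suc m) * (indicator (dcell a 0 x) y * indicator (E m) y)) \<partial>lborel)"
    by (simp add: distrib_left mult.left_commute flip: ennreal_suminf_cmult)
  also have "\<dots> = emeasure lborel (dcell a 0 x) + (\<Sum>m. ennreal (2 ^ Suc m) * (\<integral>\<^sup>+y. indicator (dcell a 0 x) y * indicator (E m) y \<partial>lborel))"
    by (simp add: nn_integral_add nn_integral_suminf nn_integral_cmult del: ennreal_suminf_cmult)
  also have "\<dots> \<le> 1 + (\<Sum>m. ennreal (2 ^ Suc m) * ennreal ((1/4) ^ m))"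
    using E unfolding dmean_def by (intro add_mono suminf_le mult_left_mono) (simp_all add: emeasure_dcell)
  also have "(\<Sum>m. ennreal (2 ^ Suc m) * ennreal ((1/4) ^ m)) = (\<Sum>m. ennreal (2 * (1/2) ^ m))"
    by (intro suminf_cong) (simp add: power_divide field_simps flip: ennreal_mult' power_mult_distrib)
  also have "\<dots> = ennreal (\<Sum>m. 2 * (1/2) ^ m)"
    by (intro suminf_ennreal2 summable_mult summable_geometric) auto
  also have "(\<Sum>m. 2 * (1/2) ^ m) = (4::real)" by (simp add: suminf_mult suminf_geometric)
  finally show ?thesis by simp
qed

text \<open>The inequality s <= exp s for s = t b ln 2 / q, raised to the power q.\<close>

lemma powr_le_exponential:
  fixes q b t :: real
  assumes "q > 0" "b > 0" "t \<ge> 0"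
  shows "t powr q \<le> (q / (b * ln 2)) powr q * 2 powr (b * t)"
proof -
  have l: "ln (2::real) > 0" by simp
  define s where "s = t * (b * ln 2) / q"
  have s: "s \<ge> 0" unfolding s_def using assms l by (intro divide_nonneg_pos mult_nonneg_nonneg) auto
  have "t = (q / (b * ln 2)) * s" unfolding s_def using assms l by simp
  then have "t powr q = (q / (b * ln 2)) powr q * s powr q"
    using s assms l by (simp only: powr_mult)
  also have "s powr q \<le> (exp s) powr q"
    using s assms exp_ge_add_one_self[of s] by (intro powr_mono2) linarith+
  also have "(exp s) powr q = 2 powr (b * t)"
    unfolding s_def powr_def using assms by (simp add: mult_ac)
  finally show ?thesis by (simp add: mult_left_mono)
qed

text \<open>The exponent |g|/A is split in halves. Above the threshold one half is at least j n, so
  it pays for the density 2^(j n) of the small cell in the unit cell; the other half dominates the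
  power |g|^q. The bound is therefore uniform in j.\<close>

lemma dyadic_moment_bound:
  fixes g :: "real ^ 'n::finite \<Rightarrow> complex"
  defines "A \<equiv> 4 * 2 ^ CARD('n) + 1"
  assumes [measurable]: "g \<in> borel_measurable borel"
    and int: "\<And>j x. integrable lborel (\<lambda>y. indicator (dcell a j x) y *\<^sub>R g y)"
    and osc: "\<And>j x. dmean a j (\<lambda>y. ennreal (norm (g y - cell_mean a g j x))) x \<le> 1"
    and mean: "\<And>x. norm (cell_mean a g 0 x) \<le> 1"
    and q: "q > 0"
  shows "dmean a j (\<lambda>y. ennreal (norm (g y) powr q) * indicator {y. real (Suc j) * (2 * A * real CARD('n)) < norm (g y)} y) x
    \<le> ennreal ((q / (1 / (2 * A) * ln 2)) powr q) * 5"
proof -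
  let ?C = "(q / (1 / (2 * A) * ln 2)) powr q"
  let ?s = "(2 ^ j) ^ CARD('n) :: real"
  have A: "A > 0" unfolding A_def by (intro add_pos_pos) auto
  let ?F = "\<lambda>y. ennreal (norm (g y) powr q) * indicator {y. real (Suc j) * (2 * A * real CARD('n)) < norm (g y)} y"
  have "?F y \<le> ennreal (?C / ?s) * ennreal (2 powr (norm (g y) / A))" for y
  proof (cases "real (Suc j) * (2 * A * real CARD('n)) < norm (g y)")
    case True
    define t where "t = norm (g y)"
    have "t powr q \<le> ?C * 2 powr (1 / (2 * A) * t)"
      by (rule powr_le_exponential) (use q A in \<open>simp_all add: t_def\<close>)
    also have "2 powr (1 / (2 * A) * t) \<le> 1 / ?s * 2 powr (t / A)"
    proof -
      have "real (j * CARD('n)) \<le> t / (2 * A)"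
      proof -
        have "real (j * CARD('n)) * (2 * A) \<le> real (Suc j) * (2 * A * real CARD('n))"
          using A by (simp add: algebra_simps)
        also have "\<dots> \<le> t" using True unfolding t_def by simp
        finally show ?thesis using A by (simp add: field_simps)
      qed
      moreover have "t / A = t / (2 * A) + t / (2 * A)" by simp
      ultimately have "real (j * CARD('n)) + 1 / (2 * A) * t \<le> t / A" by simp
      then have "2 powr (real (j * CARD('n)) + 1 / (2 * A) * t) \<le> 2 powr (t / A)" by (intro powr_mono) auto
      moreover have "2 powr (real (j * CARD('n)) + 1 / (2 * A) * t) = ?s * 2 powr (1 / (2 * A) * t)"
        unfolding powr_add by (simp only: powr_realpow zero_less_numeral power_mult)
      ultimately have le: "2 powr (1 / (2 * A) * t) * ?s \<le> 2 powr (t / A)" by (simp only: mult.commute)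
      have "?s > 0" by simp
      then show ?thesis using le by (simp only: times_divide_eq_left mult_1 pos_le_divide_eq)
    qed
    finally have "t powr q \<le> ?C / ?s * 2 powr (t / A)" by (simp add: mult_left_mono)
    then show ?thesis using True unfolding t_def by (simp add: ennreal_leI flip: ennreal_mult')
  qed simp
  then have "dmean a j ?F x \<le> ennreal ?s * (\<integral>\<^sup>+y. indicator (dcell a j x) y * (ennreal (?C / ?s) * ennreal (2 powr (norm (g y) / A))) \<partial>lborel)"
    unfolding dmean_def by (intro mult_left_mono nn_integral_mono) auto
  also have "\<dots> \<le> ennreal ?s * (\<integral>\<^sup>+y. ennreal (?C / ?s) * (indicator (dcell a 0 x) y * ennreal (2 powr (norm (g y) / A))) \<partial>lborel)"
    using dcell_antimono[of 0 j a x] by (intro mult_left_mono nn_integral_mono) (auto simp: indicator_def)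
  also have "\<dots> = (ennreal ?s * ennreal (?C / ?s)) * dmean a 0 (\<lambda>y. ennreal (2 powr (norm (g y) / A))) x"
    unfolding dmean_def by (subst nn_integral_cmult) (simp_all add: mult.assoc)
  also have "ennreal ?s * ennreal (?C / ?s) = ennreal ?C" by (simp flip: ennreal_mult')
  also have "ennreal ?C * dmean a 0 (\<lambda>y. ennreal (2 powr (norm (g y) / A))) x \<le> ennreal ?C * 5"
    unfolding A_def
    by (intro mult_left_mono dyadic_exponential_integrability) (use int osc mean in simp_all)
  finally show ?thesis .
qed

section \<open>The positive dyadic operator\<close>

text \<open>Telescoping from \<open>1/(1+j)^2 <= 2/(1+j) - 2/(2+j)\<close>. With t proportional to
  g, this is where the factor g is cancelled.\<close>

lemma inverse_square_tail:
  assumes "0 < t"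
  shows "(\<Sum>j<N. if t \<le> 1 + real j then 1 / (1 + real j)\<^sup>2 else 0) \<le> 2 / t"
proof -
  \<comment> \<open>The maximum lets the bound start to telescope only when 1 + N reaches t; before
    that, all terms are 0.\<close>
  have "(\<Sum>j<N. if t \<le> 1 + real j then 1 / (1 + real j)\<^sup>2 else 0) \<le> 2 / t - 2 / max t (1 + real N)"
  proof (induction N)
    case 0
    then show ?case using assms by (simp add: max_def frac_le)
  next
    case (Suc N)
    show ?case
    proof (cases "t \<le> 1 + real N")
      case True
      have "1 / (1 + real N)\<^sup>2 \<le> 2 / (1 + real N) - 2 / (2 + real N)"
      proof -
        have "2 / (1 + real N) - 2 / (2 + real N) = 2 / ((1 + real N) * (2 + real N))"
          by (simp add: diff_frac_eq)
        moreover have "1 / (1 + real N)\<^sup>2 \<le> 2 / ((1 + real N) * (2 + real N))"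
          by (simp add: power2_eq_square divide_simps)
        ultimately show ?thesis by simp
      qed
      moreover have "max t (1 + real N) = 1 + real N" "max t (1 + real (Suc N)) = 2 + real N" using True by auto
      ultimately show ?thesis using Suc True by simp
    next
      case False
      have "2 / max t (1 + real (Suc N)) \<le> 2 / max t (1 + real N)"
        using assms by (intro divide_left_mono) (auto simp: max_def)
      then show ?thesis using Suc False by simp
    qed
  qed
  moreover have "0 \<le> 2 / max t (1 + real N)" using assms by (simp add: max_def)
  ultimately show ?thesis by linarith
qed

lemma inverse_square_sum: "(\<Sum>j<N. 1 / (1 + real j)\<^sup>2) \<le> 2"
  using inverse_square_tail[of 1 N] by simp

text \<open>Convexity of t^p with the derivative taken at the right endpoint, derived from Young's
  inequality for \<open>s * (s + b) powr (p - 1)\<close>. In the application s + b is the partial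
  sum that includes level j.\<close>

lemma powr_increment:
  fixes s b p :: real
  assumes "p > 1" "s \<ge> 0" "b \<ge> 0"
  shows "(s + b) powr p \<le> s powr p + p * b * (s + b) powr (p - 1)"
proof -
  define q where "q = p / (p - 1)"
  have q: "q > 1" "1 / p + 1 / q = 1" using assms by (simp_all add: q_def field_simps)
  let ?S = "s + b"
  have pq: "(?S powr (p - 1)) powr q = ?S powr p" using assms by (simp add: powr_powr q_def)
  have "s * ?S powr (p - 1) \<le> s powr p / p + ?S powr p / q"
    using Youngs_inequality[OF assms(1) q(1) q(2) assms(2), of "?S powr (p - 1)"] by (simp add: pq)
  then have "p * (s * ?S powr (p - 1)) \<le> p * (s powr p / p + ?S powr p / q)"
    using assms by (intro mult_left_mono) auto
  also have "\<dots> = s powr p + (p - 1) * ?S powr p"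
    using assms by (simp add: q_def distrib_left)
  finally have 1: "p * s * ?S powr (p - 1) \<le> s powr p + (p - 1) * ?S powr p" by simp
  have "?S * ?S powr (p - 1) = ?S powr p"
    using assms powr_add[of ?S 1 "p - 1"] by (cases "?S = 0") (auto simp: powr_one)
  then have "p * ?S powr p = p * (?S * ?S powr (p - 1))" by (simp only:)
  also have "\<dots> = p * s * ?S powr (p - 1) + p * b * ?S powr (p - 1)"
    by (simp only: distrib_left distrib_right mult.assoc)
  finally have "p * ?S powr p = p * s * ?S powr (p - 1) + p * b * ?S powr (p - 1)" .
  then show ?thesis using 1 by (simp add: algebra_simps)
qed

section \<open>Power sums, Hoelder's inequality and absorption\<close>

lemma powr_add_le:
  fixes s b p :: real
  assumes "p \<ge> 0" "s \<ge> 0" "b \<ge> 0"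
  shows "(s + b) powr p \<le> 2 powr p * (s powr p + b powr p)"
proof -
  have "(s + b) powr p \<le> (2 * max s b) powr p" using assms by (intro powr_mono2) auto
  also have "\<dots> = 2 powr p * (max s b) powr p" using assms by (intro powr_mult)
  also have "\<dots> \<le> 2 powr p * (s powr p + b powr p)"
    by (intro mult_left_mono) (auto simp: max_def)
  finally show ?thesis .
qed

text \<open>Young's inequality after normalising by X^(1/p) and K^(1/q). Positive upper bounds in
  place of the integrals themselves avoid a division by 0.\<close>

lemma nn_integral_Holder:
  fixes f g :: "'a \<Rightarrow> real"
  assumes [measurable]: "f \<in> borel_measurable M" "g \<in> borel_measurable M"
    and pq: "p > 1" "q > 1" "1 / p + 1 / q = 1" and nonneg: "\<And>x. 0 \<le> f x" "\<And>x. 0 \<le> g x"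
    and X: "X > 0" "(\<integral>\<^sup>+x. ennreal (f x powr p) \<partial>M) \<le> ennreal X"
    and K: "K > 0" "(\<integral>\<^sup>+x. ennreal (g x powr q) \<partial>M) \<le> ennreal K"
  shows "(\<integral>\<^sup>+x. ennreal (f x * g x) \<partial>M) \<le> ennreal (X powr (1 / p) * K powr (1 / q))"
proof -
  let ?a = "X powr (1 / p)" let ?b = "K powr (1 / q)"
  have ab: "?a > 0" "?b > 0" using X K by auto
  have abp: "?a powr p = X" "?b powr q = K" using X K pq by (simp_all add: powr_powr)
  have "f x * g x \<le> ?a * ?b / (p * X) * (f x powr p) + ?a * ?b / (q * K) * (g x powr q)" for x
  proof -
    have "(f x / ?a) * (g x / ?b) \<le> (f x / ?a) powr p / p + (g x / ?b) powr q / q"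
      by (rule Youngs_inequality) (use pq nonneg ab in \<open>auto intro: divide_nonneg_pos\<close>)
    then have "(?a * ?b) * ((f x / ?a) * (g x / ?b)) \<le> (?a * ?b) * ((f x / ?a) powr p / p + (g x / ?b) powr q / q)"
      using ab by (intro mult_left_mono) auto
    moreover have "(?a * ?b) * ((f x / ?a) * (g x / ?b)) = f x * g x" using ab by simp
    moreover have "(f x / ?a) powr p = f x powr p / X" "(g x / ?b) powr q = g x powr q / K"
      using ab nonneg abp by (simp_all add: powr_divide)
    ultimately show ?thesis by (simp add: algebra_simps)
  qed
  then have "(\<integral>\<^sup>+x. ennreal (f x * g x) \<partial>M) \<le>
      (\<integral>\<^sup>+x. ennreal (?a * ?b / (p * X)) * ennreal (f x powr p) + ennreal (?a * ?b / (q * K)) * ennreal (g x powr q) \<partial>M)"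
    using ab X K pq by (intro nn_integral_mono) (simp add: ennreal_leI flip: ennreal_mult' ennreal_plus)
  also have "\<dots> = ennreal (?a * ?b / (p * X)) * (\<integral>\<^sup>+x. ennreal (f x powr p) \<partial>M)
      + ennreal (?a * ?b / (q * K)) * (\<integral>\<^sup>+x. ennreal (g x powr q) \<partial>M)"
    by (simp add: nn_integral_add nn_integral_cmult)
  also have "\<dots> \<le> ennreal (?a * ?b / (p * X)) * ennreal X + ennreal (?a * ?b / (q * K)) * ennreal K"
    by (intro add_mono mult_left_mono X K) simp_all
  also have "\<dots> = ennreal (?a * ?b / (p * X) * X + ?a * ?b / (q * K) * K)"
    using ab X K pq by (simp add: ennreal_plus ennreal_mult' del: times_divide_eq_left)
  also have "?a * ?b / (p * X) * X + ?a * ?b / (q * K) * K = ?a * ?b * (1 / p + 1 / q)"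
    using X K by (simp add: distrib_left)
  finally show ?thesis using pq by simp
qed

lemma nn_integral_Holder_powr:
  fixes f g :: "'a \<Rightarrow> real"
  assumes [measurable]: "f \<in> borel_measurable M" "g \<in> borel_measurable M"
    and p: "p > 1" and nonneg: "\<And>x. 0 \<le> f x" "\<And>x. 0 \<le> g x"
    and K: "K > 0" "(\<integral>\<^sup>+x. ennreal (g x powr (p / (p - 1))) \<partial>M) \<le> ennreal K"
  shows "ennreal (enn2real (\<integral>\<^sup>+x. ennreal (f x * g x) \<partial>M) powr p)
    \<le> ennreal (K powr (p - 1)) * (\<integral>\<^sup>+x. ennreal (f x powr p) \<partial>M)"
proof (cases "(\<integral>\<^sup>+x. ennreal (f x powr p) \<partial>M)")
  case (real r)
  have pq: "p / (p - 1) > 1" "1 / p + 1 / (p / (p - 1)) = 1" using p by (simp_all add: field_simps)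
  let ?I = "\<integral>\<^sup>+x. ennreal (f x * g x) \<partial>M"
  have "enn2real ?I powr p \<le> K powr (p - 1) * r"
  proof (rule field_le_epsilon)
    fix e :: real assume e: "e > 0"
    \<comment> \<open>The integral \<open>r\<close> may be 0, so a positive amount is added; d is
      chosen so that its contribution is exactly e.\<close>
    define d where "d = e / K powr (p - 1)"
    have d: "d > 0" using e K(1) by (simp add: d_def)
    have "?I \<le> ennreal ((r + d) powr (1 / p) * K powr (1 / (p / (p - 1))))"
      by (rule nn_integral_Holder) (use p pq nonneg K real d in \<open>auto intro: ennreal_leI\<close>)
    then have "enn2real ?I \<le> (r + d) powr (1 / p) * K powr ((p - 1) / p)"
      by (intro enn2real_leI) auto
    then have "enn2real ?I powr p \<le> ((r + d) powr (1 / p) * K powr ((p - 1) / p)) powr p"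
      using p by (intro powr_mono2) auto
    also have "\<dots> = (r + d) * K powr (p - 1)"
      using p real d K by (simp add: powr_mult powr_powr)
    also have "\<dots> = K powr (p - 1) * r + e" using K(1) by (simp add: d_def algebra_simps)
    finally show "enn2real ?I powr p \<le> K powr (p - 1) * r + e" .
  qed
  then show ?thesis using real by (simp add: ennreal_leI flip: ennreal_mult')
next
  case top
  have "ennreal (K powr (p - 1)) \<noteq> 0" using K(1) by simp
  then show ?thesis using top by (simp add: ennreal_mult_top)
qed

text \<open>Finiteness of \<open>x\<close> is essential here: for infinite x the first inequality
  holds trivially.\<close>

lemma ennreal_absorb_half:
  fixes x y :: ennreal
  assumes "x \<le> ennreal D * y + ennreal (1/2) * x" "x < \<infinity>" "y < \<infinity>" "D \<ge> 0"
  shows "x \<le> ennreal (2 * D) * y"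
proof -
  obtain r s where rs: "x = ennreal r" "y = ennreal s" "r \<ge> 0" "s \<ge> 0"
    using assms(2,3) by (cases x; cases y) auto
  have "ennreal D * ennreal s = ennreal (D * s)" "ennreal (1/2) * ennreal r = ennreal (1/2 * r)"
    by (rule ennreal_mult'[symmetric]; use assms(4) in simp)+
  then have "ennreal r \<le> ennreal (D * s) + ennreal (1/2 * r)" using assms(1) unfolding rs by (simp only:)
  then have "ennreal r \<le> ennreal (D * s + 1/2 * r)"
    using assms(4) rs(3,4) by (subst ennreal_plus) auto
  then have "r \<le> D * s + 1/2 * r" using assms(4) rs by (subst (asm) ennreal_le_iff) auto
  then have "r \<le> 2 * D * s" by simp
  then show ?thesis using rs assms(4) by (simp add: ennreal_leI flip: ennreal_mult')
qed

text \<open>Real values make \<open>powr\<close> available. An infinite mean would be turned into 0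
  by \<open>enn2real\<close>; \<open>dyadic_series_bound\<close> establishes that the means are
  finite before these sums are identified with the partial sums of the series.\<close>

definition dyadic_sum :: "real ^ 'n::finite \<Rightarrow> (real ^ 'n \<Rightarrow> ennreal) \<Rightarrow> nat \<Rightarrow> real ^ 'n \<Rightarrow> real" where
  "dyadic_sum a F J x = (\<Sum>j<J. 1 / (1 + real j)\<^sup>2 * enn2real (dmean a j F x))"

lemma dyadic_sum_simps [simp]:
  "dyadic_sum a F 0 x = 0"
  "dyadic_sum a F (Suc J) x = dyadic_sum a F J x + 1 / (1 + real J)\<^sup>2 * enn2real (dmean a J F x)"
  by (simp_all add: dyadic_sum_def)

lemma dyadic_sum_nonneg: "0 \<le> dyadic_sum a F J x"
  unfolding dyadic_sum_def by (intro sum_nonneg) simp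

lemma dyadic_sum_mono: "i \<le> J \<Longrightarrow> dyadic_sum a F i x \<le> dyadic_sum a F J x"
  unfolding dyadic_sum_def by (intro sum_mono2) auto

lemma dyadic_sum_measurable [measurable]:
  assumes [measurable]: "F \<in> borel_measurable borel"
  shows "dyadic_sum a F J \<in> borel_measurable borel"
  unfolding dyadic_sum_def[abs_def] by measurable

text \<open>The sum up to \<open>Suc j\<close> involves levels 0 to j, all constant on cells of
  level j. This off-by-one lets the factor from \<open>powr_increment\<close> pass through the
  averaging of level j.\<close>

lemma level_const_dyadic_sum: "level_const a j (dyadic_sum a F (Suc j))"
proof -
  have "dmean a i F y = dmean a i F x" if "y \<in> dcell a j x" "i < Suc j" for x y i
    using level_constD[OF level_const_mono[OF level_const_dmean], of i j y a x F] that by simp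
  then show ?thesis unfolding level_const_def dyadic_sum_def by (auto intro!: sum.cong)
qed

lemma dyadic_sum_powr_le:
  assumes "p > 1"
  shows "dyadic_sum a F J x powr p \<le>
    (\<Sum>j<J. p * (1 / (1 + real j)\<^sup>2 * enn2real (dmean a j F x)) * dyadic_sum a F (Suc j) x powr (p - 1))"
proof (induction J)
  case (Suc J)
  have "dyadic_sum a F (Suc J) x powr p \<le> dyadic_sum a F J x powr p
      + p * (1 / (1 + real J)\<^sup>2 * enn2real (dmean a J F x)) * dyadic_sum a F (Suc J) x powr (p - 1)"
    unfolding dyadic_sum_simps(2) by (rule powr_increment) (use assms in \<open>auto simp: dyadic_sum_nonneg\<close>)
  then show ?case using Suc by simp
qed simp

text \<open>Pointwise: if \<open>\<gamma> \<le> (1 + j) L\<close> the weights sum up to \<open>O(L / \<gamma>)\<close>; otherwise \<open>\<gamma>\<close> is kept together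
  with the factor \<open>s (Suc j)\<close> that is constant on cells of level \<open>j\<close>.\<close>

lemma weighted_sum_split:
  fixes s :: "nat \<Rightarrow> real"
  assumes p: "p > 1" and L: "L > 0" and \<delta>: "\<delta> > 0" and nonneg: "0 \<le> \<phi>" "0 \<le> \<gamma>" "\<And>i. 0 \<le> s i"
    and mono: "\<And>i. i \<le> J \<Longrightarrow> s i \<le> s J"
  defines "q \<equiv> p / (p - 1)"
  shows "(\<Sum>j<J. p * (1 / (1 + real j)\<^sup>2 * (\<phi> * \<gamma>)) * s (Suc j) powr (p - 1)) \<le>
    ((2 * L * p / \<delta>) powr p / p * \<phi> powr p + \<delta> powr q / q * s J powr p)
    + (\<Sum>j<J. 1 / (1 + real j)\<^sup>2 * ((p / \<delta>) powr p / p * \<phi> powr p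
        + \<delta> powr q / q * ((if real (Suc j) * L < \<gamma> then \<gamma> powr q else 0) * s (Suc j) powr p)))"
proof -
  have q: "q > 1" "1 / p + 1 / q = 1" using p by (simp_all add: q_def field_simps)
  have sq: "(u powr (p - 1)) powr q = u powr p" for u :: real using p by (simp add: powr_powr q_def)
  \<comment> \<open>Young's inequality with a free weight \<delta>, to be chosen small later. Since
    q is conjugate to p, the power (t^(p-1))^q is t^p, so all terms with s can be absorbed.\<close>
  have young: "c * \<phi> * (\<beta> * t powr (p - 1)) \<le> (c / \<delta>) powr p / p * \<phi> powr p + \<delta> powr q / q * (\<beta> powr q * t powr p)"
    if "c \<ge> 0" "\<beta> \<ge> 0" "t \<ge> 0" for c \<beta> t
  proof -
    have "c * \<phi> * (\<beta> * t powr (p - 1)) = (c / \<delta> * \<phi>) * (\<delta> * (\<beta> * t powr (p - 1)))" using \<delta> by simp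
    also have "\<dots> \<le> (c / \<delta> * \<phi>) powr p / p + (\<delta> * (\<beta> * t powr (p - 1))) powr q / q"
      by (rule Youngs_inequality) (use p q that \<delta> nonneg in auto)
    also have "\<dots> = (c / \<delta>) powr p / p * \<phi> powr p + \<delta> powr q / q * (\<beta> powr q * t powr p)"
    proof -
      have "(c / \<delta> * \<phi>) powr p = (c / \<delta>) powr p * \<phi> powr p"
        by (rule powr_mult)
      moreover have "(\<delta> * (\<beta> * t powr (p - 1))) powr q = \<delta> powr q * (\<beta> powr q * t powr p)"
        using that \<delta> by (simp add: powr_mult sq)
      ultimately show ?thesis by simp
    qed
    finally show ?thesis .
  qed
  let ?w = "\<lambda>j. 1 / (1 + real j)\<^sup>2"
  let ?small = "\<lambda>j. if \<gamma> \<le> real (Suc j) * L then ?w j else 0"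
  let ?big = "\<lambda>j. if real (Suc j) * L < \<gamma> then \<gamma> else 0"
  have split: "p * (?w j * (\<phi> * \<gamma>)) * s (Suc j) powr (p - 1) \<le>
      (p * \<phi> * s J powr (p - 1)) * (\<gamma> * ?small j) + ?w j * (p * \<phi> * (?big j * s (Suc j) powr (p - 1)))" if "j < J" for j
  proof (cases "\<gamma> \<le> real (Suc j) * L")
    case True
    have "s (Suc j) powr (p - 1) \<le> s J powr (p - 1)"
      using p nonneg mono[of "Suc j"] that by (intro powr_mono2) auto
    then have "p * (?w j * (\<phi> * \<gamma>)) * s (Suc j) powr (p - 1) \<le> p * (?w j * (\<phi> * \<gamma>)) * s J powr (p - 1)"
      using p nonneg by (intro mult_left_mono) auto
    then show ?thesis using True by (simp add: mult_ac)
  qed (simp add: mult_ac)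
  have "\<gamma> * (\<Sum>j<J. ?small j) \<le> 2 * L"
  proof (cases "\<gamma> = 0")
    case False
    then have \<gamma>: "\<gamma> > 0" using nonneg by simp
    have eq: "\<gamma> \<le> real (Suc j) * L \<longleftrightarrow> \<gamma> / L \<le> 1 + real j" for j
      using L by (simp add: divide_le_eq)
    have "(\<Sum>j<J. ?small j) \<le> 2 / (\<gamma> / L)"
      unfolding eq by (rule inverse_square_tail) (use \<gamma> L in simp)
    then have "\<gamma> * (\<Sum>j<J. ?small j) \<le> \<gamma> * (2 / (\<gamma> / L))" using \<gamma> by (intro mult_left_mono) auto
    then show ?thesis using \<gamma> by simp
  qed (use L in simp)
  then have small: "(p * \<phi> * s J powr (p - 1)) * (\<gamma> * (\<Sum>j<J. ?small j)) \<le> (p * \<phi> * s J powr (p - 1)) * (2 * L)"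
    using p nonneg by (intro mult_left_mono) auto
  have "(\<Sum>j<J. p * (?w j * (\<phi> * \<gamma>)) * s (Suc j) powr (p - 1)) \<le>
      (\<Sum>j<J. (p * \<phi> * s J powr (p - 1)) * (\<gamma> * ?small j) + ?w j * (p * \<phi> * (?big j * s (Suc j) powr (p - 1))))"
    by (intro sum_mono split) simp
  also have "\<dots> = (p * \<phi> * s J powr (p - 1)) * (\<gamma> * (\<Sum>j<J. ?small j)) + (\<Sum>j<J. ?w j * (p * \<phi> * (?big j * s (Suc j) powr (p - 1))))"
    by (simp only: sum.distrib sum_distrib_left)
  also have "\<dots> \<le> (2 * L * p) * \<phi> * (1 * s J powr (p - 1)) + (\<Sum>j<J. ?w j * (p * \<phi> * (?big j * s (Suc j) powr (p - 1))))"
    using small by (simp add: mult_ac)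
  also have "\<dots> \<le> ((2 * L * p / \<delta>) powr p / p * \<phi> powr p + \<delta> powr q / q * (1 powr q * s J powr p))
    + (\<Sum>j<J. ?w j * ((p / \<delta>) powr p / p * \<phi> powr p + \<delta> powr q / q * (?big j powr q * s (Suc j) powr p)))"
    by (intro add_mono sum_mono mult_left_mono young) (use p L nonneg in auto)
  also have "(\<lambda>j. ?big j powr q) = (\<lambda>j. if real (Suc j) * L < \<gamma> then \<gamma> powr q else 0)" by auto
  finally show ?thesis by (simp only: powr_one_eq_one mult_1)
qed

text \<open>Means as integrals against a probability measure, so that the general integral
  inequalities apply to them.\<close>

lemma dmean_eq_density:
  fixes F :: "real ^ 'n::finite \<Rightarrow> ennreal"
  assumes [measurable]: "F \<in> borel_measurable borel"
  shows "dmean a j F x = (\<integral>\<^sup>+y. F y \<partial>density lborel (\<lambda>y. ennreal ((2 ^ j) ^ CARD('n)) * indicator (dcell a j x) y))"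
  by (simp add: dmean_def nn_integral_density nn_integral_cmult mult.assoc)

lemma dmean_Holder_powr:
  fixes f g :: "real ^ 'n::finite \<Rightarrow> real"
  assumes [measurable]: "f \<in> borel_measurable borel" "g \<in> borel_measurable borel"
    and p: "p > 1" and nonneg: "\<And>y. 0 \<le> f y" "\<And>y. 0 \<le> g y"
    and K: "K > 0" "dmean a j (\<lambda>y. ennreal (g y powr (p / (p - 1)))) x \<le> ennreal K"
  shows "ennreal (enn2real (dmean a j (\<lambda>y. ennreal (f y * g y)) x) powr p)
    \<le> ennreal (K powr (p - 1)) * dmean a j (\<lambda>y. ennreal (f y powr p)) x"
  using K(2) by (simp add: dmean_eq_density nn_integral_Holder_powr[OF _ _ p nonneg K(1)])

lemma nn_integral_dmean:
  assumes [measurable]: "F \<in> borel_measurable borel"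
  shows "(\<integral>\<^sup>+x. dmean a j F x \<partial>lborel) = (\<integral>\<^sup>+x. F x \<partial>lborel)"
  using nn_integral_dmean_level[of F "\<lambda>_. 1" a j] by (simp add: level_const_def)

lemma dmean_const_add:
  fixes F :: "real ^ 'n::finite \<Rightarrow> ennreal"
  assumes [measurable]: "F \<in> borel_measurable borel"
  shows "dmean a j (\<lambda>y. c + F y) x = c + dmean a j F x"
proof -
  have "dmean a j (\<lambda>y. c + F y) x = dmean a j (\<lambda>y. c) x + dmean a j F x"
    by (simp add: dmean_eq_density nn_integral_add)
  then show ?thesis using dmean_level_const[of a j "\<lambda>_. c" x] by (simp add: level_const_def)
qed

lemma ennreal_linear_combination:
  assumes "0 \<le> w" "0 \<le> d" "0 \<le> u" "0 \<le> k" "0 \<le> h" "0 \<le> v"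
  shows "ennreal (w * (d * u + k * (h * v)))
    = ennreal w * (ennreal d * ennreal u + ennreal k * (ennreal h * ennreal v))"
  using assms by (simp add: ennreal_mult' ennreal_plus)

lemma dmean_powr_le_moment:
  fixes G :: "real ^ 'n::finite \<Rightarrow> real"
  assumes [measurable]: "G \<in> borel_measurable borel"
    and q: "q > 0" and L: "L > 0" and B: "B \<ge> 0" and nonneg: "\<And>y. 0 \<le> G y"
    and moment: "\<And>j x. dmean a j (\<lambda>y. ennreal (if real (Suc j) * L < G y then G y powr q else 0)) x \<le> ennreal B"
  shows "dmean a j (\<lambda>y. ennreal (G y powr q)) x \<le> ennreal ((real (Suc j) * L) powr q + B + 1)"
proof -
  let ?H = "\<lambda>y. if real (Suc j) * L < G y then G y powr q else 0"
  have "dmean a j (\<lambda>y. ennreal (G y powr q)) x \<le> dmean a j (\<lambda>y. ennreal ((real (Suc j) * L) powr q) + ennreal (?H y)) x"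
  proof (rule dmean_mono)
    fix y
    have "G y powr q \<le> (real (Suc j) * L) powr q + ?H y"
      using nonneg[of y] L q by (auto intro: powr_mono2)
    then show "ennreal (G y powr q) \<le> ennreal ((real (Suc j) * L) powr q) + ennreal (?H y)"
      by (subst ennreal_plus[symmetric]) (auto intro: ennreal_leI)
  qed
  also have "\<dots> \<le> ennreal ((real (Suc j) * L) powr q) + ennreal B"
    by (subst dmean_const_add) (simp, intro add_left_mono moment)
  also have "\<dots> \<le> ennreal ((real (Suc j) * L) powr q + B + 1)"
    using B by (subst ennreal_plus[symmetric]) (auto intro: ennreal_leI)
  finally show ?thesis .
qed

text \<open>Hoelder's inequality on each cell. The constant grows with j, so the bound serves for
  finiteness of each term before absorption and, at level 0, for the tail of the kernel.\<close>

lemma nn_integral_dmean_powr: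
  fixes f G :: "real ^ 'n::finite \<Rightarrow> real"
  assumes [measurable]: "f \<in> borel_measurable borel" "G \<in> borel_measurable borel"
    and p: "p > 1" and L: "L > 0" and B: "B \<ge> 0" and nonneg: "\<And>y. 0 \<le> f y" "\<And>y. 0 \<le> G y"
    and moment: "\<And>j x. dmean a j (\<lambda>y. ennreal (if real (Suc j) * L < G y then G y powr (p / (p - 1)) else 0)) x \<le> ennreal B"
  shows "(\<integral>\<^sup>+x. ennreal (enn2real (dmean a j (\<lambda>y. ennreal (f y * G y)) x) powr p) \<partial>lborel)
    \<le> ennreal (((real (Suc j) * L) powr (p / (p - 1)) + B + 1) powr (p - 1)) * (\<integral>\<^sup>+x. ennreal (f x powr p) \<partial>lborel)"
proof -
  let ?K = "(real (Suc j) * L) powr (p / (p - 1)) + B + 1"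
  have K: "?K > 0" using B by (simp add: add_nonneg_pos)
  have "(\<integral>\<^sup>+x. ennreal (enn2real (dmean a j (\<lambda>y. ennreal (f y * G y)) x) powr p) \<partial>lborel)
      \<le> (\<integral>\<^sup>+x. ennreal (?K powr (p - 1)) * dmean a j (\<lambda>y. ennreal (f y powr p)) x \<partial>lborel)"
    by (intro nn_integral_mono dmean_Holder_powr dmean_powr_le_moment p L B nonneg K moment) (use p in simp_all)
  also have "\<dots> = ennreal (?K powr (p - 1)) * (\<integral>\<^sup>+x. ennreal (f x powr p) \<partial>lborel)"
    by (simp add: nn_integral_cmult nn_integral_dmean)
  finally show ?thesis .
qed

text \<open>A crude consequence of Young's inequality, again with a constant growing with j; it
  provides finiteness of the means at every point.\<close>

lemma dmean_product_le:
  fixes f G :: "real ^ 'n::finite \<Rightarrow> real"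
  assumes [measurable]: "f \<in> borel_measurable borel" "G \<in> borel_measurable borel"
    and p: "p > 1" and L: "L > 0" and B: "B \<ge> 0" and nonneg: "\<And>y. 0 \<le> f y" "\<And>y. 0 \<le> G y"
    and moment: "\<And>j x. dmean a j (\<lambda>y. ennreal (if real (Suc j) * L < G y then G y powr (p / (p - 1)) else 0)) x \<le> ennreal B"
  shows "dmean a j (\<lambda>y. ennreal (f y * G y)) x \<le>
    ennreal ((2 ^ j) ^ CARD('n)) * (\<integral>\<^sup>+y. ennreal (f y powr p) \<partial>lborel) + ennreal ((real (Suc j) * L) powr (p / (p - 1)) + B + 1)"
proof -
  have q: "p / (p - 1) > 1" "1 / p + 1 / (p / (p - 1)) = 1" using p by (simp_all add: field_simps)
  have "dmean a j (\<lambda>y. ennreal (f y * G y)) x \<le> dmean a j (\<lambda>y. ennreal (f y powr p) + ennreal (G y powr (p / (p - 1)))) x"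
  proof (rule dmean_mono)
    fix y
    have "f y * G y \<le> f y powr p / p + G y powr (p / (p - 1)) / (p / (p - 1))"
      by (rule Youngs_inequality) (use p q nonneg in auto)
    also have "\<dots> \<le> f y powr p / 1 + G y powr (p / (p - 1)) / 1"
      using p q by (intro add_mono divide_left_mono) auto
    finally show "ennreal (f y * G y) \<le> ennreal (f y powr p) + ennreal (G y powr (p / (p - 1)))"
      by (simp add: ennreal_leI flip: ennreal_plus)
  qed
  also have "\<dots> = dmean a j (\<lambda>y. ennreal (f y powr p)) x + dmean a j (\<lambda>y. ennreal (G y powr (p / (p - 1)))) x"
    by (simp add: dmean_eq_density nn_integral_add)
  also have "\<dots> \<le> ennreal ((2 ^ j) ^ CARD('n)) * (\<integral>\<^sup>+y. ennreal (f y powr p) \<partial>lborel)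
      + ennreal ((real (Suc j) * L) powr (p / (p - 1)) + B + 1)"
  proof (rule add_mono)
    show "dmean a j (\<lambda>y. ennreal (f y powr p)) x \<le> ennreal ((2 ^ j) ^ CARD('n)) * (\<integral>\<^sup>+y. ennreal (f y powr p) \<partial>lborel)"
      unfolding dmean_def by (intro mult_left_mono nn_integral_mono) (auto simp: indicator_def)
    show "dmean a j (\<lambda>y. ennreal (G y powr (p / (p - 1)))) x \<le> ennreal ((real (Suc j) * L) powr (p / (p - 1)) + B + 1)"
      by (rule dmean_powr_le_moment) (use L B nonneg moment q in simp_all)
  qed
  finally show ?thesis .
qed

text \<open>Here \<delta> solves (\<delta>^q / q)(1 + 2 B) = 1/2, the coefficient of the integral of
  S^p on the right-hand side. The outer factor 2 results from absorbing that half, the inner 2 from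
  the sum of the weights \<open>(1 + j)^-2\<close>.\<close>

definition dyadic_const :: "real \<Rightarrow> real \<Rightarrow> real \<Rightarrow> real" where
  "dyadic_const p L B = (let q = p / (p - 1); \<delta> = (q / (2 * (1 + 2 * B))) powr (1 / q)
     in 2 * ((2 * L * p / \<delta>) powr p / p + 2 * ((p / \<delta>) powr p / p)))"

text \<open>For a fixed number J of levels the left-hand side is finite, which permits absorption;
  the resulting constant is free of J, which permits the limit.\<close>

lemma dyadic_sum_bound:
  fixes f G :: "real ^ 'n::finite \<Rightarrow> real"
  assumes [measurable]: "f \<in> borel_measurable borel" "G \<in> borel_measurable borel"
    and p: "p > 1" and L: "L > 0" and B: "B \<ge> 0" and nonneg: "\<And>y. 0 \<le> f y" "\<And>y. 0 \<le> G y"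
    and moment: "\<And>j x. dmean a j (\<lambda>y. ennreal (if real (Suc j) * L < G y then G y powr (p / (p - 1)) else 0)) x \<le> ennreal B"
    and fin: "(\<integral>\<^sup>+x. ennreal (f x powr p) \<partial>lborel) < \<infinity>"
  shows "(\<integral>\<^sup>+x. ennreal (dyadic_sum a (\<lambda>y. ennreal (f y * G y)) J x powr p) \<partial>lborel)
    \<le> ennreal (dyadic_const p L B) * (\<integral>\<^sup>+x. ennreal (f x powr p) \<partial>lborel)"
proof -
  define q where "q = p / (p - 1)"
  have q: "q > 1" using p by (simp add: q_def)
  define F where "F y = ennreal (f y * G y)" for y
  have [measurable]: "F \<in> borel_measurable borel" unfolding F_def[abs_def] by measurable
  define H where "H j y = (if real (Suc j) * L < G y then G y powr q else 0)" for j y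
  have [measurable]: "H j \<in> borel_measurable borel" for j unfolding H_def[abs_def] by measurable
  have H0: "0 \<le> H j y" for j y unfolding H_def by simp
  have mom: "dmean a j (\<lambda>y. ennreal (H j y)) x \<le> ennreal B" for j x
    using moment unfolding H_def q_def .
  let ?s = "dyadic_sum a F"
  let ?I = "\<integral>\<^sup>+x. ennreal (f x powr p) \<partial>lborel"
  let ?N = "\<lambda>J. \<integral>\<^sup>+x. ennreal (?s J x powr p) \<partial>lborel"
  have mean_fin: "(\<integral>\<^sup>+x. ennreal (enn2real (dmean a j F x) powr p) \<partial>lborel) < \<infinity>" for j
  proof -
    have "(\<integral>\<^sup>+x. ennreal (enn2real (dmean a j F x) powr p) \<partial>lborel)
        \<le> ennreal (((real (Suc j) * L) powr (p / (p - 1)) + B + 1) powr (p - 1)) * ?I"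
      unfolding F_def by (rule nn_integral_dmean_powr) (use p L B nonneg moment in simp_all)
    also have "\<dots> < \<infinity>" using fin by (simp add: ennreal_mult_less_top)
    finally show ?thesis .
  qed
  \<comment> \<open>A qualitative bound only, by induction on the number of levels; it makes the
    later subtraction of half of \<open>?N J\<close> legitimate.\<close>
  have N_fin: "?N J < \<infinity>" for J
  proof (induction J)
    case 0
    then show ?case using p by simp
  next
    case (Suc J)
    let ?w = "1 / (1 + real J)\<^sup>2"
    have "?N (Suc J) \<le> (\<integral>\<^sup>+x. ennreal (2 powr p) * (ennreal (?s J x powr p) + ennreal (enn2real (dmean a J F x) powr p)) \<partial>lborel)"
    proof (rule nn_integral_mono)
      fix x
      have "?w * enn2real (dmean a J F x) \<le> 1 * enn2real (dmean a J F x)"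
        by (intro mult_right_mono) (auto simp: divide_le_eq)
      then have "(?w * enn2real (dmean a J F x)) powr p \<le> enn2real (dmean a J F x) powr p"
        using p by (intro powr_mono2) auto
      then have "2 powr p * (?s J x powr p + (?w * enn2real (dmean a J F x)) powr p)
          \<le> 2 powr p * (?s J x powr p + enn2real (dmean a J F x) powr p)"
        by (intro mult_left_mono add_left_mono) simp_all
      moreover have "?s (Suc J) x powr p \<le> 2 powr p * (?s J x powr p + (?w * enn2real (dmean a J F x)) powr p)"
        unfolding dyadic_sum_simps(2) by (rule powr_add_le) (use p in \<open>auto simp: dyadic_sum_nonneg\<close>)
      ultimately have "?s (Suc J) x powr p \<le> 2 powr p * (?s J x powr p + enn2real (dmean a J F x) powr p)"
        by linarith
      then show "ennreal (?s (Suc J) x powr p) \<le> ennreal (2 powr p) * (ennreal (?s J x powr p) + ennreal (enn2real (dmean a J F x) powr p))"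
        by (simp add: ennreal_leI flip: ennreal_mult' ennreal_plus)
    qed
    also have "\<dots> = ennreal (2 powr p) * (?N J + (\<integral>\<^sup>+x. ennreal (enn2real (dmean a J F x) powr p) \<partial>lborel))"
      by (simp add: nn_integral_cmult nn_integral_add)
    also have "\<dots> < \<infinity>" using Suc mean_fin[of J] by (simp add: ennreal_mult_less_top)
    finally show ?case .
  qed
  define \<delta> where "\<delta> = (q / (2 * (1 + 2 * B))) powr (1 / q)"
  have \<delta>0: "\<delta> > 0" using q B unfolding \<delta>_def by simp
  define \<kappa> where "\<kappa> = \<delta> powr q / q"
  have \<kappa>: "\<kappa> * (1 + 2 * B) = 1 / 2" "\<kappa> \<ge> 0"
  proof -
    have "\<delta> powr q = q / (2 * (1 + 2 * B))" using q B unfolding \<delta>_def by (simp add: powr_powr)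
    then show "\<kappa> * (1 + 2 * B) = 1 / 2" "\<kappa> \<ge> 0" using q B unfolding \<kappa>_def by (simp_all add: field_simps)
  qed
  define D1 where "D1 = (2 * L * p / \<delta>) powr p / p"
  define D2 where "D2 = (p / \<delta>) powr p / p"
  have D: "D1 \<ge> 0" "D2 \<ge> 0" using p unfolding D1_def D2_def by simp_all
  let ?w = "\<lambda>j. 1 / (1 + real j)\<^sup>2"
  let ?T = "\<lambda>j x. ?s (Suc j) x powr (p - 1)"
  have "?N J \<le> (\<integral>\<^sup>+x. (\<Sum>j<J. ennreal (p * ?w j) * (dmean a j F x * ennreal (?T j x))) \<partial>lborel)"
  proof (rule nn_integral_mono)
    fix x
    have "ennreal (?s J x powr p) \<le> ennreal (\<Sum>j<J. p * (?w j * enn2real (dmean a j F x)) * ?T j x)"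
      by (intro ennreal_leI dyadic_sum_powr_le p)
    also have "\<dots> = (\<Sum>j<J. ennreal (p * (?w j * enn2real (dmean a j F x)) * ?T j x))"
      using p by (intro sum_ennreal[symmetric]) auto
    also have "\<dots> \<le> (\<Sum>j<J. ennreal (p * ?w j) * (dmean a j F x * ennreal (?T j x)))"
    proof (rule sum_mono)
      fix j
      have "ennreal (p * (?w j * enn2real (dmean a j F x)) * ?T j x)
          = ennreal ((p * ?w j) * (enn2real (dmean a j F x) * ?T j x))" by (simp only: mult.assoc)
      also have "\<dots> = ennreal (p * ?w j) * (ennreal (enn2real (dmean a j F x)) * ennreal (?T j x))"
        using p by (simp only: ennreal_mult' ennreal_mult'' enn2real_nonneg powr_ge_zero mult_nonneg_nonneg)
      also have "\<dots> \<le> ennreal (p * ?w j) * (dmean a j F x * ennreal (?T j x))"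
        by (intro mult_left_mono mult_right_mono) (auto simp: ennreal_enn2real_if)
      finally show "ennreal (p * (?w j * enn2real (dmean a j F x)) * ?T j x)
        \<le> ennreal (p * ?w j) * (dmean a j F x * ennreal (?T j x))" .
    qed
    finally show "ennreal (?s J x powr p) \<le> (\<Sum>j<J. ennreal (p * ?w j) * (dmean a j F x * ennreal (?T j x)))" .
  qed
  also have "\<dots> = (\<Sum>j<J. ennreal (p * ?w j) * (\<integral>\<^sup>+x. dmean a j F x * ennreal (?T j x) \<partial>lborel))"
    by (subst nn_integral_sum) (simp_all add: nn_integral_cmult)
  \<comment> \<open>\<open>?T j\<close> is constant on cells of level j, so averaging of F is
    dropped. From here on f, G and the partial sums meet at the same point and the splitting is
    pointwise.\<close>
  also have "\<dots> = (\<Sum>j<J. ennreal (p * ?w j) * (\<integral>\<^sup>+x. F x * ennreal (?T j x) \<partial>lborel))"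
  proof (intro sum.cong refl arg_cong2[where f="(*)"] nn_integral_dmean_level)
    fix j
    show "level_const a j (\<lambda>x. ennreal (?T j x))"
      using level_const_dyadic_sum[of a j F] unfolding level_const_def by auto
  qed simp_all
  also have "\<dots> = (\<integral>\<^sup>+x. (\<Sum>j<J. ennreal (p * ?w j) * (F x * ennreal (?T j x))) \<partial>lborel)"
    by (subst nn_integral_sum) (simp_all add: nn_integral_cmult)
  also have "\<dots> \<le> (\<integral>\<^sup>+x. (ennreal D1 * ennreal (f x powr p) + ennreal \<kappa> * ennreal (?s J x powr p))
      + (\<Sum>j<J. ennreal (?w j) * (ennreal D2 * ennreal (f x powr p)
          + ennreal \<kappa> * (ennreal (H j x) * ennreal (?s (Suc j) x powr p)))) \<partial>lborel)"
  proof (rule nn_integral_mono)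
    fix x
    have "(\<Sum>j<J. ennreal (p * ?w j) * (F x * ennreal (?T j x))) = ennreal (\<Sum>j<J. p * (?w j * (f x * G x)) * ?T j x)"
      using p nonneg unfolding F_def
      by (simp add: sum_ennreal[symmetric] ennreal_mult'[symmetric] mult.assoc del: sum_ennreal)
    also have "\<dots> \<le> ennreal ((D1 * f x powr p + \<kappa> * ?s J x powr p)
       + (\<Sum>j<J. ?w j * (D2 * f x powr p + \<kappa> * (H j x * ?s (Suc j) x powr p))))"
      unfolding D1_def D2_def \<kappa>_def H_def q_def
      by (intro ennreal_leI weighted_sum_split p L \<delta>0 nonneg dyadic_sum_nonneg dyadic_sum_mono)
    also have "\<dots> = (ennreal D1 * ennreal (f x powr p) + ennreal \<kappa> * ennreal (?s J x powr p))
      + (\<Sum>j<J. ennreal (?w j) * (ennreal D2 * ennreal (f x powr p)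
          + ennreal \<kappa> * (ennreal (H j x) * ennreal (?s (Suc j) x powr p))))"
    proof -
      let ?t = "\<lambda>j. ?w j * (D2 * f x powr p + \<kappa> * (H j x * ?s (Suc j) x powr p))"
      have t0: "0 \<le> ?t j" for j
        using D \<kappa>(2) H0 by (intro mult_nonneg_nonneg add_nonneg_nonneg) simp_all
      have "ennreal ((D1 * f x powr p + \<kappa> * ?s J x powr p) + (\<Sum>j<J. ?t j))
          = ennreal (D1 * f x powr p + \<kappa> * ?s J x powr p) + (\<Sum>j<J. ennreal (?t j))"
        using t0 D \<kappa>(2) by (simp only: ennreal_plus sum_nonneg sum_ennreal add_nonneg_nonneg mult_nonneg_nonneg powr_ge_zero)
      also have "ennreal (D1 * f x powr p + \<kappa> * ?s J x powr p) = ennreal D1 * ennreal (f x powr p) + ennreal \<kappa> * ennreal (?s J x powr p)"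
        using D \<kappa>(2) by (simp only: ennreal_plus ennreal_mult' mult_nonneg_nonneg powr_ge_zero)
      also have "(\<Sum>j<J. ennreal (?t j)) = (\<Sum>j<J. ennreal (?w j) * (ennreal D2 * ennreal (f x powr p)
          + ennreal \<kappa> * (ennreal (H j x) * ennreal (?s (Suc j) x powr p))))"
        using D \<kappa>(2) H0 by (intro sum.cong refl ennreal_linear_combination) simp_all
      finally show ?thesis .
    qed
    finally show "(\<Sum>j<J. ennreal (p * ?w j) * (F x * ennreal (?T j x))) \<le>
      (ennreal D1 * ennreal (f x powr p) + ennreal \<kappa> * ennreal (?s J x powr p))
      + (\<Sum>j<J. ennreal (?w j) * (ennreal D2 * ennreal (f x powr p)
          + ennreal \<kappa> * (ennreal (H j x) * ennreal (?s (Suc j) x powr p))))" .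
  qed
  also have "\<dots> = (ennreal D1 * ?I + ennreal \<kappa> * ?N J)
      + (\<Sum>j<J. ennreal (?w j) * (ennreal D2 * ?I + ennreal \<kappa> * (\<integral>\<^sup>+x. ennreal (H j x) * ennreal (?s (Suc j) x powr p) \<partial>lborel)))"
    by (subst nn_integral_add, simp, simp, subst nn_integral_sum, simp)
       (simp add: nn_integral_add nn_integral_cmult)
  \<comment> \<open>The same exchange backwards: averaging is put onto \<open>H j\<close>, whose
    means over cells of level j are at most B by the moment hypothesis.\<close>
  also have "\<dots> \<le> (ennreal D1 * ?I + ennreal \<kappa> * ?N J)
      + (\<Sum>j<J. ennreal (?w j) * (ennreal D2 * ?I + ennreal \<kappa> * (ennreal B * ?N J)))"
  proof (intro add_mono order_refl sum_mono mult_left_mono)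
    fix j assume j: "j \<in> {..<J}"
    have "(\<integral>\<^sup>+x. ennreal (H j x) * ennreal (?s (Suc j) x powr p) \<partial>lborel)
      = (\<integral>\<^sup>+x. dmean a j (\<lambda>y. ennreal (H j y)) x * ennreal (?s (Suc j) x powr p) \<partial>lborel)"
    proof (rule nn_integral_dmean_level[symmetric])
      show "level_const a j (\<lambda>x. ennreal (?s (Suc j) x powr p))"
        using level_const_dyadic_sum[of a j F] unfolding level_const_def by auto
    qed simp_all
    also have "\<dots> \<le> (\<integral>\<^sup>+x. ennreal B * ennreal (?s J x powr p) \<partial>lborel)"
      using j p by (intro nn_integral_mono mult_mono mom ennreal_leI powr_mono2 dyadic_sum_mono dyadic_sum_nonneg) auto
    also have "\<dots> = ennreal B * ?N J" by (simp add: nn_integral_cmult)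
    finally show "(\<integral>\<^sup>+x. ennreal (H j x) * ennreal (?s (Suc j) x powr p) \<partial>lborel) \<le> ennreal B * ?N J" .
  qed simp_all
  also have "\<dots> = (ennreal D1 * ?I + ennreal \<kappa> * ?N J)
      + ennreal (\<Sum>j<J. ?w j) * (ennreal D2 * ?I + ennreal \<kappa> * (ennreal B * ?N J))"
    by (simp add: sum_distrib_right[symmetric])
  also have "\<dots> \<le> (ennreal D1 * ?I + ennreal \<kappa> * ?N J)
      + ennreal 2 * (ennreal D2 * ?I + ennreal \<kappa> * (ennreal B * ?N J))"
    by (intro add_left_mono mult_right_mono ennreal_leI inverse_square_sum) simp
  also have "\<dots> = (ennreal D1 + ennreal 2 * ennreal D2) * ?I + (ennreal \<kappa> + ennreal 2 * (ennreal \<kappa> * ennreal B)) * ?N J"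
    by (simp only: distrib_left distrib_right mult.assoc add_ac)
  also have "ennreal D1 + ennreal 2 * ennreal D2 = ennreal (D1 + 2 * D2)"
    using D by (subst ennreal_plus, simp, simp, subst ennreal_mult') simp_all
  also have "ennreal \<kappa> + ennreal 2 * (ennreal \<kappa> * ennreal B) = ennreal (1 / 2)"
  proof -
    have "ennreal \<kappa> + ennreal 2 * (ennreal \<kappa> * ennreal B) = ennreal (\<kappa> + 2 * (\<kappa> * B))"
      using \<kappa>(2) B by (subst ennreal_plus, simp, simp, subst ennreal_mult', simp, subst ennreal_mult') simp_all
    also have "\<kappa> + 2 * (\<kappa> * B) = 1 / 2" using \<kappa>(1) by (simp add: algebra_simps)
    finally show ?thesis .
  qed
  finally have "?N J \<le> ennreal (2 * (D1 + 2 * D2)) * ?I"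
    by (rule ennreal_absorb_half) (use N_fin fin D in simp_all)
  moreover have "2 * (D1 + 2 * D2) = dyadic_const p L B"
    unfolding dyadic_const_def Let_def D1_def D2_def \<delta>_def q_def ..
  ultimately show ?thesis unfolding F_def by simp
qed

text \<open>Monotone convergence for the p-th powers of the partial sums. Their supremum is
  integrable, hence finite almost everywhere, and there the series itself converges to a finite
  value.\<close>

lemma dyadic_series_bound:
  fixes f G :: "real ^ 'n::finite \<Rightarrow> real"
  assumes [measurable]: "f \<in> borel_measurable borel" "G \<in> borel_measurable borel"
    and p: "p > 1" and L: "L > 0" and B: "B \<ge> 0" and nonneg: "\<And>y. 0 \<le> f y" "\<And>y. 0 \<le> G y"
    and moment: "\<And>j x. dmean a j (\<lambda>y. ennreal (if real (Suc j) * L < G y then G y powr (p / (p - 1)) else 0)) x \<le> ennreal B"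
    and fin: "(\<integral>\<^sup>+x. ennreal (f x powr p) \<partial>lborel) < \<infinity>"
  defines "T \<equiv> \<lambda>x. \<Sum>j. ennreal (1 / (1 + real j)\<^sup>2) * dmean a j (\<lambda>y. ennreal (f y * G y)) x"
  shows "AE x in lborel. T x < \<infinity>"
    and "(\<integral>\<^sup>+x. ennreal (enn2real (T x) powr p) \<partial>lborel) \<le> ennreal (dyadic_const p L B) * (\<integral>\<^sup>+x. ennreal (f x powr p) \<partial>lborel)"
proof -
  define F where "F y = ennreal (f y * G y)" for y
  have [measurable]: "F \<in> borel_measurable borel" unfolding F_def[abs_def] by measurable
  have dfin: "dmean a j F x < \<infinity>" for j x
  proof -
    have "dmean a j F x \<le> ennreal ((2 ^ j) ^ CARD('n)) * (\<integral>\<^sup>+y. ennreal (f y powr p) \<partial>lborel) + ennreal ((real (Suc j) * L) powr (p / (p - 1)) + B + 1)"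
      unfolding F_def by (rule dmean_product_le) (use p L B nonneg moment in simp_all)
    also have "\<dots> < \<infinity>" using fin by (simp add: ennreal_mult_less_top)
    finally show ?thesis .
  qed
  have partial: "(\<Sum>j<J. ennreal (1 / (1 + real j)\<^sup>2) * dmean a j F x) = ennreal (dyadic_sum a F J x)" for J x
  proof -
    have "ennreal (dyadic_sum a F J x) = (\<Sum>j<J. ennreal (1 / (1 + real j)\<^sup>2 * enn2real (dmean a j F x)))"
      unfolding dyadic_sum_def by (rule sum_ennreal[symmetric]) simp
    also have "\<dots> = (\<Sum>j<J. ennreal (1 / (1 + real j)\<^sup>2) * dmean a j F x)"
    proof (intro sum.cong refl)
      fix j
      show "ennreal (1 / (1 + real j)\<^sup>2 * enn2real (dmean a j F x)) = ennreal (1 / (1 + real j)\<^sup>2) * dmean a j F x"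
        using dfin[of j x] by (subst ennreal_mult') (simp_all add: less_top)
    qed
    finally show ?thesis by simp
  qed
  have T: "(\<lambda>J. ennreal (dyadic_sum a F J x)) \<longlonglongrightarrow> T x" for x
  proof -
    have "(\<lambda>j. ennreal (1 / (1 + real j)\<^sup>2) * dmean a j F x) sums T x"
      unfolding T_def F_def by (rule summable_sums) simp
    then show ?thesis unfolding sums_def partial .
  qed
  have [measurable]: "T \<in> borel_measurable borel" unfolding T_def by measurable
  let ?S = "\<lambda>x. SUP J. ennreal (dyadic_sum a F J x powr p)"
  have mono: "incseq (\<lambda>J x. ennreal (dyadic_sum a F J x powr p))"
    using p by (intro incseq_SucI le_funI ennreal_leI powr_mono2 dyadic_sum_mono) (auto simp: dyadic_sum_nonneg)
  have "(\<integral>\<^sup>+x. ?S x \<partial>lborel) = (SUP J. \<integral>\<^sup>+x. ennreal (dyadic_sum a F J x powr p) \<partial>lborel)"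
    by (rule nn_integral_monotone_convergence_SUP[OF mono]) simp
  also have "\<dots> \<le> ennreal (dyadic_const p L B) * (\<integral>\<^sup>+x. ennreal (f x powr p) \<partial>lborel)"
    unfolding F_def by (intro SUP_least dyadic_sum_bound) (use p L B nonneg moment fin in simp_all)
  finally have S_int: "(\<integral>\<^sup>+x. ?S x \<partial>lborel) \<le> ennreal (dyadic_const p L B) * (\<integral>\<^sup>+x. ennreal (f x powr p) \<partial>lborel)" .
  also have "\<dots> < \<infinity>" using fin by (simp add: ennreal_mult_less_top)
  finally have S_fin: "AE x in lborel. ?S x \<noteq> \<infinity>"
    by (intro nn_integral_PInf_AE) simp_all
  have T_fin: "T x < \<infinity>" if "?S x \<noteq> \<infinity>" for x
  proof -
    define r where "r = enn2real (?S x)"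
    have r: "?S x = ennreal r" "r \<ge> 0"
      unfolding r_def using that by (simp_all only: ennreal_enn2real_if infinity_ennreal_def if_False enn2real_nonneg)
    have "dyadic_sum a F J x \<le> r powr (1 / p)" for J
    proof -
      have "ennreal (dyadic_sum a F J x powr p) \<le> ennreal r"
        unfolding r(1)[symmetric] by (rule SUP_upper) simp
      then have "dyadic_sum a F J x powr p \<le> r" using r(2) by simp
      then have "(dyadic_sum a F J x powr p) powr (1 / p) \<le> r powr (1 / p)" using p by (intro powr_mono2) auto
      then show ?thesis using p dyadic_sum_nonneg[of a F J x] by (simp add: powr_powr)
    qed
    then have "T x \<le> ennreal (r powr (1 / p))"
      by (intro LIMSEQ_le_const2[OF T]) (auto intro: ennreal_leI)
    then show ?thesis by (simp add: le_less_trans)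
  qed
  show "AE x in lborel. T x < \<infinity>" using S_fin by eventually_elim (rule T_fin)
  have "(\<integral>\<^sup>+x. ennreal (enn2real (T x) powr p) \<partial>lborel) \<le> (\<integral>\<^sup>+x. ?S x \<partial>lborel)"
  proof (rule nn_integral_mono_AE)
    show "AE x in lborel. ennreal (enn2real (T x) powr p) \<le> ?S x"
      using S_fin
    proof eventually_elim
      fix x assume "?S x \<noteq> \<infinity>"
      then have "T x < \<infinity>" by (rule T_fin)
      then have "T x < top" by simp
      have "(\<lambda>J. ennreal (dyadic_sum a F J x)) \<longlonglongrightarrow> ennreal (enn2real (T x))"
        unfolding ennreal_enn2real[OF \<open>T x < top\<close>] by (rule T)
      then have "(\<lambda>J. enn2real (ennreal (dyadic_sum a F J x))) \<longlonglongrightarrow> enn2real (T x)"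
        by (rule tendsto_enn2real) simp
      then have "(\<lambda>J. dyadic_sum a F J x) \<longlonglongrightarrow> enn2real (T x)" by (simp add: dyadic_sum_nonneg)
      then have "(\<lambda>J. ennreal (dyadic_sum a F J x powr p)) \<longlonglongrightarrow> ennreal (enn2real (T x) powr p)"
        using p by (intro tendsto_ennrealI tendsto_powr') (auto simp: dyadic_sum_nonneg)
      then show "ennreal (enn2real (T x) powr p) \<le> ?S x"
        by (rule LIMSEQ_le_const2) (auto intro!: exI[of _ 0] SUP_upper)
    qed
  qed
  also note S_int
  finally show "(\<integral>\<^sup>+x. ennreal (enn2real (T x) powr p) \<partial>lborel) \<le> ennreal (dyadic_const p L B) * (\<integral>\<^sup>+x. ennreal (f x powr p) \<partial>lborel)" .
qed

section \<open>The tail of the kernel\<close>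

lemma nn_integral_decay_translate:
  fixes x :: "real ^ 'n::finite"
  shows "(\<integral>\<^sup>+y. ennreal (decay (y - x)) \<partial>lborel) = (\<integral>\<^sup>+y. ennreal (decay (y :: real ^ 'n)) \<partial>lborel)"
  using nn_integral_lborel_affine[of "\<lambda>y. ennreal (decay (y :: real^'n))" 1 "- x"] by (simp add: algebra_simps)

lemma decay_minus_commute: "decay (x - y) = decay (y - x)"
  by (simp add: decay_def norm_minus_commute)

text \<open>The factors are, in turn, the distortion of \<open>decay\<close> across a unit cell, the
  L^1 norm of \<open>decay\<close> as in Young's convolution inequality, and the Hoelder factor of
  \<open>nn_integral_dmean_powr\<close> at level 0.\<close>

definition tail_const :: "'n::finite itself \<Rightarrow> real \<Rightarrow> real \<Rightarrow> real \<Rightarrow> real" where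
  "tail_const _ p L B = ((1 + real CARD('n)) ^ (CARD('n) + 1)) powr p
     * ((LINT y|lborel. decay (y :: real ^ 'n)) powr p * (L powr (p / (p - 1)) + B + 1) powr (p - 1))"

text \<open>On unit cells the tail of the kernel is essentially constant, so \<open>f G\<close> may be replaced by its
  means over unit cells.\<close>

lemma tail_bound:
  fixes f G :: "real ^ 'n::finite \<Rightarrow> real"
  assumes [measurable]: "f \<in> borel_measurable borel" "G \<in> borel_measurable borel"
    and p: "p > 1" and L: "L > 0" and B: "B \<ge> 0" and nonneg: "\<And>y. 0 \<le> f y" "\<And>y. 0 \<le> G y"
    and moment: "\<And>j x. dmean a j (\<lambda>y. ennreal (if real (Suc j) * L < G y then G y powr (p / (p - 1)) else 0)) x \<le> ennreal B"
    and fin: "(\<integral>\<^sup>+x. ennreal (f x powr p) \<partial>lborel) < \<infinity>"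
  defines "Y \<equiv> \<lambda>x. \<integral>\<^sup>+y. ennreal (decay (y - x)) * ennreal (f y * G y) \<partial>lborel"
  shows "Y x < \<infinity>"
    and "(\<integral>\<^sup>+x. ennreal (enn2real (Y x) powr p) \<partial>lborel)
      \<le> ennreal (tail_const TYPE('n) p L B) * (\<integral>\<^sup>+x. ennreal (f x powr p) \<partial>lborel)"
proof -
  let ?c = "(1 + real CARD('n)) ^ (CARD('n) + 1)"
  define K where "K = L powr (p / (p - 1)) + B + 1"
  let ?I = "\<integral>\<^sup>+x. ennreal (f x powr p) \<partial>lborel"
  define F where "F y = ennreal (f y * G y)" for y
  have [measurable]: "F \<in> borel_measurable borel" unfolding F_def[abs_def] by measurable
  define D where "D = (LINT y|lborel. decay (y :: real^'n))"
  have D: "(\<integral>\<^sup>+y. ennreal (decay (y :: real^'n)) \<partial>lborel) = ennreal D"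
    unfolding D_def by (rule nn_integral_eq_integral[OF integrable_decay]) (simp add: less_imp_le decay_pos)
  have D0: "D > 0"
  proof -
    have "D \<ge> 0" unfolding D_def by (rule integral_nonneg_AE) (simp add: less_imp_le decay_pos)
    moreover have "D \<noteq> 0"
    proof
      assume "D = 0"
      then have "AE y in lborel. decay (y :: real^'n) = 0"
        unfolding D_def using integral_nonneg_eq_0_iff_AE[OF integrable_decay[where 'n='n]]
        by (simp add: less_imp_le decay_pos)
      moreover have "decay y \<noteq> 0" for y :: "real^'n" using decay_pos[of y] by simp
      ultimately have "AE y in (lborel :: (real^'n) measure). False" by simp
      then show False by (simp add: ae_filter_eq_bot_iff)
    qed
    ultimately show ?thesis by simp
  qed
  define E where "E y = enn2real (dmean a 0 F y)" for y
  have [measurable]: "E \<in> borel_measurable borel" unfolding E_def[abs_def] by measurable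
  have d_le: "dmean a 0 F y \<le> ?I + ennreal K" for y
    using dmean_product_le[where a=a and j=0 and f=f and G=G and p=p and L=L and B=B and x=y] p L B nonneg moment
    unfolding F_def K_def by simp
  have dE: "dmean a 0 F y = ennreal (E y)" for y
  proof -
    have "dmean a 0 F y < \<infinity>" by (rule le_less_trans[OF d_le]) (use fin in simp)
    then show ?thesis unfolding E_def by (simp add: ennreal_enn2real_if)
  qed
  have Y_le: "Y x \<le> ennreal ?c * (\<integral>\<^sup>+y. ennreal (E y) * ennreal (decay (y - x)) \<partial>lborel)" for x
  proof -
    have "ennreal (decay (y - x)) \<le> ennreal ?c * dmean a 0 (\<lambda>y. ennreal (decay (y - x))) y" for y
    proof -
      have "ennreal (decay (y - x)) = ennreal (decay (y - x)) * (ennreal ((2 ^ 0) ^ CARD('n)) * emeasure lborel (dcell a 0 y))"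
        unfolding dcell_normalized by simp
      also have "\<dots> = (\<integral>\<^sup>+z. ennreal (decay (y - x)) * indicator (dcell a 0 y) z \<partial>lborel)"
        by (simp add: nn_integral_cmult)
      also have "\<dots> \<le> (\<integral>\<^sup>+z. ennreal ?c * (indicator (dcell a 0 y) z * ennreal (decay (z - x))) \<partial>lborel)"
      proof (rule nn_integral_mono)
        fix z
        show "ennreal (decay (y - x)) * indicator (dcell a 0 y) z \<le> ennreal ?c * (indicator (dcell a 0 y) z * ennreal (decay (z - x)))"
        proof (cases "z \<in> dcell a 0 y")
          case True
          have "norm (y - z) \<le> real CARD('n)"
            using dcell_dist[OF True] by (simp add: norm_minus_commute)
          then have "decay ((z - x) + (y - z)) \<le> ?c * decay (z - x)" by (rule decay_shift) simp
          moreover have "(z - x) + (y - z) = y - x" by simp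
          ultimately have "decay (y - x) \<le> ?c * decay (z - x)" by (simp only:)
          then have "ennreal (decay (y - x)) \<le> ennreal (?c * decay (z - x))" by (rule ennreal_leI)
          also have "\<dots> = ennreal ?c * ennreal (decay (z - x))"
            by (rule ennreal_mult'') (simp add: less_imp_le decay_pos)
          finally show ?thesis using True by simp
        qed simp
      qed
      also have "\<dots> = ennreal ?c * dmean a 0 (\<lambda>y. ennreal (decay (y - x))) y"
        unfolding dmean_def by (subst nn_integral_cmult) simp_all
      finally show ?thesis .
    qed
    then have "ennreal (decay (y - x)) * F y \<le> (ennreal ?c * dmean a 0 (\<lambda>y. ennreal (decay (y - x))) y) * F y" for y
      by (intro mult_right_mono) simp_all
    then have "Y x \<le> (\<integral>\<^sup>+y. ennreal ?c * (F y * dmean a 0 (\<lambda>y. ennreal (decay (y - x))) y) \<partial>lborel)"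
      unfolding Y_def F_def
      by (intro nn_integral_mono) (simp only: mult_ac)
    also have "\<dots> = ennreal ?c * (\<integral>\<^sup>+y. dmean a 0 F y * ennreal (decay (y - x)) \<partial>lborel)"
      by (simp add: nn_integral_cmult dmean_selfadjoint)
    finally show ?thesis unfolding dE .
  qed
  \<comment> \<open>A measure of total mass D for every x; Hoelder's inequality against the constant
    1 then gives the p-th power of the convolution, as in Young's convolution inequality.\<close>
  let ?M = "\<lambda>x. density lborel (\<lambda>y. ennreal (decay (y - x)))"
  have M: "(\<integral>\<^sup>+y. ennreal (u y) \<partial>?M x) = (\<integral>\<^sup>+y. ennreal (u y) * ennreal (decay (y - x)) \<partial>lborel)"
    if [measurable]: "u \<in> borel_measurable borel" for u :: "real^'n \<Rightarrow> real" and x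
    by (simp add: nn_integral_density mult.commute)
  have E_fin: "(\<integral>\<^sup>+y. ennreal (E y) * ennreal (decay (y - x)) \<partial>lborel) < \<infinity>" for x
  proof -
    have "(\<integral>\<^sup>+y. ennreal (E y) * ennreal (decay (y - x)) \<partial>lborel) \<le> (\<integral>\<^sup>+y. (?I + ennreal K) * ennreal (decay (y - x)) \<partial>lborel)"
      using d_le unfolding dE by (intro nn_integral_mono mult_right_mono) simp_all
    also have "\<dots> = (?I + ennreal K) * ennreal D" by (simp add: nn_integral_cmult nn_integral_decay_translate D)
    also have "\<dots> < \<infinity>" using fin by (simp add: ennreal_mult_less_top)
    finally show ?thesis .
  qed
  show "Y x < \<infinity>"
    using Y_le[of x] E_fin[of x] by (auto simp: ennreal_mult_less_top intro: le_less_trans)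
  have ptw: "ennreal (enn2real (Y x) powr p)
      \<le> ennreal (?c powr p * D powr (p - 1)) * (\<integral>\<^sup>+y. ennreal (E y powr p) * ennreal (decay (y - x)) \<partial>lborel)" for x
  proof -
    have "ennreal (enn2real (\<integral>\<^sup>+y. ennreal (E y * 1) \<partial>?M x) powr p) \<le> ennreal (D powr (p - 1)) * (\<integral>\<^sup>+y. ennreal (E y powr p) \<partial>?M x)"
    proof (rule nn_integral_Holder_powr)
      show "(\<integral>\<^sup>+y. ennreal (1 powr (p / (p - 1))) \<partial>?M x) \<le> ennreal D"
        by (subst M) (simp_all add: nn_integral_decay_translate D)
    qed (use p D0 in \<open>simp_all add: E_def\<close>)
    then have H: "ennreal (enn2real (\<integral>\<^sup>+y. ennreal (E y) * ennreal (decay (y - x)) \<partial>lborel) powr p)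
        \<le> ennreal (D powr (p - 1)) * (\<integral>\<^sup>+y. ennreal (E y powr p) * ennreal (decay (y - x)) \<partial>lborel)"
      by (simp add: M)
    have "enn2real (Y x) \<le> enn2real (ennreal ?c * (\<integral>\<^sup>+y. ennreal (E y) * ennreal (decay (y - x)) \<partial>lborel))"
      using E_fin[of x] by (intro enn2real_mono Y_le) (simp add: ennreal_mult_less_top)
    also have "\<dots> = ?c * enn2real (\<integral>\<^sup>+y. ennreal (E y) * ennreal (decay (y - x)) \<partial>lborel)"
      unfolding enn2real_mult by simp
    finally have "enn2real (Y x) powr p \<le> (?c * enn2real (\<integral>\<^sup>+y. ennreal (E y) * ennreal (decay (y - x)) \<partial>lborel)) powr p"
      using p by (intro powr_mono2) auto
    also have "\<dots> = ?c powr p * enn2real (\<integral>\<^sup>+y. ennreal (E y) * ennreal (decay (y - x)) \<partial>lborel) powr p"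
      by (rule powr_mult)
    finally have "ennreal (enn2real (Y x) powr p) \<le> ennreal (?c powr p) * ennreal (enn2real (\<integral>\<^sup>+y. ennreal (E y) * ennreal (decay (y - x)) \<partial>lborel) powr p)"
      by (subst ennreal_mult'[symmetric]) (auto intro: ennreal_leI)
    also have "\<dots> \<le> ennreal (?c powr p) * (ennreal (D powr (p - 1)) * (\<integral>\<^sup>+y. ennreal (E y powr p) * ennreal (decay (y - x)) \<partial>lborel))"
      by (intro mult_left_mono H) simp
    also have "\<dots> = ennreal (?c powr p * D powr (p - 1)) * (\<integral>\<^sup>+y. ennreal (E y powr p) * ennreal (decay (y - x)) \<partial>lborel)"
      by (subst ennreal_mult') (simp_all only: mult.assoc powr_ge_zero)
    finally show ?thesis .
  qed
  have "(\<integral>\<^sup>+x. ennreal (enn2real (Y x) powr p) \<partial>lborel)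
      \<le> (\<integral>\<^sup>+x. ennreal (?c powr p * D powr (p - 1)) * (\<integral>\<^sup>+y. ennreal (E y powr p) * ennreal (decay (y - x)) \<partial>lborel) \<partial>lborel)"
    by (intro nn_integral_mono ptw)
  also have "\<dots> = ennreal (?c powr p * D powr (p - 1)) * (\<integral>\<^sup>+x. \<integral>\<^sup>+y. ennreal (E y powr p) * ennreal (decay (y - x)) \<partial>lborel \<partial>lborel)"
    by (rule nn_integral_cmult) measurable
  also have "(\<integral>\<^sup>+x. \<integral>\<^sup>+y. ennreal (E y powr p) * ennreal (decay (y - x)) \<partial>lborel \<partial>lborel)
      = (\<integral>\<^sup>+y. \<integral>\<^sup>+x. ennreal (E y powr p) * ennreal (decay (y - x)) \<partial>lborel \<partial>lborel)"
    by (rule lborel_pair.Fubini') measurable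
  also have "\<dots> = (\<integral>\<^sup>+y. ennreal (E y powr p) * ennreal D \<partial>lborel)"
    by (subst decay_minus_commute) (simp add: nn_integral_cmult nn_integral_decay_translate D)
  also have "\<dots> = ennreal D * (\<integral>\<^sup>+y. ennreal (E y powr p) \<partial>lborel)"
    by (subst nn_integral_multc) (simp_all add: mult.commute)
  also have "(\<integral>\<^sup>+y. ennreal (E y powr p) \<partial>lborel) \<le> ennreal (K powr (p - 1)) * ?I"
    using nn_integral_dmean_powr[where a=a and j=0 and f=f and G=G and p=p and L=L and B=B] p L B nonneg moment
    unfolding E_def F_def K_def by simp
  finally have "(\<integral>\<^sup>+x. ennreal (enn2real (Y x) powr p) \<partial>lborel)
      \<le> ennreal (?c powr p * D powr (p - 1)) * (ennreal D * (ennreal (K powr (p - 1)) * ?I))"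
    by (simp add: mult_left_mono)
  also have "\<dots> = ennreal (?c powr p * D powr (p - 1) * (D * K powr (p - 1))) * ?I"
    using D0 by (simp add: ennreal_mult' mult.assoc less_imp_le)
  also have "?c powr p * D powr (p - 1) * (D * K powr (p - 1)) = tail_const TYPE('n) p L B"
  proof -
    have "D powr (p - 1) * D = D powr p" using D0 powr_add[of D "p - 1" 1] by simp
    then show ?thesis unfolding tail_const_def D_def[symmetric] K_def[symmetric] by (simp only: mult.assoc[symmetric]) (simp only: mult.assoc)
  qed
  finally show "(\<integral>\<^sup>+x. ennreal (enn2real (Y x) powr p) \<partial>lborel)
      \<le> ennreal (tail_const TYPE('n) p L B) * (\<integral>\<^sup>+x. ennreal (f x powr p) \<partial>lborel)" .
qed

lemma sum_powr_le:
  fixes s :: "'a \<Rightarrow> real"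
  assumes "p > 0" "finite A" "\<And>i. i \<in> A \<Longrightarrow> 0 \<le> s i"
  shows "(\<Sum>i\<in>A. s i) powr p \<le> (2 powr p) ^ card A * (\<Sum>i\<in>A. s i powr p)"
  using assms(2,3)
proof (induction A rule: finite_induct)
  case (insert i A)
  have one: "1 \<le> (2 powr p) ^ card A" using assms(1) by (intro one_le_power ge_one_powr_ge_zero) auto
  have "(s i + (\<Sum>i\<in>A. s i)) powr p \<le> 2 powr p * (s i powr p + (\<Sum>i\<in>A. s i) powr p)"
    using insert.prems assms(1) by (intro powr_add_le sum_nonneg) auto
  also have "\<dots> \<le> 2 powr p * ((2 powr p) ^ card A * s i powr p + (2 powr p) ^ card A * (\<Sum>i\<in>A. s i powr p))"
    using insert one mult_right_mono[OF one, of "s i powr p"] by (intro mult_left_mono add_mono) auto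
  also have "\<dots> = (2 powr p) ^ card (insert i A) * (\<Sum>i\<in>insert i A. s i powr p)"
    using insert.hyps by (simp add: distrib_left)
  finally show ?case using insert.hyps by simp
qed (use assms(1) in simp)

section \<open>From dyadic grids to the convolution kernel\<close>

text \<open>One grid for each set of coordinates, shifted by 1/3 in exactly these: 2^n grids in
  all.\<close>

definition third_shift :: "'n::finite set \<Rightarrow> real ^ 'n" where
  "third_shift \<alpha> = (\<chi> i. if i \<in> \<alpha> then 1/3 else 0)"

text \<open>\<open>2^j / 3\<close> is at distance \<open>1/3\<close> from the integers, so a short interval cannot contain endpoints
  of cells of both grids.\<close>

lemma one_third_trick_real:
  fixes s t :: real
  assumes "\<bar>s - t\<bar> < 1 / (3 * 2 ^ j)" "\<lfloor>2 ^ j * s\<rfloor> \<noteq> \<lfloor>2 ^ j * t\<rfloor>"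
  shows "\<lfloor>2 ^ j * (s - 1/3)\<rfloor> = \<lfloor>2 ^ j * (t - 1/3)\<rfloor>"
proof -
  define u v where "u = 2 ^ j * s" and "v = 2 ^ j * t"
  have "2 ^ j * \<bar>s - t\<bar> < 2 ^ j * (1 / (3 * 2 ^ j))" using assms(1) by (intro mult_strict_left_mono) auto
  then have uv: "\<bar>u - v\<bar> < 1/3" by (simp add: u_def v_def abs_mult flip: right_diff_distrib)
  have "\<lfloor>u\<rfloor> \<noteq> \<lfloor>v\<rfloor>" using assms(2) by (simp add: u_def v_def)
  then have "(u < \<lfloor>v\<rfloor> \<and> \<lfloor>v\<rfloor> \<le> v) \<or> (v < \<lfloor>u\<rfloor> \<and> \<lfloor>u\<rfloor> \<le> u)"
    using of_int_floor_le[of u] of_int_floor_le[of v] floor_less_iff[of u "\<lfloor>v\<rfloor>"] floor_less_iff[of v "\<lfloor>u\<rfloor>"]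
    by linarith
  then obtain m :: int where m: "(u < m \<and> m \<le> v) \<or> (v < m \<and> m \<le> u)" by blast
  have "(2::nat) ^ j mod 3 = 1 \<or> (2::nat) ^ j mod 3 = 2"
  proof (induction j)
    case (Suc j)
    have "(2::nat) ^ Suc j mod 3 = 2 * (2 ^ j mod 3) mod 3" by (simp add: mod_mult_right_eq)
    then show ?case using Suc by auto
  qed simp
  then have "(2::nat) ^ j = 3 * (2 ^ j div 3) + 1 \<or> (2::nat) ^ j = 3 * (2 ^ j div 3) + 2" by presburger
  then obtain k :: nat where "(2::nat) ^ j = 3 * k + 1 \<or> (2::nat) ^ j = 3 * k + 2" by blast
  then have "real (2 ^ j) = real (3 * k + 1) \<or> real (2 ^ j) = real (3 * k + 2)" by metis
  then have k: "(2::real) ^ j * (1/3) = real k + 1/3 \<or> (2::real) ^ j * (1/3) = real k + 2/3" by auto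
  define w where "w = (2::real) ^ j * (1/3)"
  have kw: "w = real k + 1/3 \<or> w = real k + 2/3" using k unfolding w_def .
  have uv': "u - v < 1/3" "v - u < 1/3" using uv by linarith+
  have c: "real_of_int (m - int k - 1) = real_of_int m - real k - 1" by simp
  \<comment> \<open>Both u and v are within 1/3 of the integer m, and w exceeds k by 1/3 or 2/3; so
    u - w and v - w lie between the same consecutive integers m - k - 1 and m - k.\<close>
  have "\<lfloor>u - w\<rfloor> = m - int k - 1"
    by (rule floor_unique; unfold c; insert m kw uv'; elim disjE conjE; linarith)
  moreover have "\<lfloor>v - w\<rfloor> = m - int k - 1"
    by (rule floor_unique; unfold c; insert m kw uv'; elim disjE conjE; linarith)
  ultimately have "\<lfloor>u - 2 ^ j * (1/3)\<rfloor> = \<lfloor>v - 2 ^ j * (1/3)\<rfloor>" unfolding w_def by simp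
  then show ?thesis by (simp add: u_def v_def right_diff_distrib)
qed

text \<open>The witness collects the coordinates in which the unshifted grid separates x and y; in
  these coordinates the shifted grid does not.\<close>

lemma one_third_trick:
  fixes x y :: "real ^ 'n::finite"
  assumes "\<And>i. \<bar>(y - x) $ i\<bar> < 1 / (3 * 2 ^ j)"
  shows "\<exists>\<alpha>. y \<in> dcell (third_shift \<alpha>) j x"
proof
  show "y \<in> dcell (third_shift {i. \<lfloor>2 ^ j * (y $ i)\<rfloor> \<noteq> \<lfloor>2 ^ j * (x $ i)\<rfloor>}) j x"
    using one_third_trick_real assms by (auto simp: dcell_def third_shift_def)
qed

definition model_kernel :: "nat \<Rightarrow> real ^ 'n::finite \<Rightarrow> real" where
  "model_kernel j z = 1 / (1 + real j)\<^sup>2 * ((2 ^ j) ^ CARD('n) * decay (2 ^ j *\<^sub>R z))"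

lemma model_kernel_measurable [measurable]: "model_kernel j \<in> borel_measurable borel"
  unfolding model_kernel_def[abs_def] by measurable

text \<open>The integral kernel of the averaging operator of level j with its weight
  \<open>(1 + j)^-2\<close>.\<close>

definition cell_kernel :: "real ^ 'n::finite \<Rightarrow> nat \<Rightarrow> real ^ 'n \<Rightarrow> real ^ 'n \<Rightarrow> ennreal" where
  "cell_kernel a j x y = ennreal (1 / (1 + real j)\<^sup>2 * (2 ^ j) ^ CARD('n)) * indicator (dcell a j x) y"

text \<open>Let I be the first level at which some coordinate of y - x reaches a third of the side
  of a cell. Before I, x and y share a cell in one of the shifted grids, which dominates the term.
  From I on the terms form a geometric series of the size of its first one; the cell kernel of level
  I - 1 dominates it, or \<open>decay\<close> if I = 0.\<close>

lemma model_kernel_domination: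
  fixes x y :: "real ^ 'n::finite"
  assumes "x \<noteq> y"
  shows "(\<Sum>j. ennreal (model_kernel j (y - x))) \<le>
    ennreal (1 + 2 * 6 ^ (CARD('n) + 1)) * ((\<Sum>\<alpha>\<in>UNIV. \<Sum>j. cell_kernel (third_shift \<alpha>) j x y) + ennreal (decay (y - x)))"
proof -
  define z where "z = y - x"
  have z: "z \<noteq> 0" using assms by (simp add: z_def)
  let ?m = "CARD('n) + 1"
  let ?w = "\<lambda>j. 1 / (1 + real j)\<^sup>2"
  let ?T = "\<Sum>\<alpha>\<in>UNIV. \<Sum>j. cell_kernel (third_shift \<alpha>) j x y"
  define near where "near j \<longleftrightarrow> (\<forall>i. \<bar>z $ i\<bar> < 1 / (3 * 2 ^ j))" for j :: nat
  have "\<exists>j. \<not> near j"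
  proof -
    obtain i where i: "z $ i \<noteq> 0" using z by (auto simp: vec_eq_iff)
    obtain j where "1 / \<bar>z $ i\<bar> < 2 ^ j" using real_arch_pow[of 2 "1 / \<bar>z $ i\<bar>"] by auto
    then have "1 < 2 ^ j * \<bar>z $ i\<bar>" using i by (simp add: divide_less_eq)
    then have "1 < (3 * 2 ^ j) * \<bar>z $ i\<bar>" by simp
    then have "\<not> near j" unfolding near_def
      by (auto simp: not_less intro!: exI[of _ i]) (simp add: divide_le_eq mult.commute less_imp_le)
    then show ?thesis ..
  qed
  define I where "I = (LEAST j. \<not> near j)"
  have I: "\<not> near I" unfolding I_def using \<open>\<exists>j. \<not> near j\<close> by (rule LeastI_ex)
  have less_I: "near j" if "j < I" for j using not_less_Least[of j "\<lambda>j. \<not> near j"] that unfolding I_def by blast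
  have nz: "1 / (3 * 2 ^ I) \<le> norm z"
  proof -
    obtain i where "1 / (3 * 2 ^ I) \<le> \<bar>z $ i\<bar>" using I unfolding near_def by (auto simp: not_less)
    then show ?thesis using component_le_norm_cart[of z i] by linarith
  qed
  have near_cell: "ennreal (?w j * (2 ^ j) ^ CARD('n)) \<le> (\<Sum>\<alpha>\<in>UNIV. cell_kernel (third_shift \<alpha>) j x y)" if nj: "near j" for j
  proof -
    obtain \<alpha> where "y \<in> dcell (third_shift \<alpha>) j x"
      using one_third_trick[of y x j] nj unfolding near_def z_def by blast
    then have "ennreal (?w j * (2 ^ j) ^ CARD('n)) = cell_kernel (third_shift \<alpha>) j x y" by (simp add: cell_kernel_def)
    also have "\<dots> \<le> (\<Sum>\<alpha>\<in>UNIV. cell_kernel (third_shift \<alpha>) j x y)" by (rule member_le_sum) auto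
    finally show ?thesis .
  qed
  have T_eq: "?T = (\<Sum>j. \<Sum>\<alpha>\<in>UNIV. cell_kernel (third_shift \<alpha>) j x y)"
    by (rule suminf_sum[symmetric]) simp
  define R where "R = ?w I * (1 / norm z ^ ?m)"
  have R0: "R \<ge> 0" unfolding R_def by simp
  have term_le: "ennreal (model_kernel j z) \<le> (\<Sum>\<alpha>\<in>UNIV. cell_kernel (third_shift \<alpha>) j x y) + ennreal (R * (if I \<le> j then 1 / 2 ^ j else 0))" for j
  proof (cases "j < I")
    case True
    have "model_kernel j z \<le> ?w j * ((2 ^ j) ^ CARD('n) * 1)"
      unfolding model_kernel_def by (intro mult_left_mono decay_le_1) auto
    then have "ennreal (model_kernel j z) \<le> ennreal (?w j * (2 ^ j) ^ CARD('n))" by (intro ennreal_leI) simp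
    also have "\<dots> \<le> (\<Sum>\<alpha>\<in>UNIV. cell_kernel (third_shift \<alpha>) j x y)" by (rule near_cell[OF less_I[OF True]])
    finally show ?thesis by (rule order_trans) simp
  next
    case False
    have "model_kernel j z \<le> ?w I * (1 / norm z ^ ?m * (1 / 2 ^ j))"
      unfolding model_kernel_def
    proof (rule mult_mono[OF _ dilated_decay_bound[OF z]])
      show "?w j \<le> ?w I" using False by (intro divide_left_mono power_mono) auto
      show "0 \<le> (2 ^ j) ^ CARD('n) * decay (2 ^ j *\<^sub>R z)" by (intro mult_nonneg_nonneg less_imp_le[OF decay_pos]) simp
    qed simp
    then have "model_kernel j z \<le> R * (if I \<le> j then 1 / 2 ^ j else 0)" using False unfolding R_def by simp
    then show ?thesis by (simp add: add_increasing ennreal_leI)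
  qed
  have "(\<Sum>j. ennreal (model_kernel j z)) \<le> (\<Sum>j. (\<Sum>\<alpha>\<in>UNIV. cell_kernel (third_shift \<alpha>) j x y) + ennreal (R * (if I \<le> j then 1 / 2 ^ j else 0)))"
    by (intro suminf_le term_le) simp_all
  also have "\<dots> = ?T + (\<Sum>j. ennreal (R * (if I \<le> j then 1 / 2 ^ j else 0)))"
    unfolding T_eq by (rule suminf_add[symmetric]) simp_all
  also have "(\<Sum>j. ennreal (R * (if I \<le> j then 1 / 2 ^ j else 0))) = ennreal (R * (2 / 2 ^ I))"
  proof -
    have "(\<lambda>j. (1/2::real) ^ j) sums 2" using geometric_sums[of "1/2::real"] by simp
    then have "(\<lambda>j. (1 / 2 ^ I) * (1/2::real) ^ j) sums ((1 / 2 ^ I) * 2)" by (rule sums_mult)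
    then have "(\<lambda>j. if I \<le> j + I then 1 / 2 ^ (j + I) else 0 :: real) sums (2 / 2 ^ I)"
      by (simp add: power_add power_one_over mult.commute)
    then have "(\<lambda>j. if I \<le> j then 1 / 2 ^ j else 0 :: real) sums (2 / 2 ^ I + (\<Sum>j<I. if I \<le> j then 1 / 2 ^ j else 0))"
      by (subst (asm) sums_iff_shift)
    then have "(\<lambda>j. R * (if I \<le> j then 1 / 2 ^ j else 0)) sums (R * (2 / 2 ^ I))"
      by (intro sums_mult) simp
    then show ?thesis by (subst suminf_ennreal_eq) (use R0 in auto)
  qed
  also have "ennreal (R * (2 / 2 ^ I)) \<le> ennreal (2 * 6 ^ ?m) * (?T + ennreal (decay z))"
  proof (cases I)
    case 0
    \<comment> \<open>There is no earlier level to refer to, but |z| >= 1/3 makes |z|^-(n+1)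
      comparable to \<open>decay z\<close>.\<close>
    have nz3: "1 / 3 \<le> norm z" using nz 0 by simp
    have "(1 + norm z) ^ ?m \<le> (4 * norm z) ^ ?m" using nz3 by (intro power_mono) auto
    also have "\<dots> \<le> (6 * norm z) ^ ?m" by (intro power_mono) auto
    finally have "(1 + norm z) ^ ?m \<le> 6 ^ ?m * norm z ^ ?m" by (simp only: power_mult_distrib)
    then have "1 / norm z ^ ?m \<le> 6 ^ ?m * decay z"
      unfolding decay_def using z by (simp add: divide_simps add_pos_nonneg mult.commute)
    then have "R * (2 / 2 ^ I) \<le> (2 * 6 ^ ?m) * decay z" unfolding R_def 0 by simp
    then have "ennreal (R * (2 / 2 ^ I)) \<le> ennreal ((2 * 6 ^ ?m) * decay z)" by (rule ennreal_leI)
    also have "\<dots> = ennreal (2 * 6 ^ ?m) * ennreal (decay z)" by (rule ennreal_mult') simp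
    also have "\<dots> \<le> ennreal (2 * 6 ^ ?m) * (?T + ennreal (decay z))" by (intro mult_left_mono) simp_all
    finally show ?thesis .
  next
    case (Suc i)
    \<comment> \<open>At i = I - 1 the points still share a cell, and
      \<open>3 * 2^I = 6 * 2^i\<close>; this is where the 6 in the constant comes from.\<close>
    have "1 / norm z ^ ?m \<le> (3 * 2 ^ I) ^ ?m"
    proof -
      have "1 / norm z \<le> 3 * 2 ^ I" using nz z by (simp add: divide_le_eq mult.commute)
      then have "(1 / norm z) ^ ?m \<le> (3 * 2 ^ I) ^ ?m" by (intro power_mono) auto
      then show ?thesis by (simp add: power_one_over)
    qed
    moreover have "?w I \<le> ?w i" unfolding Suc by (intro divide_left_mono power_mono) auto
    ultimately have "R \<le> ?w i * (3 * 2 ^ I) ^ ?m" unfolding R_def by (intro mult_mono) auto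
    then have "R * (2 / 2 ^ I) \<le> (?w i * (3 * 2 ^ I) ^ ?m) * (2 / 2 ^ I)" by (rule mult_right_mono) simp
    also have "(3 * 2 ^ I :: real) ^ ?m = 6 ^ ?m * (2 ^ i) ^ ?m"
      unfolding Suc power_mult_distrib[symmetric] by simp
    also have "(?w i * (6 ^ ?m * (2 ^ i) ^ ?m)) * (2 / 2 ^ I) = 6 ^ ?m * (?w i * (2 ^ i) ^ CARD('n))"
      unfolding Suc by simp
    also have "\<dots> \<le> (2 * 6 ^ ?m) * (?w i * (2 ^ i) ^ CARD('n))" by (intro mult_right_mono) auto
    finally have "ennreal (R * (2 / 2 ^ I)) \<le> ennreal ((2 * 6 ^ ?m) * (?w i * (2 ^ i) ^ CARD('n)))" by (rule ennreal_leI)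
    also have "\<dots> = ennreal (2 * 6 ^ ?m) * ennreal (?w i * (2 ^ i) ^ CARD('n))" by (rule ennreal_mult') simp
    also have "ennreal (?w i * (2 ^ i) ^ CARD('n)) \<le> ?T + ennreal (decay z)"
    proof -
      have "ennreal (?w i * (2 ^ i) ^ CARD('n)) \<le> (\<Sum>\<alpha>\<in>UNIV. cell_kernel (third_shift \<alpha>) i x y)"
        by (rule near_cell[OF less_I]) (simp add: Suc)
      also have "\<dots> \<le> ?T" unfolding T_eq
        using sum_le_suminf[of "\<lambda>j. \<Sum>\<alpha>\<in>UNIV. cell_kernel (third_shift \<alpha>) j x y" "{i}"] by simp
      finally show ?thesis by (rule order_trans) simp
    qed
    finally show ?thesis by (simp add: mult_left_mono)
  qed
  finally have "(\<Sum>j. ennreal (model_kernel j z)) \<le> ?T + ennreal (2 * 6 ^ ?m) * (?T + ennreal (decay z))"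
    by (simp add: add_left_mono)
  also have "\<dots> \<le> (?T + ennreal (decay z)) + ennreal (2 * 6 ^ ?m) * (?T + ennreal (decay z))"
    by (intro add_right_mono) simp
  also have "\<dots> = ennreal (1 + 2 * 6 ^ ?m) * (?T + ennreal (decay z))"
    by (subst ennreal_plus) (simp_all add: distrib_right)
  finally show ?thesis unfolding z_def .
qed

section \<open>Convolution with the majorant kernel\<close>

definition potential :: "(real ^ 'n::finite \<Rightarrow> ennreal) \<Rightarrow> real ^ 'n \<Rightarrow> ennreal" where
  "potential F x = (\<integral>\<^sup>+y. (\<Sum>j. ennreal (model_kernel j (y - x))) * F y \<partial>lborel)"

lemma potential_measurable [measurable]:
  assumes [measurable]: "F \<in> borel_measurable borel"
  shows "potential F \<in> borel_measurable borel"
  unfolding potential_def[abs_def] by measurable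

lemma potential_le:
  fixes F :: "real ^ 'n::finite \<Rightarrow> ennreal"
  assumes [measurable]: "F \<in> borel_measurable borel"
  shows "potential F x \<le> ennreal (1 + 2 * 6 ^ (CARD('n) + 1)) *
    ((\<Sum>\<alpha>\<in>UNIV. \<Sum>j. ennreal (1 / (1 + real j)\<^sup>2) * dmean (third_shift \<alpha>) j F x) + (\<integral>\<^sup>+y. ennreal (decay (y - x)) * F y \<partial>lborel))"
proof -
  let ?C = "ennreal (1 + 2 * 6 ^ (CARD('n) + 1))"
  have [measurable]: "cell_kernel a j x \<in> borel_measurable borel" for a j
    unfolding cell_kernel_def[abs_def] by measurable
  have ck: "(\<integral>\<^sup>+y. cell_kernel a j x y * F y \<partial>lborel) = ennreal (1 / (1 + real j)\<^sup>2) * dmean a j F x" for a j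
  proof -
    have "(\<integral>\<^sup>+y. cell_kernel a j x y * F y \<partial>lborel)
      = (\<integral>\<^sup>+y. ennreal (1 / (1 + real j)\<^sup>2 * (2 ^ j) ^ CARD('n)) * (indicator (dcell a j x) y * F y) \<partial>lborel)"
      unfolding cell_kernel_def by (simp only: mult.assoc)
    also have "\<dots> = ennreal (1 / (1 + real j)\<^sup>2 * (2 ^ j) ^ CARD('n)) * (\<integral>\<^sup>+y. indicator (dcell a j x) y * F y \<partial>lborel)"
      by (rule nn_integral_cmult) simp
    also have "ennreal (1 / (1 + real j)\<^sup>2 * (2 ^ j) ^ CARD('n)) = ennreal (1 / (1 + real j)\<^sup>2) * ennreal ((2 ^ j) ^ CARD('n))"
      by (rule ennreal_mult') simp
    finally show ?thesis unfolding dmean_def by (simp only: mult.assoc)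
  qed
  have "potential F x \<le> (\<integral>\<^sup>+y. ?C * ((\<Sum>\<alpha>\<in>UNIV. \<Sum>j. cell_kernel (third_shift \<alpha>) j x y * F y) + ennreal (decay (y - x)) * F y) \<partial>lborel)"
    unfolding potential_def
  proof (rule nn_integral_mono_AE)
    show "AE y in lborel. (\<Sum>j. ennreal (model_kernel j (y - x))) * F y
      \<le> ?C * ((\<Sum>\<alpha>\<in>UNIV. \<Sum>j. cell_kernel (third_shift \<alpha>) j x y * F y) + ennreal (decay (y - x)) * F y)"
      using AE_lborel_singleton[of x]
    proof eventually_elim
      fix y assume "y \<noteq> x"
      then have "(\<Sum>j. ennreal (model_kernel j (y - x))) * F y \<le>
        (?C * ((\<Sum>\<alpha>\<in>UNIV. \<Sum>j. cell_kernel (third_shift \<alpha>) j x y) + ennreal (decay (y - x)))) * F y"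
        by (intro mult_right_mono model_kernel_domination) auto
      also have "\<dots> = ?C * ((\<Sum>\<alpha>\<in>UNIV. \<Sum>j. cell_kernel (third_shift \<alpha>) j x y * F y) + ennreal (decay (y - x)) * F y)"
        by (simp add: mult.assoc distrib_right sum_distrib_right ennreal_suminf_multc)
      finally show "(\<Sum>j. ennreal (model_kernel j (y - x))) * F y
        \<le> ?C * ((\<Sum>\<alpha>\<in>UNIV. \<Sum>j. cell_kernel (third_shift \<alpha>) j x y * F y) + ennreal (decay (y - x)) * F y)" .
    qed
  qed
  also have "\<dots> = ?C * ((\<Sum>\<alpha>\<in>UNIV. \<Sum>j. \<integral>\<^sup>+y. cell_kernel (third_shift \<alpha>) j x y * F y \<partial>lborel) + (\<integral>\<^sup>+y. ennreal (decay (y - x)) * F y \<partial>lborel))"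
    by (simp add: nn_integral_cmult nn_integral_add nn_integral_sum nn_integral_suminf del: ennreal_suminf_multc)
  finally show ?thesis unfolding ck .
qed

text \<open>The first factor is the constant of \<open>model_kernel_domination\<close>. The powers
  of 2 come from taking p-th powers of sums: one separates the dyadic part from the tail, the others
  separate the grids.\<close>

definition potential_const :: "'n::finite itself \<Rightarrow> real \<Rightarrow> real \<Rightarrow> real \<Rightarrow> real" where
  "potential_const _ p L B = (1 + 2 * 6 ^ (CARD('n) + 1)) powr p * (2 powr p *
     ((2 powr p) ^ CARD('n set) * (real CARD('n set) * dyadic_const p L B) + tail_const TYPE('n) p L B))"

lemma potential_bound:
  fixes f G :: "real ^ 'n::finite \<Rightarrow> real"
  assumes [measurable]: "f \<in> borel_measurable borel" "G \<in> borel_measurable borel"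
    and p: "p > 1" and L: "L > 0" and B: "B \<ge> 0" and nonneg: "\<And>y. 0 \<le> f y" "\<And>y. 0 \<le> G y"
    and moment: "\<And>a j x. dmean a j (\<lambda>y. ennreal (if real (Suc j) * L < G y then G y powr (p / (p - 1)) else 0)) x \<le> ennreal B"
    and fin: "(\<integral>\<^sup>+x. ennreal (f x powr p) \<partial>lborel) < \<infinity>"
  defines "X \<equiv> potential (\<lambda>y. ennreal (f y * G y))"
  shows "AE x in lborel. X x < \<infinity>"
    and "(\<integral>\<^sup>+x. ennreal (enn2real (X x) powr p) \<partial>lborel) \<le> ennreal (potential_const TYPE('n) p L B) * (\<integral>\<^sup>+x. ennreal (f x powr p) \<partial>lborel)"
proof -
  let ?F = "\<lambda>y. ennreal (f y * G y)"
  let ?I = "\<integral>\<^sup>+x. ennreal (f x powr p) \<partial>lborel"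
  let ?C = "1 + 2 * 6 ^ (CARD('n) + 1) :: real"
  define T where "T \<alpha> x = (\<Sum>j. ennreal (1 / (1 + real j)\<^sup>2) * dmean (third_shift \<alpha>) j ?F x)" for \<alpha> :: "'n set" and x
  define Y where "Y x = (\<integral>\<^sup>+y. ennreal (decay (y - x)) * ?F y \<partial>lborel)" for x
  have [measurable]: "T \<alpha> \<in> borel_measurable borel" for \<alpha> unfolding T_def[abs_def] by measurable
  have [measurable]: "Y \<in> borel_measurable borel" unfolding Y_def[abs_def] by measurable
  have X_le: "X x \<le> ennreal ?C * ((\<Sum>\<alpha>\<in>UNIV. T \<alpha> x) + Y x)" for x
    unfolding X_def T_def Y_def by (rule potential_le) simp
  have T_fin: "AE x in lborel. T \<alpha> x < \<infinity>" for \<alpha>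
    unfolding T_def by (rule dyadic_series_bound(1)) (use p L B nonneg moment fin in simp_all)
  have T_int: "(\<integral>\<^sup>+x. ennreal (enn2real (T \<alpha> x) powr p) \<partial>lborel) \<le> ennreal (dyadic_const p L B) * ?I" for \<alpha>
    unfolding T_def by (rule dyadic_series_bound(2)) (use p L B nonneg moment fin in simp_all)
  have Y_fin: "Y x < \<infinity>" for x
    unfolding Y_def by (rule tail_bound(1)[where a=0 and p=p and L=L and B=B]) (use p L B nonneg moment fin in simp_all)
  have Y_int: "(\<integral>\<^sup>+x. ennreal (enn2real (Y x) powr p) \<partial>lborel) \<le> ennreal (tail_const TYPE('n) p L B) * ?I"
    unfolding Y_def by (rule tail_bound(2)[where a=0]) (use p L B nonneg moment fin in simp_all)
  have T_fin': "AE x in lborel. \<forall>\<alpha>. T \<alpha> x < \<infinity>"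
  proof -
    have "AE x in lborel. \<forall>\<alpha>\<in>UNIV. T \<alpha> x < \<infinity>"
      by (rule AE_finite_allI) (simp, rule T_fin)
    then show ?thesis by simp
  qed
  have X_real: "enn2real (X x) \<le> ?C * ((\<Sum>\<alpha>\<in>UNIV. enn2real (T \<alpha> x)) + enn2real (Y x))" and X_lt: "X x < \<infinity>"
    if "\<forall>\<alpha>. T \<alpha> x < \<infinity>" for x
  proof -
    have e: "T \<alpha> x = ennreal (enn2real (T \<alpha> x))" "Y x = ennreal (enn2real (Y x))" for \<alpha>
      using that Y_fin[of x] by (simp_all add: ennreal_enn2real_if less_top)
    have "(\<Sum>\<alpha>\<in>UNIV. T \<alpha> x) = ennreal (\<Sum>\<alpha>\<in>UNIV. enn2real (T \<alpha> x))"
      by (subst sum_ennreal[symmetric], simp, subst e(1)[symmetric]) simp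
    then have "(\<Sum>\<alpha>\<in>UNIV. T \<alpha> x) + Y x = ennreal ((\<Sum>\<alpha>\<in>UNIV. enn2real (T \<alpha> x)) + enn2real (Y x))"
      by (subst ennreal_plus) (simp_all add: sum_nonneg flip: e(2))
    then have le: "X x \<le> ennreal (?C * ((\<Sum>\<alpha>\<in>UNIV. enn2real (T \<alpha> x)) + enn2real (Y x)))"
      using X_le[of x] by (subst ennreal_mult') (simp_all only: add_nonneg_nonneg zero_le_one zero_le_power mult_nonneg_nonneg zero_le_numeral)
    then show "X x < \<infinity>" by (rule le_less_trans) simp
    show "enn2real (X x) \<le> ?C * ((\<Sum>\<alpha>\<in>UNIV. enn2real (T \<alpha> x)) + enn2real (Y x))"
      using le by (intro enn2real_leI mult_nonneg_nonneg add_nonneg_nonneg sum_nonneg) auto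
  qed
  show "AE x in lborel. X x < \<infinity>" using T_fin' by eventually_elim (rule X_lt)
  let ?N = "CARD('n set)"
  have ptw: "enn2real (X x) powr p \<le> ?C powr p * (2 powr p * ((2 powr p) ^ ?N * (\<Sum>\<alpha>\<in>UNIV. enn2real (T \<alpha> x) powr p) + enn2real (Y x) powr p))"
    if "\<forall>\<alpha>. T \<alpha> x < \<infinity>" for x
  proof -
    let ?t = "\<Sum>\<alpha>\<in>(UNIV :: 'n set set). enn2real (T \<alpha> x)"
    have t0: "0 \<le> ?t" by (intro sum_nonneg) simp
    have "enn2real (X x) powr p \<le> (?C * (?t + enn2real (Y x))) powr p"
      using X_real[OF that] p by (intro powr_mono2) auto
    also have "\<dots> = ?C powr p * (?t + enn2real (Y x)) powr p" by (rule powr_mult)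
    also have "(?t + enn2real (Y x)) powr p \<le> 2 powr p * (?t powr p + enn2real (Y x) powr p)"
      using p t0 by (intro powr_add_le) auto
    also have "?t powr p \<le> (2 powr p) ^ ?N * (\<Sum>\<alpha>\<in>UNIV. enn2real (T \<alpha> x) powr p)"
      using p by (intro sum_powr_le) auto
    finally show ?thesis by (simp add: mult_left_mono add_right_mono)
  qed
  let ?c1 = "ennreal (?C powr p)" and ?c2 = "ennreal (2 powr p)" and ?c3 = "ennreal ((2 powr p) ^ ?N)"
  have "(\<integral>\<^sup>+x. ennreal (enn2real (X x) powr p) \<partial>lborel) \<le>
    (\<integral>\<^sup>+x. ?c1 * (?c2 * (?c3 * (\<Sum>\<alpha>\<in>UNIV. ennreal (enn2real (T \<alpha> x) powr p)) + ennreal (enn2real (Y x) powr p))) \<partial>lborel)"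
  proof (rule nn_integral_mono_AE)
    show "AE x in lborel. ennreal (enn2real (X x) powr p) \<le>
      ?c1 * (?c2 * (?c3 * (\<Sum>\<alpha>\<in>UNIV. ennreal (enn2real (T \<alpha> x) powr p)) + ennreal (enn2real (Y x) powr p)))"
      using T_fin'
    proof eventually_elim
      fix x assume "\<forall>\<alpha>. T \<alpha> x < \<infinity>"
      from ennreal_leI[OF ptw[OF this]]
      show "ennreal (enn2real (X x) powr p) \<le>
        ?c1 * (?c2 * (?c3 * (\<Sum>\<alpha>\<in>UNIV. ennreal (enn2real (T \<alpha> x) powr p)) + ennreal (enn2real (Y x) powr p)))"
        by (simp only: ennreal_mult' ennreal_plus sum_ennreal powr_ge_zero zero_le_power sum_nonneg mult_nonneg_nonneg)
    qed
  qed
  also have "\<dots> = ?c1 * (?c2 * (?c3 * (\<Sum>\<alpha>\<in>UNIV. \<integral>\<^sup>+x. ennreal (enn2real (T \<alpha> x) powr p) \<partial>lborel) + (\<integral>\<^sup>+x. ennreal (enn2real (Y x) powr p) \<partial>lborel)))"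
    by (simp add: nn_integral_cmult nn_integral_add nn_integral_sum del: sum_ennreal)
  also have "\<dots> \<le> ?c1 * (?c2 * (?c3 * (\<Sum>\<alpha>\<in>(UNIV :: 'n set set). ennreal (dyadic_const p L B) * ?I) + ennreal (tail_const TYPE('n) p L B) * ?I))"
    by (intro mult_left_mono add_mono sum_mono T_int Y_int) simp_all
  also have "\<dots> = ennreal (potential_const TYPE('n) p L B) * ?I"
  proof -
    have dc: "0 \<le> dyadic_const p L B" using p unfolding dyadic_const_def Let_def by simp
    have tc: "0 \<le> tail_const TYPE('n) p L B" unfolding tail_const_def by simp
    have "(\<Sum>\<alpha>\<in>(UNIV :: 'n set set). ennreal (dyadic_const p L B) * ?I) = ennreal (real ?N * dyadic_const p L B) * ?I"
      by (simp add: ennreal_mult' mult.assoc ennreal_of_nat_eq_real_of_nat)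
    then show ?thesis
      unfolding potential_const_def using dc tc
      by (simp only: ennreal_mult' ennreal_plus powr_ge_zero zero_le_power mult_nonneg_nonneg of_nat_0_le_iff add_nonneg_nonneg distrib_right mult.assoc)
  qed
  finally show "(\<integral>\<^sup>+x. ennreal (enn2real (X x) powr p) \<partial>lborel) \<le> ennreal (potential_const TYPE('n) p L B) * ?I" .
qed

section \<open>Dyadic means of bmo functions\<close>

lemma emeasure_cube:
  fixes c :: "real ^ 'n::finite"
  assumes "l \<ge> 0"
  shows "emeasure lborel (cube c l) = ennreal (l ^ CARD('n))"
proof -
  let ?u = "\<chi> i. c $ i + l"
  have "(\<Prod>b\<in>Basis. (?u - c) \<bullet> b) = (\<Prod>b\<in>(Basis::(real^'n) set). l)"
    by (intro prod.cong refl) (auto simp: Basis_vec_def inner_axis)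
  then have "(\<Prod>b\<in>Basis. (?u - c) \<bullet> b) = l ^ CARD('n)" by simp
  moreover have "\<forall>b\<in>Basis. c \<bullet> b \<le> ?u \<bullet> b" using assms by (auto simp: Basis_vec_def inner_axis)
  ultimately show ?thesis by (simp add: cube_def emeasure_lborel_cbox_eq)
qed

lemma cube_sets [measurable, simp]: "cube c l \<in> sets borel"
  by (simp add: cube_def)

text \<open>The bmo norm is defined by closed cubes, the dyadic argument needs half-open cells;
  equality of volumes shows that they differ by a null set.\<close>

lemma cube_dcell_AE: "AE y in lborel. y \<in> cube (dcorner a j x) (1 / 2 ^ j) \<longleftrightarrow> y \<in> dcell a j x"
  for x a :: "real ^ 'n::finite"
proof -
  let ?Q = "cube (dcorner a j x) (1 / 2 ^ j)"
  have "dcorner a j x + (\<chi> i. 1 / 2 ^ j) = (\<chi> i. dcorner a j x $ i + 1 / 2 ^ j)" by (simp add: vec_eq_iff)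
  then have sub: "dcell a j x \<subseteq> ?Q" using dcell_cbox(1)[of a j x] by (simp add: cube_def)
  have "emeasure lborel (?Q - dcell a j x) = emeasure lborel ?Q - emeasure lborel (dcell a j x)"
    by (rule emeasure_Diff) (use sub in \<open>simp_all add: emeasure_dcell\<close>)
  also have "\<dots> = 0" by (simp add: emeasure_cube emeasure_dcell power_one_over)
  finally have "?Q - dcell a j x \<in> null_sets lborel" by (intro null_setsI) simp_all
  from AE_not_in[OF this] show ?thesis by eventually_elim (use sub in blast)
qed

lemma avg_dyadic_cube:
  fixes g h :: "real ^ 'n::finite \<Rightarrow> 'b::{banach, second_countable_topology}"
  assumes g: "g \<in> borel_measurable lebesgue" and h [measurable]: "h \<in> borel_measurable borel"
    and AE: "AE x in lborel. g x = h x"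
  shows "avg (cube (dcorner a j x) (1 / 2 ^ j)) g = (2 ^ j) ^ CARD('n) *\<^sub>R (LINT y|lborel. indicator (dcell a j x) y *\<^sub>R h y)"
proof -
  let ?Q = "cube (dcorner a j x) (1 / 2 ^ j)"
  have "(LINT y:?Q|lebesgue. g y) = (LINT y|lborel. indicator (dcell a j x) y *\<^sub>R h y)"
    unfolding set_lebesgue_integral_def
  proof (rule lebesgue_integral_representative)
    show "(\<lambda>y. indicator ?Q y *\<^sub>R g y) \<in> borel_measurable lebesgue"
      using g by (intro borel_measurable_scaleR borel_measurable_indicator) simp_all
    show "AE y in lborel. indicator ?Q y *\<^sub>R g y = indicator (dcell a j x) y *\<^sub>R h y"
      using AE cube_dcell_AE[of a j x] by eventually_elim (simp add: indicator_def)
  qed simp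
  moreover have "measure lebesgue ?Q = 1 / (2 ^ j) ^ CARD('n)"
  proof -
    have "measure lebesgue ?Q = measure lborel ?Q" by (rule measure_completion) simp
    then show ?thesis by (simp add: measure_def emeasure_cube power_one_over)
  qed
  ultimately show ?thesis by (simp add: avg_def)
qed

lemma locally_integrable_measurable:
  fixes g :: "real ^ 'n::finite \<Rightarrow> complex"
  assumes "locally_integrable g"
  shows "g \<in> borel_measurable lebesgue"
proof (rule borel_measurable_LIMSEQ_metric)
  show "(\<lambda>x. indicator (cball 0 (real k)) x *\<^sub>R g x) \<in> borel_measurable lebesgue" for k
    by (rule borel_measurable_integrable)
       (use assms compact_cball in \<open>unfold locally_integrable_def set_integrable_def, blast\<close>)
  fix x :: "real^'n"
  obtain N where "norm x \<le> real N" using real_arch_simple by blast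
  then have "\<forall>\<^sub>F k in sequentially. indicator (cball 0 (real k)) x *\<^sub>R g x = g x"
    by (intro eventually_sequentiallyI[of N]) (auto simp: indicator_def)
  then show "(\<lambda>k. indicator (cball 0 (real k)) x *\<^sub>R g x) \<longlonglongrightarrow> g x" by (rule tendsto_eventually)
qed

lemma avg_nonneg:
  fixes f :: "real ^ 'n::finite \<Rightarrow> real"
  assumes "\<And>x. 0 \<le> f x"
  shows "0 \<le> avg Q f"
  unfolding avg_def set_lebesgue_integral_def
  by (simp add: integral_nonneg_AE assms)

text \<open>Cells of level at least 1 have side less than 1, so \<open>bmo_small\<close> controls
  their oscillation. Unit cells belong to \<open>bmo_large\<close>, where the mean of |g| is
  bounded; subtracting the mean costs the factor 2.\<close>

lemma bmo_cell_bounds: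
  fixes g h :: "real ^ 'n::finite \<Rightarrow> complex"
  assumes g: "g \<in> bmo" and h [measurable]: "h \<in> borel_measurable borel" and AE: "AE x in lborel. g x = h x"
  shows "integrable lborel (\<lambda>y. indicator (dcell a j x) y *\<^sub>R h y)"
    and "dmean a j (\<lambda>y. ennreal (norm (h y - cell_mean a h j x))) x \<le> ennreal (2 * bmo_norm g)"
    and "norm (cell_mean a h 0 x) \<le> bmo_norm g"
    and "0 \<le> bmo_norm g"
proof -
  have loc: "locally_integrable g" and bs: "bdd_above (bmo_small g)" and bl: "bdd_above (bmo_large g)"
    using g by (auto simp: bmo_def)
  have gm: "g \<in> borel_measurable lebesgue" by (rule locally_integrable_measurable[OF loc])
  have int: "integrable lborel (\<lambda>y. indicator (dcell b k z) y *\<^sub>R h y)" for b k z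
  proof -
    let ?Q = "cube (dcorner b k z) (1 / 2 ^ k)"
    have "compact ?Q" by (simp add: cube_def compact_cbox)
    then have "integrable lebesgue (\<lambda>y. indicator ?Q y *\<^sub>R g y)"
      using loc unfolding locally_integrable_def set_integrable_def by blast
    moreover have "integrable lebesgue (\<lambda>y. indicator ?Q y *\<^sub>R g y) \<longleftrightarrow> integrable lborel (\<lambda>y. indicator (dcell b k z) y *\<^sub>R h y)"
    proof (rule lebesgue_integral_representative)
      show "(\<lambda>y. indicator ?Q y *\<^sub>R g y) \<in> borel_measurable lebesgue"
        using gm by (intro borel_measurable_scaleR borel_measurable_indicator) simp_all
      show "AE y in lborel. indicator ?Q y *\<^sub>R g y = indicator (dcell b k z) y *\<^sub>R h y"
        using AE cube_dcell_AE[of b k z] by eventually_elim (simp add: indicator_def)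
    qed simp
    ultimately show ?thesis by simp
  qed
  show "integrable lborel (\<lambda>y. indicator (dcell a j x) y *\<^sub>R h y)" by (rule int)
  have mean: "avg (cube (dcorner b k z) (1 / 2 ^ k)) g = cell_mean b h k z" for b k z
    unfolding cell_mean_def by (rule avg_dyadic_cube) (use gm AE in simp_all)
  have dmean_avg: "dmean b k (\<lambda>y. ennreal (norm (h y - c))) z = ennreal (avg (cube (dcorner b k z) (1 / 2 ^ k)) (\<lambda>y. norm (g y - c)))" for b k z c
  proof -
    have i: "integrable lborel (\<lambda>y. indicator (dcell b k z) y *\<^sub>R norm (h y - c))"
    proof -
      have "integrable lborel (\<lambda>y. indicator (dcell b k z) y *\<^sub>R h y - indicator (dcell b k z) y *\<^sub>R c)"
        by (intro Bochner_Integration.integrable_diff int integrable_scaleR_left integrable_dcell_indicator)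
      then have "integrable lborel (\<lambda>y. norm (indicator (dcell b k z) y *\<^sub>R h y - indicator (dcell b k z) y *\<^sub>R c))"
        by (rule integrable_norm)
      then show ?thesis by (simp flip: scaleR_diff_right)
    qed
    have "avg (cube (dcorner b k z) (1 / 2 ^ k)) (\<lambda>y. norm (g y - c)) =
      (2 ^ k) ^ CARD('n) *\<^sub>R (LINT y|lborel. indicator (dcell b k z) y *\<^sub>R norm (h y - c))"
    proof (rule avg_dyadic_cube)
      show "(\<lambda>y. norm (g y - c)) \<in> borel_measurable lebesgue" using gm by measurable
      show "AE y in lborel. norm (g y - c) = norm (h y - c)" using AE by eventually_elim simp
    qed simp
    moreover have "(\<integral>\<^sup>+y. indicator (dcell b k z) y * ennreal (norm (h y - c)) \<partial>lborel)
      = ennreal (LINT y|lborel. indicator (dcell b k z) y *\<^sub>R norm (h y - c))"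
      using nn_integral_eq_integral[OF i] by (simp add: ennreal_mult' ennreal_indicator)
    ultimately show ?thesis unfolding dmean_def by (simp add: ennreal_mult')
  qed
  have small0: "0 \<le> Sup (bmo_small g)"
  proof -
    have e: "avg (cube 0 (1/2)) (\<lambda>x. norm (g x - avg (cube 0 (1/2)) g)) \<in> bmo_small g"
      unfolding bmo_small_def by (auto intro!: exI[of _ 0] exI[of _ "1/2"])
    have "0 \<le> avg (cube 0 (1/2)) (\<lambda>x. norm (g x - avg (cube 0 (1/2)) g))" by (rule avg_nonneg) simp
    also have "\<dots> \<le> Sup (bmo_small g)" by (rule cSup_upper[OF e bs])
    finally show ?thesis .
  qed
  have large: "avg (cube c 1) (\<lambda>x. norm (g x)) \<le> Sup (bmo_large g)" for c
    by (rule cSup_upper[OF _ bl]) (unfold bmo_large_def, rule CollectI, rule exI[of _ c], rule exI[of _ 1], simp)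
  have "0 \<le> avg (cube 0 1) (\<lambda>x. norm (g x))" by (rule avg_nonneg) simp
  then have large0: "0 \<le> Sup (bmo_large g)" using large[of 0] by linarith
  show N0: "0 \<le> bmo_norm g" unfolding bmo_norm_def using small0 large0 by simp
  have unit: "dmean a 0 (\<lambda>y. ennreal (norm (h y))) z \<le> ennreal (bmo_norm g)" for z
  proof -
    have "dmean a 0 (\<lambda>y. ennreal (norm (h y))) z = ennreal (avg (cube (dcorner a 0 z) 1) (\<lambda>y. norm (g y)))"
      using dmean_avg[of a 0 0 z] by simp
    also have "\<dots> \<le> ennreal (bmo_norm g)"
      unfolding bmo_norm_def using large[of "dcorner a 0 z"] small0 by (intro ennreal_leI) linarith
    finally show ?thesis .
  qed
  have unit_mean: "ennreal (norm (cell_mean a h 0 z)) \<le> ennreal (bmo_norm g)" for z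
    using order_trans[OF cell_mean_diff_le[OF h int, of a 0 z 0]] unit[of z] by simp
  then show "norm (cell_mean a h 0 x) \<le> bmo_norm g" using N0 by simp
  show "dmean a j (\<lambda>y. ennreal (norm (h y - cell_mean a h j x))) x \<le> ennreal (2 * bmo_norm g)"
  proof (cases "j = 0")
    case True
    have "dmean a 0 (\<lambda>y. ennreal (norm (h y - cell_mean a h 0 x))) x
      \<le> dmean a 0 (\<lambda>y. ennreal (norm (cell_mean a h 0 x)) + ennreal (norm (h y))) x"
    proof (rule dmean_mono)
      fix y
      have "norm (h y - cell_mean a h 0 x) \<le> norm (cell_mean a h 0 x) + norm (h y)"
        using norm_triangle_ineq4[of "h y" "cell_mean a h 0 x"] by simp
      then show "ennreal (norm (h y - cell_mean a h 0 x)) \<le> ennreal (norm (cell_mean a h 0 x)) + ennreal (norm (h y))"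
        by (simp add: ennreal_leI flip: ennreal_plus)
    qed
    also have "\<dots> = ennreal (norm (cell_mean a h 0 x)) + dmean a 0 (\<lambda>y. ennreal (norm (h y))) x"
      by (rule dmean_const_add) simp
    also have "\<dots> \<le> ennreal (bmo_norm g) + ennreal (bmo_norm g)" by (intro add_mono unit unit_mean)
    also have "\<dots> = ennreal (2 * bmo_norm g)" using N0 by (simp flip: ennreal_plus)
    finally show ?thesis using True by simp
  next
    case False
    let ?Q = "cube (dcorner a j x) (1 / 2 ^ j)"
    have "(2::real) ^ 1 \<le> 2 ^ j" using False by (intro power_increasing) auto
    then have "avg ?Q (\<lambda>y. norm (g y - avg ?Q g)) \<in> bmo_small g"
      unfolding bmo_small_def by (auto intro!: exI[of _ "dcorner a j x"] exI[of _ "1 / 2 ^ j"])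
    then have "avg ?Q (\<lambda>y. norm (g y - avg ?Q g)) \<le> Sup (bmo_small g)" by (rule cSup_upper[OF _ bs])
    also have "\<dots> \<le> 2 * bmo_norm g" unfolding bmo_norm_def using small0 large0 by simp
    finally show ?thesis unfolding dmean_avg mean[symmetric] by (rule ennreal_leI)
  qed
qed

text \<open>The threshold 2 A n of \<open>dyadic_moment_bound\<close>, with A = 4 * 2^n + 1 as in
  the exponential estimate; it takes the place of L from here on.\<close>

definition bmo_level :: "'n::finite itself \<Rightarrow> real" where
  "bmo_level _ = 2 * (4 * 2 ^ CARD('n) + 1) * real CARD('n)"

definition bmo_moment :: "'n::finite itself \<Rightarrow> real \<Rightarrow> real" where
  "bmo_moment _ q = (q / (1 / (2 * (4 * 2 ^ CARD('n) + 1)) * ln 2)) powr q * 5"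

lemma bmo_level_pos: "bmo_level TYPE('n::finite) > 0"
  unfolding bmo_level_def by (intro mult_pos_pos add_pos_pos) auto

lemma bmo_moment_nonneg: "bmo_moment TYPE('n::finite) q \<ge> 0"
  unfolding bmo_moment_def by simp

text \<open>Division by \<open>s\<close> normalises the oscillations and unit means to at most 1. A
  positive s above twice the norm, rather than the norm itself, also covers functions of norm
  0.\<close>

lemma bmo_moment_bound:
  fixes g h :: "real ^ 'n::finite \<Rightarrow> complex"
  assumes g: "g \<in> bmo" and h [measurable]: "h \<in> borel_measurable borel" and AE: "AE x in lborel. g x = h x"
    and s: "s > 0" "2 * bmo_norm g \<le> s" and q: "q > 0"
  shows "dmean a j (\<lambda>y. ennreal (if real (Suc j) * bmo_level TYPE('n) < norm (h y) / s then (norm (h y) / s) powr q else 0)) x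
    \<le> ennreal (bmo_moment TYPE('n) q)"
proof -
  note bd = bmo_cell_bounds[OF g h AE]
  define u where "u y = h y /\<^sub>R s" for y
  have [measurable]: "u \<in> borel_measurable borel" unfolding u_def[abs_def] by measurable
  have mean: "cell_mean a u k z = cell_mean a h k z /\<^sub>R s" for k z
  proof -
    have "indicator (dcell a k z) y *\<^sub>R u y = (indicator (dcell a k z) y *\<^sub>R h y) /\<^sub>R s" for y
      unfolding u_def by (rule scaleR_left_commute)
    then show ?thesis
      unfolding cell_mean_def by (simp only: integral_scaleR_right) (rule scaleR_left_commute)
  qed
  have nu: "norm (u y) = norm (h y) / s" for y using s by (simp add: u_def divide_inverse)
  have "dmean a j (\<lambda>y. ennreal (norm (u y) powr q) * indicator {y. real (Suc j) * (2 * (4 * 2 ^ CARD('n) + 1) * real CARD('n)) < norm (u y)} y) x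
    \<le> ennreal ((q / (1 / (2 * (4 * 2 ^ CARD('n) + 1)) * ln 2)) powr q) * 5"
  proof (rule dyadic_moment_bound)
    fix k z
    show "integrable lborel (\<lambda>y. indicator (dcell a k z) y *\<^sub>R u y)"
      using integrable_scaleR_right[OF bd(1)[of a k z], of "inverse s"] unfolding u_def
      by (simp add: mult.commute)
    have "ennreal (norm (u y - cell_mean a u k z)) = ennreal (1 / s) * ennreal (norm (h y - cell_mean a h k z))" for y
    proof -
      have "norm (u y - cell_mean a u k z) = 1 / s * norm (h y - cell_mean a h k z)"
        unfolding mean u_def scaleR_diff_right[symmetric] norm_scaleR using s by (simp add: divide_inverse)
      then show ?thesis using s by (simp only: ennreal_mult'[symmetric] zero_le_divide_1_iff less_imp_le)
    qed
    then have "dmean a k (\<lambda>y. ennreal (norm (u y - cell_mean a u k z))) z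
       = ennreal (1 / s) * dmean a k (\<lambda>y. ennreal (norm (h y - cell_mean a h k z))) z"
      by (simp add: dmean_eq_density nn_integral_cmult)
    also have "\<dots> \<le> ennreal (1 / s) * ennreal (2 * bmo_norm g)" by (intro mult_left_mono bd(2)) simp
    also have "\<dots> = ennreal (1 / s * (2 * bmo_norm g))" using s by (intro ennreal_mult'[symmetric]) simp
    also have "\<dots> \<le> ennreal 1" using s by (intro ennreal_leI) simp
    finally show "dmean a k (\<lambda>y. ennreal (norm (u y - cell_mean a u k z))) z \<le> 1" by simp
    have "norm (cell_mean a u 0 z) = norm (cell_mean a h 0 z) / s"
      unfolding mean norm_scaleR using s by (simp add: divide_inverse)
    also have "\<dots> \<le> bmo_norm g / s" using s bd(3)[of a z] by (intro divide_right_mono) auto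
    also have "\<dots> \<le> 1" using s bd(4) by simp
    finally show "norm (cell_mean a u 0 z) \<le> 1" .
  qed (use q in simp_all)
  also have "\<dots> = ennreal (bmo_moment TYPE('n) q)"
  proof -
    have "ennreal (c * 5) = ennreal c * 5" if "0 \<le> c" for c using that by (simp add: ennreal_mult')
    then show ?thesis unfolding bmo_moment_def by simp
  qed
  also have "(\<lambda>y. ennreal (norm (u y) powr q) * indicator {y. real (Suc j) * (2 * (4 * 2 ^ CARD('n) + 1) * real CARD('n)) < norm (u y)} y)
    = (\<lambda>y. ennreal (if real (Suc j) * bmo_level TYPE('n) < norm (h y) / s then (norm (h y) / s) powr q else 0))"
    unfolding bmo_level_def nu by (auto simp: fun_eq_iff indicator_def)
  finally show ?thesis .
qed

section \<open>The product estimate\<close>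

text \<open>A Schwartz function is at most a seminorm times \<open>decay\<close>, and so is the
  indicator of a compact set up to a constant; integrability of W against \<open>decay\<close> thus
  gives the pairings, their continuity and local integrability.\<close>

lemma tempered_function_if_decay_integrable:
  fixes W w :: "real ^ 'n::finite \<Rightarrow> complex"
  assumes W: "W \<in> borel_measurable lebesgue" and w [measurable]: "w \<in> borel_measurable borel"
    and AE: "AE x in lborel. W x = w x"
    and fin: "(\<integral>\<^sup>+y. ennreal (decay y) * ennreal (norm (w y)) \<partial>lborel) < \<infinity>"
  shows "tempered_function W"
proof -
  let ?m = "CARD('n) + 1"
  have dw: "integrable lborel (\<lambda>y. decay y * norm (w y))"
    unfolding integrable_iff_bounded using fin
    by (simp add: abs_mult ennreal_mult'[symmetric] less_imp_le decay_pos)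
  have int: "integrable lebesgue (\<lambda>x. W x * \<psi> x)"
    if \<psi>: "\<psi> \<in> borel_measurable borel" "\<And>x. norm (\<psi> x) \<le> C * decay x" for \<psi> :: "real^'n \<Rightarrow> complex" and C
  proof -
    have [measurable]: "\<psi> \<in> borel_measurable borel" by (rule \<psi>(1))
    have "\<psi> \<in> borel_measurable lebesgue" by (simp add: measurable_completion)
    moreover have "integrable lborel (\<lambda>x. w x * \<psi> x)"
    proof (rule Bochner_Integration.integrable_bound)
      show "integrable lborel (\<lambda>x. C * (decay x * norm (w x)))" using dw by simp
      have "norm (w x * \<psi> x) \<le> norm (C * (decay x * norm (w x)))" for x
      proof -
        have "norm (w x * \<psi> x) \<le> norm (w x) * (C * decay x)"
          unfolding norm_mult by (intro mult_left_mono \<psi>(2)) simp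
        also have "\<dots> = C * (decay x * norm (w x))" by simp
        finally show ?thesis by simp
      qed
      then show "AE x in lborel. norm (w x * \<psi> x) \<le> norm (C * (decay x * norm (w x)))" by simp
    qed simp
    moreover have "AE x in lborel. W x * \<psi> x = w x * \<psi> x" using AE by eventually_elim simp
    ultimately show ?thesis
      using lebesgue_integral_representative(2)[of "\<lambda>x. W x * \<psi> x" "\<lambda>x. w x * \<psi> x"] W by simp
  qed
  have int_schwartz: "integrable lebesgue (\<lambda>x. W x * \<phi> x)" if "\<phi> \<in> schwartz" for \<phi>
    by (rule int[OF schwartz_measurable[OF that] schwartz_decay_bound[OF that]])
  have loc: "locally_integrable W"
    unfolding locally_integrable_def set_integrable_def
  proof (intro allI impI)
    fix K :: "(real^'n) set" assume K: "compact K"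
    then obtain R where R: "R > 0" "\<And>x. x \<in> K \<Longrightarrow> norm x \<le> R"
      using compact_imp_bounded[OF K] unfolding bounded_pos by blast
    \<comment> \<open>On a ball of radius R the profile \<open>decay\<close> is bounded below by (1
      + R)^-(n+1), so the indicator of K is an admissible \<psi>.\<close>
    have "integrable lebesgue (\<lambda>x. W x * of_real (indicator K x))"
    proof (rule int)
      show "(\<lambda>x. complex_of_real (indicator K x)) \<in> borel_measurable borel"
        using borel_compact[OF K] by measurable
      show "norm (complex_of_real (indicator K x)) \<le> (1 + R) ^ ?m * decay x" for x
      proof (cases "x \<in> K")
        case True
        have "(1 + norm x) ^ ?m \<le> (1 + R) ^ ?m" using R(2)[OF True] by (intro power_mono) auto
        then show ?thesis using True by (simp add: decay_def add_pos_nonneg)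
      next
        case False
        then show ?thesis using R decay_pos[of x] by (simp add: less_imp_le)
      qed
    qed
    then show "integrable lebesgue (\<lambda>x. indicator K x *\<^sub>R W x)"
      by (simp add: scaleR_conv_of_real mult.commute)
  qed
  have "tempered_distribution (function_distribution W)"
    unfolding tempered_distribution_def
  proof (intro conjI ballI allI)
    fix \<phi> \<psi> :: "real^'n \<Rightarrow> complex" and c assume s: "\<phi> \<in> schwartz"
    show "function_distribution W (\<lambda>x. c * \<phi> x) = c * function_distribution W \<phi>"
      by (simp add: function_distribution_def mult.left_commute)
    assume "\<psi> \<in> schwartz"
    then show "function_distribution W (\<lambda>x. \<phi> x + \<psi> x) = function_distribution W \<phi> + function_distribution W \<psi>"
      using int_schwartz s by (simp add: function_distribution_def distrib_left)
  next
    show "\<exists>C N. \<forall>\<phi>\<in>schwartz. norm (function_distribution W \<phi>) \<le> C * (\<Sum>is | length is \<le> N. schwartz_seminorm N is \<phi>)"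
    proof (intro exI ballI)
      fix \<phi> :: "real^'n \<Rightarrow> complex" assume \<phi>: "\<phi> \<in> schwartz"
      have [measurable]: "\<phi> \<in> borel_measurable borel" by (rule schwartz_measurable[OF \<phi>])
      have "\<phi> \<in> borel_measurable lebesgue" by (simp add: measurable_completion)
      then have m: "(\<lambda>x. W x * \<phi> x) \<in> borel_measurable lebesgue" using W by simp
      have ae: "AE x in lborel. W x * \<phi> x = w x * \<phi> x" using AE by eventually_elim simp
      have "integrable lborel (\<lambda>x. w x * \<phi> x)"
        using lebesgue_integral_representative(2)[OF m _ ae] int_schwartz[OF \<phi>] by simp
      then have "norm (LINT x|lborel. w x * \<phi> x) \<le> (LINT x|lborel. schwartz_seminorm ?m [] \<phi> * (decay x * norm (w x)))"
        using dw
      proof (intro order_trans[OF integral_norm_bound] integral_mono integrable_norm integrable_mult_right)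
        fix x
        have "norm (w x * \<phi> x) \<le> norm (w x) * (schwartz_seminorm ?m [] \<phi> * decay x)"
          unfolding norm_mult by (intro mult_left_mono schwartz_decay_bound \<phi>) simp
        then show "norm (w x * \<phi> x) \<le> schwartz_seminorm ?m [] \<phi> * (decay x * norm (w x))" by (simp add: mult_ac)
      qed
      also have "\<dots> = (LINT x|lborel. decay x * norm (w x)) * schwartz_seminorm ?m [] \<phi>" by simp
      also have "\<dots> \<le> (LINT x|lborel. decay x * norm (w x)) * (\<Sum>is | length is \<le> ?m. schwartz_seminorm ?m is \<phi>)"
      proof (rule mult_left_mono)
        have "finite {xs :: 'n list. length xs \<le> ?m}"
          using finite_lists_length_le[of "UNIV :: 'n set" ?m] by simp
        then show "schwartz_seminorm ?m [] \<phi> \<le> (\<Sum>is | length is \<le> ?m. schwartz_seminorm ?m is \<phi>)"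
          by (intro member_le_sum) (auto simp: schwartz_seminorm_nonneg[OF \<phi>])
        show "0 \<le> (LINT x|lborel. decay x * norm (w x))"
          by (rule integral_nonneg_AE) (simp add: less_imp_le decay_pos)
      qed
      also have "(LINT x|lborel. w x * \<phi> x) = function_distribution W \<phi>"
        unfolding function_distribution_def by (rule lebesgue_integral_representative(1)[OF m _ ae, symmetric]) simp
      finally show "norm (function_distribution W \<phi>) \<le> (LINT x|lborel. decay x * norm (w x)) * (\<Sum>is | length is \<le> ?m. schwartz_seminorm ?m is \<phi>)" .
    qed
  qed
  then show ?thesis unfolding tempered_function_def using loc int_schwartz by blast
qed

lemma potential_cmult:
  assumes [measurable]: "F \<in> borel_measurable borel"
  shows "potential (\<lambda>y. c * F y) x = c * potential F x"
  unfolding potential_def by (simp add: mult.left_commute nn_integral_cmult)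

definition product_const :: "'n::finite itself \<Rightarrow> real \<Rightarrow> real" where
  "product_const _ p = potential_const TYPE('n) p (bmo_level TYPE('n)) (bmo_moment TYPE('n) (p / (p - 1)))"

text \<open>The estimate holds for |h|/s, which satisfies the normalised moment bound; homogeneity
  of the potential restores the factor s.\<close>

lemma product_potential_bound:
  fixes f g h :: "real ^ 'n::finite \<Rightarrow> complex"
  assumes g: "g \<in> bmo" and h [measurable]: "h \<in> borel_measurable borel" and AE: "AE x in lborel. g x = h x"
    and s: "s > 0" "2 * bmo_norm g \<le> s" and p: "p > 1"
    and f [measurable]: "f \<in> borel_measurable borel" and fin: "integrable lborel (\<lambda>x. norm (f x) powr p)"
  defines "F \<equiv> \<lambda>y. ennreal (norm (f y * h y))"
  shows "AE x in lborel. potential F x < \<infinity>"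
    and "(\<integral>\<^sup>+x. ennreal (enn2real (potential F x) powr p) \<partial>lborel)
      \<le> ennreal (s powr p * (product_const TYPE('n) p * (LINT x|lborel. norm (f x) powr p)))"
    and "(\<integral>\<^sup>+y. ennreal (decay y) * F y \<partial>lborel) < \<infinity>"
proof -
  let ?G = "\<lambda>y. norm (h y) / s"
  let ?F = "\<lambda>y. ennreal (norm (f y) * ?G y)"
  let ?L = "bmo_level TYPE('n)" let ?B = "bmo_moment TYPE('n) (p / (p - 1))"
  have q: "p / (p - 1) > 0" using p by simp
  have I: "(\<integral>\<^sup>+x. ennreal (norm (f x) powr p) \<partial>lborel) = ennreal (LINT x|lborel. norm (f x) powr p)"
    by (rule nn_integral_eq_integral[OF fin]) simp
  have fin': "(\<integral>\<^sup>+x. ennreal (norm (f x) powr p) \<partial>lborel) < \<infinity>" unfolding I by simp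
  note hyps = p bmo_level_pos bmo_moment_nonneg bmo_moment_bound[OF g h AE s q] fin'
  have FG: "F = (\<lambda>y. ennreal s * ?F y)"
    using s by (simp add: fun_eq_iff F_def norm_mult flip: ennreal_mult')
  have pF: "potential F x = ennreal s * potential ?F x" for x
    unfolding FG by (rule potential_cmult) simp
  have "AE x in lborel. potential ?F x < \<infinity>"
    by (rule potential_bound(1)[where p=p and L="?L" and B="?B"]) (use hyps s in simp_all)
  then show "AE x in lborel. potential F x < \<infinity>"
    unfolding pF by eventually_elim (simp add: ennreal_mult_less_top)
  have b: "(\<integral>\<^sup>+x. ennreal (enn2real (potential ?F x) powr p) \<partial>lborel) \<le> ennreal (product_const TYPE('n) p) * (\<integral>\<^sup>+x. ennreal (norm (f x) powr p) \<partial>lborel)"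
    unfolding product_const_def by (rule potential_bound(2)) (use hyps s in simp_all)
  have "ennreal (enn2real (potential F x) powr p) = ennreal (s powr p) * ennreal (enn2real (potential ?F x) powr p)" for x
    unfolding pF enn2real_mult using s by (simp add: powr_mult flip: ennreal_mult')
  then have "(\<integral>\<^sup>+x. ennreal (enn2real (potential F x) powr p) \<partial>lborel) = ennreal (s powr p) * (\<integral>\<^sup>+x. ennreal (enn2real (potential ?F x) powr p) \<partial>lborel)"
    by (simp add: nn_integral_cmult)
  also have "\<dots> \<le> ennreal (s powr p) * (ennreal (product_const TYPE('n) p) * ennreal (LINT x|lborel. norm (f x) powr p))"
    using b unfolding I by (rule mult_left_mono) simp
  also have "\<dots> = ennreal (s powr p * (product_const TYPE('n) p * (LINT x|lborel. norm (f x) powr p)))"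
    by (simp only: ennreal_mult' ennreal_mult'' powr_ge_zero integral_nonneg_AE AE_I2)
  finally show "(\<integral>\<^sup>+x. ennreal (enn2real (potential F x) powr p) \<partial>lborel)
      \<le> ennreal (s powr p * (product_const TYPE('n) p * (LINT x|lborel. norm (f x) powr p)))" .
  have "(\<integral>\<^sup>+y. ennreal (decay (y - 0)) * ?F y \<partial>lborel) < \<infinity>"
    by (rule tail_bound(1)[where a=0 and p=p and L="?L" and B="?B"]) (use hyps s in simp_all)
  then have "ennreal s * (\<integral>\<^sup>+y. ennreal (decay y) * ?F y \<partial>lborel) < \<infinity>"
    by (simp add: ennreal_mult_less_top)
  also have "ennreal s * (\<integral>\<^sup>+y. ennreal (decay y) * ?F y \<partial>lborel) = (\<integral>\<^sup>+y. ennreal (decay y) * F y \<partial>lborel)"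
    unfolding FG by (simp add: mult.left_commute flip: nn_integral_cmult)
  finally show "(\<integral>\<^sup>+y. ennreal (decay y) * F y \<partial>lborel) < \<infinity>" .
qed

lemma model_kernel_even: "model_kernel j (x - y) = model_kernel j (y - x)"
  unfolding model_kernel_def by (simp add: scaleR_diff_right decay_minus_commute)

lemma inv_weight_mult_function_distribution:
  "inv_weight_mult \<phi>0 (function_distribution W) \<phi> =
    (LINT y|lebesgue. W y * fourier (\<lambda>\<xi>. of_real (1 / log_weight \<phi>0 \<xi>) * inv_fourier \<phi> \<xi>) y)"
  by (simp add: inv_weight_mult_def fourier_multiplier_def inv_fourier_dist_def mult_dist_def
      fourier_dist_def function_distribution_def)

text \<open>A fixed choice, so that the final constant depends on the cutoff but not on f and
  g.\<close>

definition kernel_const :: "(real ^ 'n::finite \<Rightarrow> real) \<Rightarrow> real" where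
  "kernel_const \<phi>0 = (SOME C. C \<ge> 0 \<and> (\<forall>j z. norm (kernel \<phi>0 j z) \<le> C * model_kernel j z))"

lemma kernel_const:
  fixes \<phi>0 :: "real ^ 'n::finite \<Rightarrow> real"
  assumes "LP_cutoff \<phi>0"
  shows "kernel_const \<phi>0 \<ge> 0" "norm (kernel \<phi>0 j z) \<le> kernel_const \<phi>0 * model_kernel j z"
proof -
  note kernel_bound[OF assms, folded model_kernel_def]
  from someI_ex[OF this] show "kernel_const \<phi>0 \<ge> 0" "norm (kernel \<phi>0 j z) \<le> kernel_const \<phi>0 * model_kernel j z"
    unfolding kernel_const_def by blast+
qed

text \<open>The representing function R is the convolution of f g with the kernel: the multiplier,
  transposed onto the test function, is moved back to the product by Fubini's theorem. The norm
  bound is stated for every admissible s, so that s can approach twice the bmo norm.\<close>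

lemma product_represented:
  fixes f g :: "real ^ 'n::finite \<Rightarrow> complex" and \<phi>0 :: "real ^ 'n \<Rightarrow> real"
  assumes cutoff: "LP_cutoff \<phi>0" and p: "1 < p" and f: "f \<in> Lp p" and g: "g \<in> bmo"
  shows "tempered_function (\<lambda>x. f x * g x)"
    and "\<exists>R. Lp_represents p (inv_weight_mult \<phi>0 (function_distribution (\<lambda>x. f x * g x))) R \<and>
      (\<forall>s>0. 2 * bmo_norm g \<le> s \<longrightarrow> Lp_norm p R \<le> kernel_const \<phi>0 * product_const TYPE('n) p powr (1 / p) * s * Lp_norm p f)"
proof -
  obtain f' where f' [measurable]: "f' \<in> borel_measurable borel" and f'_AE: "AE x in lborel. f x = f' x"
    and f'_int: "integrable lborel (\<lambda>x. norm (f' x) powr p)"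
    and f'_norm: "(LINT x|lebesgue. norm (f x) powr p) = (LINT x|lborel. norm (f' x) powr p)"
    by (rule Lp_borel_representative[OF f])
  have fm: "f \<in> borel_measurable lebesgue" using f by (simp add: Lp_def)
  have gm: "g \<in> borel_measurable lebesgue" using g by (auto simp: bmo_def intro: locally_integrable_measurable)
  obtain h where h [measurable]: "h \<in> borel_measurable borel" and h_AE: "AE x in lborel. g x = h x"
    by (rule lebesgue_borel_representative[OF gm])
  let ?W = "\<lambda>x. f x * g x" and ?w = "\<lambda>x. f' x * h x"
  have W: "?W \<in> borel_measurable lebesgue" using fm gm by simp
  have W_AE: "AE x in lborel. ?W x = ?w x" using f'_AE h_AE by eventually_elim simp
  define F where "F y = ennreal (norm (f' y * h y))" for y
  have [measurable]: "F \<in> borel_measurable borel" unfolding F_def[abs_def] by measurable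
  have N0: "0 \<le> bmo_norm g" by (rule bmo_cell_bounds(4)[OF g h h_AE])
  define s0 where "s0 = 2 * bmo_norm g + 1"
  have s0: "s0 > 0" "2 * bmo_norm g \<le> s0" using N0 by (simp_all add: s0_def)
  note pb = product_potential_bound[OF g h h_AE _ _ p f' f'_int, folded F_def]
  have pot_fin: "AE x in lborel. potential F x < \<infinity>" by (rule pb(1)[OF s0])
  have dF: "(\<integral>\<^sup>+y. ennreal (decay y) * F y \<partial>lborel) < \<infinity>" by (rule pb(3)[OF s0])
  show "tempered_function ?W"
    by (rule tempered_function_if_decay_integrable[OF W _ W_AE]) (use dF in \<open>simp_all add: F_def\<close>)
  define C where "C = kernel_const \<phi>0"
  have C: "C \<ge> 0" "\<And>j z. norm (kernel \<phi>0 j z) \<le> C * model_kernel j z"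
    unfolding C_def by (rule kernel_const[OF cutoff])+
  have [measurable]: "kernel \<phi>0 j \<in> borel_measurable borel" for j by (rule kernel_measurable[OF cutoff])
  define K where "K z = (\<Sum>j. kernel \<phi>0 j z)" for z
  have [measurable]: "K \<in> borel_measurable borel" unfolding K_def[abs_def] by measurable
  have K_le: "ennreal (norm (K z)) \<le> ennreal C * (\<Sum>j. ennreal (model_kernel j z))" if "z \<noteq> 0" for z
  proof -
    have sm: "summable (\<lambda>j. norm (kernel \<phi>0 j z))" by (rule kernel_summable[OF cutoff that])
    have "ennreal (norm (K z)) \<le> ennreal (\<Sum>j. norm (kernel \<phi>0 j z))"
      unfolding K_def by (intro ennreal_leI summable_norm sm)
    also have "\<dots> = (\<Sum>j. ennreal (norm (kernel \<phi>0 j z)))" by (rule suminf_ennreal2[symmetric]) (simp_all add: sm)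
    also have "\<dots> \<le> (\<Sum>j. ennreal C * ennreal (model_kernel j z))"
      using C by (intro suminf_le) (simp_all add: ennreal_leI flip: ennreal_mult')
    finally show ?thesis by simp
  qed
  have pot: "(\<integral>\<^sup>+y. ennreal (norm (K (x - y))) * F y \<partial>lborel) \<le> ennreal C * potential F x" for x
  proof -
    have "(\<integral>\<^sup>+y. ennreal (norm (K (x - y))) * F y \<partial>lborel) \<le>
      (\<integral>\<^sup>+y. ennreal C * ((\<Sum>j. ennreal (model_kernel j (y - x))) * F y) \<partial>lborel)"
    proof (rule nn_integral_mono_AE)
      show "AE y in lborel. ennreal (norm (K (x - y))) * F y \<le> ennreal C * ((\<Sum>j. ennreal (model_kernel j (y - x))) * F y)"
        using AE_lborel_singleton[of x]
      proof eventually_elim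
        fix y assume "y \<noteq> x"
        then have "ennreal (norm (K (x - y))) * F y \<le> (ennreal C * (\<Sum>j. ennreal (model_kernel j (x - y)))) * F y"
          by (intro mult_right_mono K_le) auto
        then show "ennreal (norm (K (x - y))) * F y \<le> ennreal C * ((\<Sum>j. ennreal (model_kernel j (y - x))) * F y)"
          by (subst (asm) model_kernel_even) (simp only: mult.assoc)
      qed
    qed
    also have "\<dots> = ennreal C * potential F x"
      unfolding potential_def by (rule nn_integral_cmult) simp
    finally show ?thesis .
  qed
  define R where "R x = (LINT y|lborel. K (x - y) * ?w y)" for x
  have R [measurable]: "R \<in> borel_measurable borel" unfolding R_def[abs_def] by measurable
  have R_le: "ennreal (norm (R x)) \<le> ennreal C * potential F x" for x
  proof (cases "integrable lborel (\<lambda>y. K (x - y) * ?w y)")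
    case True
    have "ennreal (norm (R x)) \<le> (\<integral>\<^sup>+y. ennreal (norm (K (x - y) * ?w y)) \<partial>lborel)"
      unfolding R_def by (rule integral_norm_bound_ennreal[OF True])
    also have "\<dots> = (\<integral>\<^sup>+y. ennreal (norm (K (x - y))) * F y \<partial>lborel)"
      unfolding F_def by (subst norm_mult) (simp add: ennreal_mult')
    also have "\<dots> \<le> ennreal C * potential F x" by (rule pot)
    finally show ?thesis .
  next
    \<comment> \<open>Where the integral does not converge, the Bochner integral is 0 and the bound
      remains true.\<close>
    case False
    then show ?thesis by (simp add: R_def not_integrable_integral_eq)
  qed
  have R_powr: "(\<integral>\<^sup>+x. ennreal (norm (R x) powr p) \<partial>lborel)
      \<le> ennreal (C powr p * (s powr p * (product_const TYPE('n) p * (LINT x|lborel. norm (f' x) powr p))))"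
    if s: "s > 0" "2 * bmo_norm g \<le> s" for s
  proof -
    have "(\<integral>\<^sup>+x. ennreal (norm (R x) powr p) \<partial>lborel) \<le> (\<integral>\<^sup>+x. ennreal (C powr p) * ennreal (enn2real (potential F x) powr p) \<partial>lborel)"
    proof (rule nn_integral_mono_AE)
      show "AE x in lborel. ennreal (norm (R x) powr p) \<le> ennreal (C powr p) * ennreal (enn2real (potential F x) powr p)"
        using pot_fin
      proof eventually_elim
        fix x assume "potential F x < \<infinity>"
        then have "potential F x = ennreal (enn2real (potential F x))" by (simp add: ennreal_enn2real_if)
        then have "ennreal (norm (R x)) \<le> ennreal C * ennreal (enn2real (potential F x))" using R_le[of x] by simp
        also have "\<dots> = ennreal (C * enn2real (potential F x))" by (rule ennreal_mult'[symmetric, OF C(1)])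
        finally have "norm (R x) \<le> C * enn2real (potential F x)" using C(1) by (subst (asm) ennreal_le_iff) simp_all
        then have "norm (R x) powr p \<le> (C * enn2real (potential F x)) powr p" using p by (intro powr_mono2) auto
        then have "ennreal (norm (R x) powr p) \<le> ennreal (C powr p * enn2real (potential F x) powr p)"
          unfolding powr_mult by (rule ennreal_leI)
        also have "\<dots> = ennreal (C powr p) * ennreal (enn2real (potential F x) powr p)" by (rule ennreal_mult') simp
        finally show "ennreal (norm (R x) powr p) \<le> ennreal (C powr p) * ennreal (enn2real (potential F x) powr p)" .
      qed
    qed
    also have "\<dots> = ennreal (C powr p) * (\<integral>\<^sup>+x. ennreal (enn2real (potential F x) powr p) \<partial>lborel)"
      by (rule nn_integral_cmult) simp
    also have "\<dots> \<le> ennreal (C powr p) * ennreal (s powr p * (product_const TYPE('n) p * (LINT x|lborel. norm (f' x) powr p)))"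
      by (intro mult_left_mono pb(2) s) simp
    also have "\<dots> = ennreal (C powr p * (s powr p * (product_const TYPE('n) p * (LINT x|lborel. norm (f' x) powr p))))"
      by (rule ennreal_mult'[symmetric]) simp
    finally show ?thesis .
  qed
  have R_int: "integrable lborel (\<lambda>x. norm (R x) powr p)"
    unfolding integrable_iff_bounded
  proof
    have "(\<integral>\<^sup>+x. ennreal (norm (norm (R x) powr p)) \<partial>lborel) \<le>
      ennreal (C powr p * (s0 powr p * (product_const TYPE('n) p * (LINT x|lborel. norm (f' x) powr p))))"
      using R_powr[OF s0] by simp
    also have "\<dots> < \<infinity>" by simp
    finally show "(\<integral>\<^sup>+x. ennreal (norm (norm (R x) powr p)) \<partial>lborel) < \<infinity>" .
  qed simp
  have R_leb: "R \<in> borel_measurable lebesgue" by (simp add: measurable_completion)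
  have R_rep: "(LINT x|lebesgue. norm (R x) powr p) = (LINT x|lborel. norm (R x) powr p)"
    "integrable lebesgue (\<lambda>x. norm (R x) powr p)"
  proof -
    have m: "(\<lambda>x. norm (R x) powr p) \<in> borel_measurable lebesgue" using R_leb by measurable
    show "(LINT x|lebesgue. norm (R x) powr p) = (LINT x|lborel. norm (R x) powr p)"
      by (rule lebesgue_integral_representative(1)[OF m]) simp_all
    show "integrable lebesgue (\<lambda>x. norm (R x) powr p)"
      using lebesgue_integral_representative(2)[OF m, of "\<lambda>x. norm (R x) powr p"] R_int by simp
  qed
  have dist: "inv_weight_mult \<phi>0 (function_distribution ?W) \<phi> = function_distribution R \<phi>" if \<phi>: "\<phi> \<in> schwartz" for \<phi>
  proof -
    have [measurable]: "\<phi> \<in> borel_measurable borel" by (rule schwartz_measurable[OF \<phi>])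
    have \<phi>_leb: "\<phi> \<in> borel_measurable lebesgue" by (simp add: measurable_completion)
    let ?\<psi> = "\<lambda>y. LINT z|lborel. K (z - y) * \<phi> z"
    have \<psi>: "fourier (\<lambda>\<xi>. of_real (1 / log_weight \<phi>0 \<xi>) * inv_fourier \<phi> \<xi>) = ?\<psi>"
      unfolding K_def by (rule ext) (rule weight_multiplier_eq_convolution[OF cutoff \<phi>])
    have [measurable]: "?\<psi> \<in> borel_measurable borel" by measurable
    have \<psi>_leb: "?\<psi> \<in> borel_measurable lebesgue" by (simp add: measurable_completion)
    have "inv_weight_mult \<phi>0 (function_distribution ?W) \<phi> = (LINT y|lborel. ?w y * ?\<psi> y)"
      unfolding inv_weight_mult_function_distribution \<psi>
    proof (rule lebesgue_integral_representative(1))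
      show "(\<lambda>y. ?W y * ?\<psi> y) \<in> borel_measurable lebesgue" using W \<psi>_leb by (rule borel_measurable_times)
      show "AE y in lborel. ?W y * ?\<psi> y = ?w y * ?\<psi> y" using W_AE by eventually_elim simp
    qed simp
    also have "\<dots> = (LINT y|lborel. LINT z|lborel. ?w y * (K (z - y) * \<phi> z))" by simp
    also have "\<dots> = (LINT z|lborel. LINT y|lborel. ?w y * (K (z - y) * \<phi> z))"
    proof (rule integral_lborel_swap)
      define b where "b = schwartz_seminorm 0 [] \<phi>"
      have b: "norm (\<phi> z) \<le> b" for z unfolding b_def by (rule schwartz_bounded[OF \<phi>])
      have b0: "b \<ge> 0" unfolding b_def by (rule schwartz_seminorm_nonneg[OF \<phi>])
      have "(\<integral>\<^sup>+y. \<integral>\<^sup>+z. ennreal (norm (?w y * (K (z - y) * \<phi> z))) \<partial>lborel \<partial>lborel)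
        = (\<integral>\<^sup>+z. \<integral>\<^sup>+y. ennreal (norm (?w y * (K (z - y) * \<phi> z))) \<partial>lborel \<partial>lborel)"
        by (rule lborel_pair.Fubini'[symmetric]) simp
      also have "\<dots> = (\<integral>\<^sup>+z. ennreal (norm (\<phi> z)) * (\<integral>\<^sup>+y. ennreal (norm (K (z - y))) * F y \<partial>lborel) \<partial>lborel)"
      proof (rule nn_integral_cong)
        fix z
        have "ennreal (norm (?w y * (K (z - y) * \<phi> z))) = ennreal (norm (\<phi> z)) * (ennreal (norm (K (z - y))) * F y)" for y
          unfolding F_def by (simp add: norm_mult mult_ac flip: ennreal_mult')
        then show "(\<integral>\<^sup>+y. ennreal (norm (?w y * (K (z - y) * \<phi> z))) \<partial>lborel)
          = ennreal (norm (\<phi> z)) * (\<integral>\<^sup>+y. ennreal (norm (K (z - y))) * F y \<partial>lborel)"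
          by (simp add: nn_integral_cmult)
      qed
      \<comment> \<open>By \<open>t <= 1 + t^p\<close>, |\<phi>| times the potential is at most
        |\<phi>| plus \<open>b\<close> times its p-th power; both have finite integral.\<close>
      also have "\<dots> \<le> (\<integral>\<^sup>+z. ennreal C * (ennreal (norm (\<phi> z)) + ennreal b * ennreal (enn2real (potential F z) powr p)) \<partial>lborel)"
      proof (rule nn_integral_mono_AE)
        show "AE z in lborel. ennreal (norm (\<phi> z)) * (\<integral>\<^sup>+y. ennreal (norm (K (z - y))) * F y \<partial>lborel)
          \<le> ennreal C * (ennreal (norm (\<phi> z)) + ennreal b * ennreal (enn2real (potential F z) powr p))"
          using pot_fin
        proof eventually_elim
          fix z assume "potential F z < \<infinity>"
          define r where "r = enn2real (potential F z)"
          have r: "potential F z = ennreal r" "r \<ge> 0"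
            using \<open>potential F z < \<infinity>\<close> unfolding r_def by (simp_all add: ennreal_enn2real_if)
          have "norm (\<phi> z) * r \<le> norm (\<phi> z) * (1 + r powr p)"
            using p r(2) by (intro mult_left_mono le_1_plus_powr) auto
          also have "\<dots> \<le> norm (\<phi> z) + b * r powr p"
            using b[of z] by (simp add: distrib_left mult_right_mono)
          finally have le: "norm (\<phi> z) * r \<le> norm (\<phi> z) + b * r powr p" .
          have "ennreal (norm (\<phi> z)) * (\<integral>\<^sup>+y. ennreal (norm (K (z - y))) * F y \<partial>lborel)
            \<le> ennreal (norm (\<phi> z)) * (ennreal C * ennreal r)"
            using pot[of z] unfolding r(1) by (rule mult_left_mono) simp
          also have "\<dots> = ennreal C * ennreal (norm (\<phi> z) * r)"
            by (subst ennreal_mult') (simp_all add: mult_ac)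
          also have "\<dots> \<le> ennreal C * ennreal (norm (\<phi> z) + b * r powr p)"
            by (intro mult_left_mono ennreal_leI le) simp
          also have "ennreal (norm (\<phi> z) + b * r powr p) = ennreal (norm (\<phi> z)) + ennreal b * ennreal (r powr p)"
            using b0 by (simp add: ennreal_plus ennreal_mult')
          finally show "ennreal (norm (\<phi> z)) * (\<integral>\<^sup>+y. ennreal (norm (K (z - y))) * F y \<partial>lborel)
            \<le> ennreal C * (ennreal (norm (\<phi> z)) + ennreal b * ennreal (enn2real (potential F z) powr p))"
            unfolding r_def .
        qed
      qed
      also have "\<dots> = ennreal C * ((\<integral>\<^sup>+z. ennreal (norm (\<phi> z)) \<partial>lborel) + ennreal b * (\<integral>\<^sup>+z. ennreal (enn2real (potential F z) powr p) \<partial>lborel))"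
        by (simp add: nn_integral_cmult nn_integral_add)
      also have "\<dots> < \<infinity>"
      proof -
        have "(\<integral>\<^sup>+z. ennreal (norm (\<phi> z)) \<partial>lborel) < \<infinity>"
          using schwartz_integrable[OF \<phi>] by (simp add: integrable_iff_bounded)
        moreover have "(\<integral>\<^sup>+z. ennreal (enn2real (potential F z) powr p) \<partial>lborel) < \<infinity>"
          by (rule le_less_trans[OF pb(2)[OF s0]]) simp
        ultimately show ?thesis by (simp add: ennreal_mult_less_top)
      qed
      finally show "(\<integral>\<^sup>+y. \<integral>\<^sup>+z. ennreal (norm (?w y * (K (z - y) * \<phi> z))) \<partial>lborel \<partial>lborel) < \<infinity>" .
    qed simp
    also have "\<dots> = (LINT z|lborel. R z * \<phi> z)"
    proof (rule Bochner_Integration.integral_cong[OF refl])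
      fix z
      have "(LINT y|lborel. ?w y * (K (z - y) * \<phi> z)) = (LINT y|lborel. (K (z - y) * ?w y) * \<phi> z)"
        by (simp only: mult_ac)
      then show "(LINT y|lborel. ?w y * (K (z - y) * \<phi> z)) = R z * \<phi> z"
        unfolding R_def by (simp only: integral_mult_left_zero)
    qed
    also have "\<dots> = function_distribution R \<phi>"
      unfolding function_distribution_def
      by (rule lebesgue_integral_representative(1)[symmetric]) (use R_leb \<phi>_leb in simp_all)
    finally show ?thesis .
  qed
  have rep: "Lp_represents p (inv_weight_mult \<phi>0 (function_distribution ?W)) R"
    unfolding Lp_represents_def Lp_def using R_leb R_rep(2) dist by blast
  have "Lp_norm p R \<le> C * product_const TYPE('n) p powr (1 / p) * s * Lp_norm p f"
    if s: "s > 0" "2 * bmo_norm g \<le> s" for s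
  proof -
    let ?I = "LINT x|lborel. norm (f' x) powr p"
    have I0: "?I \<ge> 0" by (rule integral_nonneg_AE) simp
    have P0: "product_const TYPE('n) p \<ge> 0"
      unfolding product_const_def potential_const_def dyadic_const_def tail_const_def Let_def using p
      by (intro mult_nonneg_nonneg add_nonneg_nonneg) auto
    have "ennreal (LINT x|lborel. norm (R x) powr p) \<le> ennreal (C powr p * (s powr p * (product_const TYPE('n) p * ?I)))"
      using R_powr[OF s] nn_integral_eq_integral[OF R_int] by simp
    then have "(LINT x|lborel. norm (R x) powr p) \<le> C powr p * (s powr p * (product_const TYPE('n) p * ?I))"
      using I0 P0 by (subst (asm) ennreal_le_iff) (auto intro!: mult_nonneg_nonneg)
    then have "Lp_norm p R \<le> (C powr p * (s powr p * (product_const TYPE('n) p * ?I))) powr (1 / p)"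
      unfolding Lp_norm_def R_rep(1) using p by (intro powr_mono2) (auto intro!: integral_nonneg_AE)
    also have "\<dots> = C * (s * (product_const TYPE('n) p powr (1 / p) * ?I powr (1 / p)))"
      using C(1) s(1) p by (simp add: powr_mult powr_powr)
    finally show ?thesis unfolding Lp_norm_def f'_norm by (simp only: mult_ac)
  qed
  then show "\<exists>R. Lp_represents p (inv_weight_mult \<phi>0 (function_distribution ?W)) R \<and>
      (\<forall>s>0. 2 * bmo_norm g \<le> s \<longrightarrow> Lp_norm p R \<le> kernel_const \<phi>0 * product_const TYPE('n) p powr (1 / p) * s * Lp_norm p f)"
    using rep unfolding C_def by blast
qed

theorem corollary6p2:
  fixes \<phi>0 :: "real ^ 'n::finite \<Rightarrow> real" and p :: real
  assumes "LP_cutoff \<phi>0" and "1 < p"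
  shows "\<exists>C>0. \<forall>f\<in>Lp p. \<forall>g\<in>bmo.
           tempered_function (\<lambda>x. f x * g x) \<and>
           function_distribution (\<lambda>x. f x * g x) \<in> J_space \<phi>0 p \<and>
           J_norm \<phi>0 p (function_distribution (\<lambda>x. f x * g x)) \<le> C * Lp_norm p f * bmo_norm g"
proof -
  define c where "c = kernel_const \<phi>0 * product_const TYPE('n) p powr (1 / p)"
  have c: "c \<ge> 0" unfolding c_def using kernel_const(1)[OF assms(1)] by simp
  show ?thesis
  proof (intro exI[of _ "2 * c + 1"] conjI ballI)
    \<comment> \<open>The 2 is the ratio between the least admissible s and the bmo norm; the
      summand 1 only makes the constant positive, as c may be 0.\<close>
    show "0 < 2 * c + 1" using c by simp
    fix f g :: "real ^ 'n \<Rightarrow> complex" assume f: "f \<in> Lp p" and g: "g \<in> bmo"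
    let ?T = "function_distribution (\<lambda>x. f x * g x)"
    show tf: "tempered_function (\<lambda>x. f x * g x)" by (rule product_represented(1)[OF assms f g])
    obtain R where R: "Lp_represents p (inv_weight_mult \<phi>0 ?T) R"
      and R_norm: "\<And>s. s > 0 \<Longrightarrow> 2 * bmo_norm g \<le> s \<Longrightarrow> Lp_norm p R \<le> c * s * Lp_norm p f"
      using product_represented(2)[OF assms f g] unfolding c_def by blast
    show "?T \<in> J_space \<phi>0 p" using tf R unfolding J_space_def tempered_function_def by blast
    have "Lp_represents p (inv_weight_mult \<phi>0 ?T) (SOME h. Lp_represents p (inv_weight_mult \<phi>0 ?T) h)"
      by (rule someI[of "\<lambda>h. Lp_represents p (inv_weight_mult \<phi>0 ?T) h", OF R])
    then have J: "J_norm \<phi>0 p ?T = Lp_norm p R"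
      unfolding J_norm_def Lp_norm_dist_def
      by (rule Lp_representative_unique[OF assms(1) less_imp_le[OF assms(2)] _ R])
    have F0: "0 \<le> Lp_norm p f" unfolding Lp_norm_def by simp
    have N0: "0 \<le> bmo_norm g"
    proof -
      have "g \<in> borel_measurable lebesgue" using g by (auto simp: bmo_def intro: locally_integrable_measurable)
      then obtain h where "h \<in> borel_measurable borel" "AE x in lborel. g x = h x"
        by (rule lebesgue_borel_representative)
      then show ?thesis by (rule bmo_cell_bounds(4)[OF g])
    qed
    \<comment> \<open>The value s = 2 \<open>bmo_norm g\<close> may be 0 and hence inadmissible, so
      it is approached from above; d is chosen so that the excess costs at most e.\<close>
    have "Lp_norm p R \<le> 2 * c * Lp_norm p f * bmo_norm g"
    proof (rule field_le_epsilon)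
      fix e :: real assume e: "e > 0"
      define d where "d = e / (c * Lp_norm p f + 1)"
      have pos: "c * Lp_norm p f + 1 > 0" using c F0 by (simp add: add_nonneg_pos)
      have d: "d > 0" "c * Lp_norm p f * d \<le> e"
      proof -
        show "d > 0" unfolding d_def using e pos by simp
        have "c * Lp_norm p f * d \<le> (c * Lp_norm p f + 1) * d" using \<open>d > 0\<close> by (simp add: distrib_right)
        also have "\<dots> = e" unfolding d_def using pos by simp
        finally show "c * Lp_norm p f * d \<le> e" .
      qed
      have "Lp_norm p R \<le> c * (2 * bmo_norm g + d) * Lp_norm p f"
        by (rule R_norm) (use N0 d in simp_all)
      then show "Lp_norm p R \<le> 2 * c * Lp_norm p f * bmo_norm g + e"
        using d(2) by (simp add: distrib_left distrib_right mult_ac)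
    qed
    also have "\<dots> \<le> (2 * c + 1) * Lp_norm p f * bmo_norm g"
      using F0 N0 by (simp add: distrib_right)
    finally show "J_norm \<phi>0 p ?T \<le> (2 * c + 1) * Lp_norm p f * bmo_norm g" unfolding J .
  qed
qed

end
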